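(* Let the data and the discretization satisfy all assumptions listed in the context. Let $m:=\min\{\theta_{\rm ext},\operatorname{ess\,inf}(\theta_{\rm init})\}$ and, for each $\nu\in\{0,\dots,N\}$, $$M_\nu:=\max\{\theta_{\rm ext},\|\theta_{\rm init}\|_{L^\infty(\Omega)}\}+\frac{t_\nu}{C_\varepsilon}\sum_{p\in\{\mathrm s,\mathrm g\}}\|f_p\|_{L^\infty(]0,t_\nu[\times\Omega_p)}$$ (the second term being $0$ for $\nu=0$). Consider the finite volume scheme of finding $(\mathbf u_0,\dots,\mathbf u_N)$, $\mathbf u_\nu=(u_{\nu,i})_{i\in I}\in(\mathbb R^+_0)^I$, such that $$u_{0,i}=\theta_{{\rm init},i}\ \ (i\in I),\qquad \mathcal H_{\nu,i}(\mathbf u_{\nu-1},\mathbf u_\nu)=0\ \ (i\in I,\ \nu\in\{1,\dots,N\}).\tag{$*$}$$ If $(\mathbf u_0,\dots,\mathbf u_N)\in(\mathbb R^+_0)^{I\times\{0,\dots,N\}}$ is a solution to $( * )$, then $\mathbf u_\nu\in[m,M_\nu]^I$ for each $\nu\in\{0,\dots,N\}$. Furthermore, if $$k_\nu\Big((L_{V,\Gamma_\Omega}+L_{V,\partial\Omega\setminus\Gamma_\Omega}+L_{V,\Sigma})\,l_g^1(M_\nu)+(L_{V,\Gamma_\Omega}+L_{V,\Sigma})\,l_g^2(M_\nu)+L_{V,\partial\Omega\setminus\Gamma_\Omega}\,l_g^3(M_\nu)\Big)<C_\varepsilon\quad\text{for all }\nu\in\{1,\dots,N\},\tag{$**$}$$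 then $( * )$ has a unique solution $(\mathbf u_0,\dots,\mathbf u_N)\in(\mathbb R^+_0)^{I\times\{0,\dots,N\}}$. A sufficient condition for $( ** )$ is $$\max\{k_\nu:\nu\in\{1,\dots,N\}\}\Big((L_{V,\Gamma_\Omega}+L_{V,\partial\Omega\setminus\Gamma_\Omega}+L_{V,\Sigma})\,l_g^1(M_N)+(L_{V,\Gamma_\Omega}+L_{V,\Sigma})\,l_g^2(M_N)+L_{V,\partial\Omega\setminus\Gamma_\Omega}\,l_g^3(M_N)\Big)<C_\varepsilon.$$
   Context: Notation: $\mathbb R^+=(0,\infty)$, $\mathbb R^+_0=[0,\infty)$; $\lambda_d$ is $d$-dimensional (surface) measure; $\|\cdot\|_2$ is the Euclidean norm. A partition of a polyhedral set consists of finitely many (relatively) open, pairwise disjoint pieces which cover it up to boundaries of the pieces. Domain: $T>0$, $\overline\Omega=\overline\Omega_{\mathrm s}\cup\overline\Omega_{\mathrm g}$, $\Omega_{\mathrm s}\cap\Omega_{\mathrm g}=\emptyset$, where $\Omega,\Omega_{\mathrm s},\Omega_{\mathrm g}$ are nonvoid, polyhedral, bounded, open subsets of $\mathbb R^3$; $\partial\Omega_{\mathrm s}$ is the disjoint union of $\partial\Omega$ and $\partial\Omega_{\mathrm g}$. Put $\Sigma:=\partial\Omega_{\mathrm g}=\overline\Omega_{\mathrm s}\cap\overline\Omega_{\mathrm g}$ (a Lipschitz interface), so $\partial\Omega=\partial\Omega_{\mathrm s}\setminus\Sigma$. Put $O:=\mathrm{int}(\mathrm{conv}(\overline\Omega))\setminus\overline\Omega$,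 $\Gamma:=\partial O$, $\Gamma_\Omega:=\overline\Omega\cap\overline O$, $\Gamma_{\rm ph}:=\partial\,\mathrm{conv}(\overline\Omega)\cap\partial O$; $\Gamma_\Omega,\Gamma_{\rm ph}$ partition $\Gamma$. Data: for $m\in\{\mathrm s,\mathrm g\}$, $\varepsilon_m:\mathbb R^+_0\to\mathbb R^+_0$ is continuous and there is $C_\varepsilon\in\mathbb R^+$ with $\varepsilon_m(\theta_2)\ge(\theta_2-\theta_1)C_\varepsilon+\varepsilon_m(\theta_1)$ for $\theta_2\ge\theta_1\ge0$; $\kappa_m\in\mathbb R^+_0$; $f_m\in L^\infty(]0,T[\times\Omega_m)$, $f_m\ge0$ a.e.; $\sigma\in\mathbb R^+$; $\theta_{\rm ext}\in\mathbb R^+$; $\theta_{\rm init}\in L^\infty(\Omega,\mathbb R^+)$. The emissivity $\epsilon:\mathbb R^+_0\to\,]0,1]$ is locally Lipschitz: for each $r\ge0$, $L_{\epsilon,r}:=\sup\{|\epsilon(\theta_1)-\epsilon(\theta_2)|/|\theta_1-\theta_2|:\theta_1,\theta_2\in[0,r],\theta_1\ne\theta_2\}<\infty$ ($L_{\epsilon,0}:=0$). Put $\epsilon_{\min,r}:=\min_{[0,r]}\epsilon>0$. The negative variation is $\mathrm{var}^-\epsilon(0):=0$ and, for $\lambda>0$, $\mathrm{var}^-\epsilon(\lambda):=\sup\sum_{l=1}^n\big(-\min\{0,\epsilon(s_l)-\epsilon(s_{l-1})\}\big)$ over all $0=s_0<\dots<s_n=\lambda$. Discretization: $0=t_0<\dots<t_N=T$,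 $N\in\mathbb N$, $k_\nu:=t_\nu-t_{\nu-1}$. $(\omega_i)_{i\in I}$ is a finite partition of $\Omega$ into nonvoid, polyhedral, connected, open subsets; $\omega_{m,i}:=\omega_i\cap\Omega_m$, $I_m:=\{j\in I:\omega_{m,j}\ne\emptyset\}$. For each $i\in I$, $\partial_{\rm reg}\omega_{\mathrm s,i}\cap\Sigma=\partial_{\rm reg}\omega_{\mathrm g,i}\cap\Sigma$, where $\partial_{\rm reg}$ is the part of the boundary where a unique outer unit normal exists ($\partial_{\rm reg}\emptyset=\emptyset$). Points $x_i\in\overline\omega_i$ are given such that: $x_i\in\overline\omega_{m,i}$ for $i\in I_m$; if $\lambda_2(\overline\omega_i\cap\Gamma_\Omega)\ne0$, then $x_i\in\overline\omega_i\cap\Gamma_\Omega$; if $\lambda_2(\overline\omega_i\cap(\partial\Omega\setminus\Gamma_\Omega))\ne0$, then $x_i\in\overline\omega_i\cap\overline{\partial\Omega\setminus\Gamma_\Omega}$. Put $\mathrm{nb}_m(i):=\{j\in I_m\setminus\{i\}:\lambda_2(\partial\omega_{m,i}\cap\partial\omega_{m,j})\ne0\}$, $\mathrm{nb}(i):=\{j\in I\setminus\{i\}:\lambda_2(\partial\omega_i\cap\partial\omega_j)\ne0\}$; for $i\in I$, $j\in\mathrm{nb}(i)$: $x_i\ne x_j$ and $(x_j-x_i)/\|x_i-x_j\|_2$ equals the outer unit normal of $\omega_i$ on $\partial\omega_i\cap\partial\omega_j$. Boundary elements: $(\zeta_\alpha)_{\alpha\in I_\Omega}$ and $(\zeta_\alpha)_{\alpha\in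 I_\Sigma}$ are finite partitions of $\Gamma_\Omega$ and $\Sigma$, respectively, into nonvoid, polyhedral, connected, relatively open sets, each lying in a plane; $I_\Omega\cap I_\Sigma=\emptyset$, $\mathrm{ph}\notin I_\Omega\cup I_\Sigma$; $\zeta_{\rm ph}:=\Gamma_{\rm ph}$, $I_\Gamma:=I_\Omega\cup\{\mathrm{ph}\}$. For each $\alpha\in I_\Omega$ (resp. $I_\Sigma$) there is a unique $i(\alpha)\in I$ with $\zeta_\alpha\subseteq\partial\omega_{i(\alpha)}\cap\Gamma_\Omega$ (resp. $\zeta_\alpha\subseteq\partial\omega_{\mathrm s,i(\alpha)}\cap\Sigma$); moreover $x_{i(\alpha)}\in\overline\zeta_\alpha$. Put $J_{\Omega,i}:=\{\alpha\in I_\Omega:\lambda_2(\zeta_\alpha\cap\partial\omega_i)\ne0\}$, $J_{\Sigma,i}:=\{\alpha\in I_\Sigma:\lambda_2(\zeta_\alpha\cap\partial\omega_{\mathrm s,i})\ne0\}$. View factors: for $(S,D)=(\Sigma,\Omega_{\mathrm g})$ or $(\Gamma,O)$ let $\vec n$ be the a.e. defined unit normal on $S=\partial D$ pointing into $D$, $\omega(x,y):=\dfrac{(\vec n(y)\cdot(x-y))\,(\vec n(x)\cdot(y-x))}{\pi\,((y-x)\cdot(y-x))^2}$, and $\Lambda(x,y):=1$ if $x,y\in S$ are mutually visible, i.e. the open segment $]x,y[$ is contained in $D$, and $\Lambda(x,y):=0$ otherwise. For $(\alpha,\beta)\in(I_\Sigma\times I_\Sigma)\cup(I_\Gamma\times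 I_\Gamma)$ put $\Lambda_{\alpha,\beta}:=\int_{\zeta_\alpha\times\zeta_\beta}\Lambda\,\omega$. These numbers are nonnegative and symmetric, with $\sum_{\beta\in I_\Sigma}\Lambda_{\alpha,\beta}=\lambda_2(\zeta_\alpha)$ for $\alpha\in I_\Sigma$ and $\sum_{\beta\in I_\Gamma}\Lambda_{\alpha,\beta}=\lambda_2(\zeta_\alpha)$ for $\alpha\in I_\Gamma$. Discrete radiation operators: for $\mathbf u\in(\mathbb R^+_0)^{I_\Omega}$ (resp. $(\mathbb R^+_0)^{I_\Sigma}$) let $E_{\Gamma,\alpha}(\mathbf u)$ (resp. $E_{\Sigma,\alpha}(\mathbf u)$) $:=\sigma\epsilon(u_\alpha)u_\alpha^4\lambda_2(\zeta_\alpha)$; for $\alpha\in I_\Omega$, $E_{{\rm ph},\alpha}(\mathbf u):=\sigma(1-\epsilon(u_\alpha))\theta_{\rm ext}^4\Lambda_{\alpha,{\rm ph}}$; $G_{\Gamma,\alpha,\beta}(\mathbf u)$ (for $\alpha,\beta\in I_\Omega$), resp. $G_{\Sigma,\alpha,\beta}(\mathbf u)$ (for $\alpha,\beta\in I_\Sigma$), is $\delta_{\alpha\beta}\lambda_2(\zeta_\alpha)-(1-\epsilon(u_\alpha))\Lambda_{\alpha,\beta}$. The matrices $\mathbf G_\Gamma(\mathbf u),\mathbf G_\Sigma(\mathbf u)$ are strictly diagonally dominant, hence invertible. Put $\mathbf R_\Gamma(\mathbf u):=\mathbf G_\Gamma(\mathbf u)^{-1}(\mathbf E_\Gamma(\mathbf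 u)+\mathbf E_{\rm ph}(\mathbf u))$, $\mathbf R_\Sigma(\mathbf u):=\mathbf G_\Sigma(\mathbf u)^{-1}\mathbf E_\Sigma(\mathbf u)$, $V_{\Gamma,\alpha}(\mathbf u):=\epsilon(u_\alpha)\sum_{\beta\in I_\Omega}R_{\Gamma,\beta}(\mathbf u)\Lambda_{\alpha,\beta}+\sigma\epsilon(u_\alpha)\theta_{\rm ext}^4\Lambda_{\alpha,{\rm ph}}$ ($\alpha\in I_\Omega$), $V_{\Sigma,\alpha}(\mathbf u):=\epsilon(u_\alpha)\sum_{\beta\in I_\Sigma}R_{\Sigma,\beta}(\mathbf u)\Lambda_{\alpha,\beta}$ ($\alpha\in I_\Sigma$). For $\mathbf u\in(\mathbb R^+_0)^I$: $\mathbf u|_{I_\Omega}:=(u_{i(\alpha)})_{\alpha\in I_\Omega}$, $\mathbf u|_{I_\Sigma}:=(u_{i(\alpha)})_{\alpha\in I_\Sigma}$. Source and initial approximations: $f_{m,\nu,i}$ and $\theta_{{\rm init},i}$ are given real numbers with $0\le\operatorname{ess\,inf}(f_m|_{]t_{\nu-1},t_\nu[\times\omega_{m,i}})\le f_{m,\nu,i}\le\|f_m\|_{L^\infty(]t_{\nu-1},t_\nu[\times\omega_{m,i})}$ for $m\in\{\mathrm s,\mathrm g\}$, $\nu\in\{1,\dots,N\}$, $i\in I_m$ (terms with $\omega_{m,i}=\emptyset$ contribute $0$), and $0\le\operatorname{ess\,inf}(\theta_{\rm init}|_{\omega_i})\le\theta_{{\rm init},i}\le\|\theta_{\rm init}\|_{L^\infty(\omega_i)}$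 for $i\in I$. Scheme operator: for $\nu\in\{1,\dots,N\}$, $i\in I$, $\mathcal H_{\nu,i}:(\mathbb R^+_0)^I\times(\mathbb R^+_0)^I\to\mathbb R$, $$\begin{aligned}\mathcal H_{\nu,i}(\tilde{\mathbf u},\mathbf u)=\;&k_\nu^{-1}\sum_{m\in\{\mathrm s,\mathrm g\}}(\varepsilon_m(u_i)-\varepsilon_m(\tilde u_i))\lambda_3(\omega_{m,i})-\sum_{m\in\{\mathrm s,\mathrm g\}}\kappa_m\sum_{j\in\mathrm{nb}_m(i)}\frac{u_j-u_i}{\|x_i-x_j\|_2}\lambda_2(\partial\omega_{m,i}\cap\partial\omega_{m,j})\\&+\sigma\epsilon(u_i)u_i^4\lambda_2(\partial\omega_{\mathrm s,i}\cap\Gamma_\Omega)-\sum_{\alpha\in J_{\Omega,i}}V_{\Gamma,\alpha}(\mathbf u|_{I_\Omega})\\&+\sigma\epsilon(u_i)(u_i^4-\theta_{\rm ext}^4)\lambda_2(\partial\omega_{\mathrm s,i}\cap(\partial\Omega\setminus\Gamma_\Omega))\\&+\sigma\epsilon(u_i)u_i^4\lambda_2(\omega_i\cap\Sigma)-\sum_{\alpha\in J_{\Sigma,i}}V_{\Sigma,\alpha}(\mathbf u|_{I_\Sigma})-\sum_{m\in\{\mathrm s,\mathrm g\}}f_{m,\nu,i}\lambda_3(\omega_{m,i}).\end{aligned}$$ Constants: $L_{V,\Gamma_\Omega}:=\sigma\max_{i\in I}\lambda_2(\partial\omega_{\mathrm s,i}\cap\Gamma_\Omega)/\lambda_3(\omega_i)$;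 $L_{V,\partial\Omega\setminus\Gamma_\Omega}:=\sigma\max_{i\in I}\lambda_2(\partial\omega_{\mathrm s,i}\cap(\partial\Omega\setminus\Gamma_\Omega))/\lambda_3(\omega_i)$; $L_{V,\Sigma}:=\sigma\max_{i\in I}\lambda_2(\omega_i\cap\Sigma)/\lambda_3(\omega_i)$; for $r\ge0$: $l_g^1(r):=4\,\mathrm{var}^-\epsilon(r)\,r^3+L_{\epsilon,r}r^4$, $l_g^2(r):=4\epsilon_{\min,r}^{-1}r^3+\max\{r^4,\theta_{\rm ext}^4\}L_{\epsilon,r}(2\epsilon_{\min,r}^{-1}+1)$, $l_g^3(r):=L_{\epsilon,r}\theta_{\rm ext}^4$. *)

theory Defs
  imports "HOL-Analysis.Analysis" "HOL-Probability.Essential_Supremum"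
begin

definition planes :: "(real^3) set set" where
  "planes = {P. affine P \<and> aff_dim P = 2}"

text \<open>The area on a plane is the image of the Lebesgue measure under an isometric
  parametrization; it does not depend on the parametrization (\<open>plane_area_range\<close> below).\<close>

definition plane_area :: "(real^3) set \<Rightarrow> (real^3) measure" where
  "plane_area P = distr lborel borel
     (SOME \<phi> :: real^2 \<Rightarrow> real^3. (\<forall>x y. dist (\<phi> x) (\<phi> y) = dist x y) \<and> range \<phi> = P)"

text \<open>Surface measure on subsets of finite unions of planes: the areas of the traces on all planes
  are added up. Two distinct planes meet in a null set, so nothing is counted twice, and for
  such sets this is two-dimensional Hausdorff measure. (Curved surfaces, which do not occur
  below, would get measure zero.)\<close>

definition surface_measure :: "(real^3) measure" where
  "surface_measure =
     measure_of UNIV (sets borel) (\<lambda>A. \<integral>\<^sup>+P. emeasure (plane_area P) A \<partial>count_space planes)"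

abbreviation area :: "(real^3) set \<Rightarrow> real" where
  "area A \<equiv> measure surface_measure A"

abbreviation volume :: "(real^3) set \<Rightarrow> real" where
  "volume A \<equiv> measure lborel A"

lemma space_surface_measure [simp]: "space surface_measure = UNIV"
  by (simp add: surface_measure_def)

lemma sets_surface_measure [simp, measurable_cong]: "sets surface_measure = sets borel"
  using sets.sigma_sets_eq[of "borel :: (real^3) measure"] by (simp add: surface_measure_def)

lemma sets_plane_area [simp, measurable_cong]: "sets (plane_area P) = sets borel"
  by (simp add: plane_area_def)

lemma emeasure_surface_measure:
  assumes "A \<in> sets borel"
  shows "emeasure surface_measure A = (\<integral>\<^sup>+P. emeasure (plane_area P) A \<partial>count_space planes)"
proof (rule emeasure_measure_of[OF surface_measure_def])
  show "countably_additive (sets surface_measure)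
     (\<lambda>A. \<integral>\<^sup>+P. emeasure (plane_area P) A \<partial>count_space planes)"
  proof (rule countably_additiveI)
    fix B :: "nat \<Rightarrow> (real^3) set"
    assume B: "range B \<subseteq> sets surface_measure" "disjoint_family B" "(\<Union>i. B i) \<in> sets surface_measure"
    have "(\<Sum>i. \<integral>\<^sup>+P. emeasure (plane_area P) (B i) \<partial>count_space planes)
        = (\<integral>\<^sup>+P. (\<Sum>i. emeasure (plane_area P) (B i)) \<partial>count_space planes)"
      by (rule nn_integral_suminf[symmetric]) simp
    also have "\<dots> = (\<integral>\<^sup>+P. emeasure (plane_area P) (\<Union>i. B i) \<partial>count_space planes)"
      using B by (intro nn_integral_cong suminf_emeasure) auto
    finally show "(\<Sum>i. \<integral>\<^sup>+P. emeasure (plane_area P) (B i) \<partial>count_space planes)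
        = (\<integral>\<^sup>+P. emeasure (plane_area P) (\<Union>i. B i) \<partial>count_space planes)" .
  qed
qed (use assms in \<open>auto simp: positive_def\<close>)

lemma isometry_imp_lborel:
  fixes g :: "real^2 \<Rightarrow> real^2"
  assumes "\<And>x y. dist (g x) (g y) = dist x y"
  shows "distr lborel borel g = lborel"
proof -
  define f where "f = (\<lambda>x. g x - g 0)"
  have f: "orthogonal_transformation f"
    unfolding orthogonal_transformation_isometry f_def using assms by (auto simp: dist_norm)
  have finv: "orthogonal_transformation (inv f)"
    by (rule orthogonal_transformation_inv[OF f])
  have bij: "bij f" using f by (rule orthogonal_transformation_bij)
  have cont: "continuous_on UNIV g"
    using assms by (auto simp: continuous_on_iff)
  then have meas: "g \<in> borel_measurable lborel"
    using borel_measurable_continuous_onI by auto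
  show ?thesis
  proof (rule lborel_eqI[symmetric])
    fix l u :: "real^2" assume lu: "\<And>b. b \<in> Basis \<Longrightarrow> l \<bullet> b \<le> u \<bullet> b"
    have img: "g -` box l u = inv f ` ((\<lambda>x. x - g 0) ` box l u)"
    proof -
      have "g x \<in> box l u \<longleftrightarrow> f x \<in> (\<lambda>x. x - g 0) ` box l u" for x
        by (auto simp: f_def image_iff)
      then have "g -` box l u = f -` ((\<lambda>x. x - g 0) ` box l u)" by auto
      also have "\<dots> = inv f ` ((\<lambda>x. x - g 0) ` box l u)"
        by (rule bij_vimage_eq_inv_image[OF bij])
      finally show ?thesis .
    qed
    have lm: "(\<lambda>x. x - g 0) ` box l u \<in> lmeasurable"
      using measurable_translation_subtract lmeasurable_box by blast
    have "emeasure (distr lborel borel g) (box l u) = emeasure lborel (g -` box l u)"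
      using meas by (simp add: emeasure_distr)
    also have "\<dots> = emeasure lebesgue (inv f ` ((\<lambda>x. x - g 0) ` box l u))"
    proof -
      have "g -` box l u \<in> sets lborel"
        using measurable_sets[OF meas, of "box l u"] by simp
      then show ?thesis
        unfolding img[symmetric] by simp
    qed
    also have "\<dots> = ennreal (measure lebesgue (inv f ` ((\<lambda>x. x - g 0) ` box l u)))"
      by (rule emeasure_eq_measure2[OF measurable_orthogonal_image[OF finv lm]])
    also have "measure lebesgue (inv f ` ((\<lambda>x. x - g 0) ` box l u)) = measure lebesgue (box l u)"
      using measure_orthogonal_image[OF finv lm] measure_translation_subtract by metis
    also have "ennreal \<dots> = emeasure lborel (box l u)"
      by (simp add: emeasure_eq_measure2)
    finally show "emeasure (distr lborel borel g) (box l u) = (\<Prod>b\<in>Basis. (u - l) \<bullet> b)"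
      using lu by simp
  qed simp
qed

lemma plane_parametrization:
  assumes "P \<in> planes"
  obtains f :: "real^2 \<Rightarrow> real^3" and a where "linear f"
    "\<And>x y. dist (f x + a) (f y + a) = dist x y" "range (\<lambda>x. f x + a) = P"
proof -
  have P: "affine P" "aff_dim P = 2" using assms by (auto simp: planes_def)
  then obtain a where a: "a \<in> P" by fastforce
  define V where "V = (\<lambda>x. x - a) ` P"
  have "subspace V"
    using affine_diffs_subspace_subtract[OF P(1) a] by (simp add: V_def)
  moreover have "dim V = 2"
    using aff_dim_dim_affine_diffs[OF P(1) a] P(2) by (simp add: V_def)
  ultimately obtain f :: "real^2 \<Rightarrow> real^3"
    where f: "linear f" "f ` UNIV = V" "\<And>x. norm (f x) = norm x"
    using isometry_subspaces[of "UNIV :: (real^2) set" V] by auto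
  have "dist (f x + a) (f y + a) = dist x y" for x y
    using f(3)[of "x - y"] linear_diff[OF f(1), of x y] by (simp add: dist_norm)
  moreover have "range (\<lambda>x. f x + a) = P"
  proof -
    have "range (\<lambda>x. f x + a) = (\<lambda>v. v + a) ` V" using f(2) by auto
    also have "\<dots> = P" by (force simp: V_def)
    finally show ?thesis .
  qed
  ultimately show ?thesis by (rule that[OF f(1)])
qed

lemma plane_area_range:
  fixes \<phi> :: "real^2 \<Rightarrow> real^3"
  assumes \<phi>: "\<And>x y. dist (\<phi> x) (\<phi> y) = dist x y"
  shows "plane_area (range \<phi>) = distr lborel borel \<phi>"
proof -
  let ?Q = "\<lambda>\<psi> :: real^2 \<Rightarrow> real^3. (\<forall>x y. dist (\<psi> x) (\<psi> y) = dist x y) \<and> range \<psi> = range \<phi>"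
  define \<psi> where "\<psi> = (SOME \<psi>. ?Q \<psi>)"
  have Q: "?Q \<psi>" unfolding \<psi>_def by (rule someI[of ?Q \<phi>]) (use assms in auto)
  have inj: "inj \<phi>" by (rule injI) (metis assms dist_eq_0_iff)
  define g where "g = inv \<phi> \<circ> \<psi>"
  have g: "\<phi> (g x) = \<psi> x" for x
    using Q by (metis comp_apply f_inv_into_f g_def rangeI)
  have "dist (g x) (g y) = dist x y" for x y
    by (metis Q assms g)
  then have "distr lborel borel g = lborel" "g \<in> borel_measurable borel"
    by (auto simp: isometry_imp_lborel continuous_on_iff intro!: borel_measurable_continuous_onI)
  moreover have "\<phi> \<in> borel_measurable borel"
    using assms by (auto simp: continuous_on_iff intro!: borel_measurable_continuous_onI)
  moreover have "\<psi> = \<phi> \<circ> g" using g by auto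
  ultimately have "distr lborel borel \<psi> = distr lborel borel \<phi>"
    by (metis distr_distr measurable_lborel1 measurable_lborel2)
  then show ?thesis by (simp add: plane_area_def \<psi>_def)
qed

lemma plane_eq_hyperplane:
  assumes "P \<in> planes"
  obtains n c where "P = {y. n \<bullet> y = c}" "n \<noteq> 0"
proof -
  have "affine P" and dim: "aff_dim P = int (DIM(real^3) - 1)" using assms by (auto simp: planes_def)
  from iffD1[OF aff_dim_eq_hyperplane dim]
  obtain n c where "n \<noteq> 0" and hull: "affine hull P = {y. n \<bullet> y = c}" by auto
  have "affine hull P = P" using \<open>affine P\<close> by (simp only: affine_hull_eq)
  from this[symmetric] have "P = {y. n \<bullet> y = c}" unfolding hull .
  then show ?thesis using \<open>n \<noteq> 0\<close> by (rule that)
qed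

lemma emeasure_plane_area_Int:
  assumes P: "P \<in> planes" and Q: "Q \<in> planes" and "P \<noteq> Q"
  shows "emeasure (plane_area Q) P = 0"
proof -
  obtain n c where P_eq: "P = {y. n \<bullet> y = c}" and "n \<noteq> 0" by (rule plane_eq_hyperplane[OF P])
  obtain f :: "real^2 \<Rightarrow> real^3" and a where f: "linear f"
    "\<And>x y. dist (f x + a) (f y + a) = dist x y" "range (\<lambda>x. f x + a) = Q"
    by (rule plane_parametrization[OF Q]) (rule that)
  define m where "m = adjoint f n"
  have pre: "(\<lambda>x. f x + a) -` P = {x. m \<bullet> x = c - n \<bullet> a}"
    using adjoint_works[OF f(1)] by (auto simp: P_eq m_def inner_right_distrib inner_commute algebra_simps)
  have "emeasure lborel {x. m \<bullet> x = c - n \<bullet> a} = 0"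
  proof (cases "m = 0 \<and> c - n \<bullet> a = 0")
    case True
    then have "Q \<subseteq> P" using pre f(3) by auto
    moreover have "affine P" "affine Q" "aff_dim P = aff_dim Q" "Q \<noteq> {}"
      using P Q by (auto simp: planes_def)
    ultimately have "P = Q" using affine_dim_equal[of Q P] by auto
    then show ?thesis using \<open>P \<noteq> Q\<close> by simp
  next
    case False
    then have "negligible {x. m \<bullet> x = c - n \<bullet> a}"
      by (intro negligible_hyperplane) auto
    moreover have "{x. m \<bullet> x = c - n \<bullet> a} \<in> sets borel"
      by (intro borel_closed closed_hyperplane)
    ultimately show ?thesis
      by (simp add: negligible_iff_null_sets null_sets_def)
  qed
  moreover have "(\<lambda>x. f x + a) \<in> borel_measurable borel"
    using f(2) by (auto simp: continuous_on_iff intro!: borel_measurable_continuous_onI)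
  moreover have "P \<in> sets borel"
    unfolding P_eq by (intro borel_closed closed_hyperplane)
  ultimately show ?thesis
    using plane_area_range[of "\<lambda>x. f x + a", OF f(2)] by (simp add: f(3) emeasure_distr pre)
qed

lemma emeasure_surface_measure_plane:
  assumes P: "P \<in> planes" and A: "A \<in> sets borel" "A \<subseteq> P"
  shows "emeasure surface_measure A = emeasure (plane_area P) A"
proof -
  have "emeasure (plane_area Q) A = 0" if "Q \<in> planes" "Q \<noteq> P" for Q
  proof -
    obtain n c where "P = {y. n \<bullet> y = c}" by (rule plane_eq_hyperplane[OF P])
    then have "P \<in> sets (plane_area Q)" by (simp add: closed_hyperplane)
    then have "emeasure (plane_area Q) A \<le> emeasure (plane_area Q) P"
      using A by (intro emeasure_mono) auto
    then show ?thesis using emeasure_plane_area_Int[OF P that(1)] that(2) by auto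
  qed
  then have "(\<integral>\<^sup>+Q. emeasure (plane_area Q) A \<partial>count_space planes)
      = (\<integral>\<^sup>+Q. emeasure (plane_area P) A * indicator {P} Q \<partial>count_space planes)"
    by (intro nn_integral_cong) (auto simp: indicator_def)
  also have "\<dots> = emeasure (plane_area P) A"
    using P by (simp add: nn_integral_cmult_indicator emeasure_count_space_finite)
  finally show ?thesis using A by (simp add: emeasure_surface_measure)
qed

text \<open>Bounded polyhedral sets that are open relative to an affine set \<open>P\<close> (all of space, or a
  plane). They are interiors of finite unions of polytopes, which rules out slits,
  i.e. boundary parts having the set on both sides.\<close>

definition polyhedral_open_in :: "'a::euclidean_space set \<Rightarrow> 'a set \<Rightarrow> bool" where
  "polyhedral_open_in P S \<longleftrightarrow>
     (\<exists>F. finite F \<and> (\<forall>p\<in>F. polytope p \<and> p \<subseteq> P) \<and> S = top_of_set P interior_of (\<Union>F))"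

abbreviation polyhedral_open :: "'a::euclidean_space set \<Rightarrow> bool" where
  "polyhedral_open S \<equiv> polyhedral_open_in UNIV S"

definition partition_up_to_boundary :: "'b set \<Rightarrow> ('b \<Rightarrow> 'a::topological_space set) \<Rightarrow> 'a set \<Rightarrow> bool" where
  "partition_up_to_boundary A p S \<longleftrightarrow>
     finite A \<and> disjoint_family_on p A \<and> (\<forall>a\<in>A. p a \<subseteq> S) \<and> S \<subseteq> (\<Union>a\<in>A. closure (p a))"

text \<open>A polyhedral open set has an outer unit normal at a boundary point precisely if it is
  locally a half-space there.\<close>

definition outer_unit_normal :: "'a::euclidean_space set \<Rightarrow> 'a \<Rightarrow> 'a \<Rightarrow> bool" where
  "outer_unit_normal D x n \<longleftrightarrow>
     norm n = 1 \<and> (\<exists>r>0. \<forall>y\<in>ball x r. y \<in> D \<longleftrightarrow> (y - x) \<bullet> n < 0)"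

definition regular_frontier :: "'a::euclidean_space set \<Rightarrow> 'a set" where
  "regular_frontier D = {x \<in> frontier D. \<exists>!n. outer_unit_normal D x n}"

definition inner_unit_normal :: "'a::euclidean_space set \<Rightarrow> 'a \<Rightarrow> 'a" where
  "inner_unit_normal D x = (THE n. outer_unit_normal D x (- n))"

text \<open>Near every boundary point, \<open>D\<close> is the region above a Lipschitz graph over the hyperplane
  orthogonal to some unit vector \<open>n\<close>.\<close>

definition Lipschitz_boundary :: "'a::euclidean_space set \<Rightarrow> bool" where
  "Lipschitz_boundary D \<longleftrightarrow>
     (\<forall>x\<in>frontier D. \<exists>n r L g. norm n = 1 \<and> r > 0 \<and> L-lipschitz_on {z. z \<bullet> n = 0} g \<and>
        (\<forall>y\<in>ball x r. y \<in> D \<longleftrightarrow> y \<bullet> n > g (y - (y \<bullet> n) *\<^sub>R n)))"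

definition view_kernel :: "(real^3) set \<Rightarrow> real^3 \<Rightarrow> real^3 \<Rightarrow> real" where
  "view_kernel D x y =
     (inner_unit_normal D y \<bullet> (x - y)) * (inner_unit_normal D x \<bullet> (y - x))
       / (pi * ((y - x) \<bullet> (y - x))\<^sup>2)"

definition visibility :: "(real^3) set \<Rightarrow> real^3 \<Rightarrow> real^3 \<Rightarrow> real" where
  "visibility D x y = (if x \<in> frontier D \<and> y \<in> frontier D \<and> open_segment x y \<subseteq> D then 1 else 0)"

text \<open>The surface measure is restricted before taking the product because it is not sigma-finite on
  all of space.\<close>

definition view_factor :: "(real^3) set \<Rightarrow> (real^3) set \<Rightarrow> (real^3) set \<Rightarrow> real" where
  "view_factor D A B =
     (\<integral>(x, y). visibility D x y * view_kernel D x y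
        \<partial>(restrict_space surface_measure A \<Otimes>\<^sub>M restrict_space surface_measure B))"

definition Linf_norm :: "'a::euclidean_space set \<Rightarrow> ('a \<Rightarrow> real) \<Rightarrow> real" where
  "Linf_norm S g = real_of_ereal (esssup (lebesgue_on S) (\<lambda>x. ereal \<bar>g x\<bar>))"

definition ess_inf :: "'a::euclidean_space set \<Rightarrow> ('a \<Rightarrow> real) \<Rightarrow> real" where
  "ess_inf S g = real_of_ereal (- esssup (lebesgue_on S) (\<lambda>x. - ereal (g x)))"

definition Linf :: "'a::euclidean_space set \<Rightarrow> ('a \<Rightarrow> real) set" where
  "Linf S = {g \<in> borel_measurable (lebesgue_on S). esssup (lebesgue_on S) (\<lambda>x. ereal \<bar>g x\<bar>) < \<infinity>}"

definition difference_quotients :: "(real \<Rightarrow> real) \<Rightarrow> real \<Rightarrow> real set" where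
  "difference_quotients e r =
     {\<bar>e a - e b\<bar> / \<bar>a - b\<bar> | a b. a \<in> {0..r} \<and> b \<in> {0..r} \<and> a \<noteq> b}"

definition Lip_const :: "(real \<Rightarrow> real) \<Rightarrow> real \<Rightarrow> real" where
  "Lip_const e r = (if r = 0 then 0 else Sup (difference_quotients e r))"

definition min_val :: "(real \<Rightarrow> real) \<Rightarrow> real \<Rightarrow> real" where
  "min_val e r = (INF \<theta>\<in>{0..r}. e \<theta>)"

definition neg_variation :: "(real \<Rightarrow> real) \<Rightarrow> real \<Rightarrow> real" where
  "neg_variation e r = (if r = 0 then 0 else
     Sup {\<Sum>l=1..n. - min 0 (e (s l) - e (s (l - 1))) | (n::nat) s.
            s 0 = 0 \<and> s n = r \<and> strict_mono_on {0..n} s})"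

datatype phase = Solid | Gas

record ('i, 'a) fv_data =
  T_end :: real
  \<Omega> :: "(real^3) set"
  \<Omega>\<^sub>m :: "phase \<Rightarrow> (real^3) set"
  energy :: "phase \<Rightarrow> real \<Rightarrow> real"           (* epsilon_m *)
  C_energy :: real                               (* C_epsilon *)
  conductivity :: "phase \<Rightarrow> real"             (* kappa_m *)
  source :: "phase \<Rightarrow> real \<times> (real^3) \<Rightarrow> real"  (* f_m *)
  boltzmann :: real                              (* sigma *)
  \<theta>ext :: real
  \<theta>init :: "real^3 \<Rightarrow> real"
  emissivity :: "real \<Rightarrow> real"
  N_steps :: nat
  time :: "nat \<Rightarrow> real"
  cells :: "'i set"                              (* I *)
  \<omega> :: "'i \<Rightarrow> (real^3) set"
  pt :: "'i \<Rightarrow> real^3"                       (* x_i *)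
  I\<^sub>\<Omega> :: "'a set"
  I\<^sub>\<Sigma> :: "'a set"
  ph :: 'a
  \<zeta> :: "'a \<Rightarrow> (real^3) set"
  source_approx :: "phase \<Rightarrow> nat \<Rightarrow> 'i \<Rightarrow> real"
  init_approx :: "'i \<Rightarrow> real"

definition \<Sigma> :: "('i, 'a) fv_data \<Rightarrow> (real^3) set" where
  "\<Sigma> D = frontier (\<Omega>\<^sub>m D Gas)"

definition open_rad :: "('i, 'a) fv_data \<Rightarrow> (real^3) set" where   (* the set O *)
  "open_rad D = interior (convex hull (closure (\<Omega> D))) - closure (\<Omega> D)"

definition \<Gamma>\<^sub>\<Omega> :: "('i, 'a) fv_data \<Rightarrow> (real^3) set" where
  "\<Gamma>\<^sub>\<Omega> D = closure (\<Omega> D) \<inter> closure (open_rad D)"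

definition \<Gamma>ph :: "('i, 'a) fv_data \<Rightarrow> (real^3) set" where
  "\<Gamma>ph D = frontier (convex hull (closure (\<Omega> D))) \<inter> frontier (open_rad D)"

definition \<omega>\<^sub>m :: "('i, 'a) fv_data \<Rightarrow> phase \<Rightarrow> 'i \<Rightarrow> (real^3) set" where
  "\<omega>\<^sub>m D p i = \<omega> D i \<inter> \<Omega>\<^sub>m D p"

definition cells\<^sub>m :: "('i, 'a) fv_data \<Rightarrow> phase \<Rightarrow> 'i set" where
  "cells\<^sub>m D p = {j \<in> cells D. \<omega>\<^sub>m D p j \<noteq> {}}"

definition nb\<^sub>m :: "('i, 'a) fv_data \<Rightarrow> phase \<Rightarrow> 'i \<Rightarrow> 'i set" where
  "nb\<^sub>m D p i = {j \<in> cells\<^sub>m D p - {i}. area (frontier (\<omega>\<^sub>m D p i) \<inter> frontier (\<omega>\<^sub>m D p j)) \<noteq> 0}"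

definition nb :: "('i, 'a) fv_data \<Rightarrow> 'i \<Rightarrow> 'i set" where
  "nb D i = {j \<in> cells D - {i}. area (frontier (\<omega> D i) \<inter> frontier (\<omega> D j)) \<noteq> 0}"

definition I\<^sub>\<Gamma> :: "('i, 'a) fv_data \<Rightarrow> 'a set" where
  "I\<^sub>\<Gamma> D = insert (ph D) (I\<^sub>\<Omega> D)"

definition cell\<^sub>\<Omega> :: "('i, 'a) fv_data \<Rightarrow> 'a \<Rightarrow> 'i" where
  "cell\<^sub>\<Omega> D \<alpha> = (THE i. i \<in> cells D \<and> \<zeta> D \<alpha> \<subseteq> frontier (\<omega> D i) \<inter> \<Gamma>\<^sub>\<Omega> D)"

definition cell\<^sub>\<Sigma> :: "('i, 'a) fv_data \<Rightarrow> 'a \<Rightarrow> 'i" where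
  "cell\<^sub>\<Sigma> D \<alpha> = (THE i. i \<in> cells D \<and> \<zeta> D \<alpha> \<subseteq> frontier (\<omega>\<^sub>m D Solid i) \<inter> \<Sigma> D)"

definition J\<^sub>\<Omega> :: "('i, 'a) fv_data \<Rightarrow> 'i \<Rightarrow> 'a set" where
  "J\<^sub>\<Omega> D i = {\<alpha> \<in> I\<^sub>\<Omega> D. area (\<zeta> D \<alpha> \<inter> frontier (\<omega> D i)) \<noteq> 0}"

definition J\<^sub>\<Sigma> :: "('i, 'a) fv_data \<Rightarrow> 'i \<Rightarrow> 'a set" where
  "J\<^sub>\<Sigma> D i = {\<alpha> \<in> I\<^sub>\<Sigma> D. area (\<zeta> D \<alpha> \<inter> frontier (\<omega>\<^sub>m D Solid i)) \<noteq> 0}"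

definition \<Lambda>\<^sub>\<Gamma> :: "('i, 'a) fv_data \<Rightarrow> 'a \<Rightarrow> 'a \<Rightarrow> real" where
  "\<Lambda>\<^sub>\<Gamma> D \<alpha> \<beta> = view_factor (open_rad D) (\<zeta> D \<alpha>) (\<zeta> D \<beta>)"

definition \<Lambda>\<^sub>\<Sigma> :: "('i, 'a) fv_data \<Rightarrow> 'a \<Rightarrow> 'a \<Rightarrow> real" where
  "\<Lambda>\<^sub>\<Sigma> D \<alpha> \<beta> = view_factor (\<Omega>\<^sub>m D Gas) (\<zeta> D \<alpha>) (\<zeta> D \<beta>)"

locale fv_domain =
  fixes D :: "('i, 'a) fv_data"
  assumes T_pos: "T_end D > 0"
    and \<Omega>_nonempty: "\<Omega> D \<noteq> {}"
    and \<Omega>_polyhedral: "polyhedral_open (\<Omega> D)"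
    and \<Omega>\<^sub>m_nonempty: "\<And>p. \<Omega>\<^sub>m D p \<noteq> {}"
    and \<Omega>\<^sub>m_polyhedral: "\<And>p. polyhedral_open (\<Omega>\<^sub>m D p)"
    and closure_\<Omega>: "closure (\<Omega> D) = closure (\<Omega>\<^sub>m D Solid) \<union> closure (\<Omega>\<^sub>m D Gas)"
    and \<Omega>\<^sub>m_disjoint: "\<Omega>\<^sub>m D Solid \<inter> \<Omega>\<^sub>m D Gas = {}"
    and frontier_solid: "frontier (\<Omega>\<^sub>m D Solid) = frontier (\<Omega> D) \<union> frontier (\<Omega>\<^sub>m D Gas)"
    and frontier_disjoint: "frontier (\<Omega> D) \<inter> frontier (\<Omega>\<^sub>m D Gas) = {}"
    and interface_Lipschitz: "Lipschitz_boundary (\<Omega>\<^sub>m D Gas)"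

lemma (in fv_domain) \<Sigma>_eq: "\<Sigma> D = closure (\<Omega>\<^sub>m D Solid) \<inter> closure (\<Omega>\<^sub>m D Gas)"
proof -
  have op: "open (\<Omega>\<^sub>m D p)" for p
    using \<Omega>\<^sub>m_polyhedral[of p] by (auto simp: polyhedral_open_in_def)
  have "closure (\<Omega>\<^sub>m D Solid) \<inter> \<Omega>\<^sub>m D Gas = {}"
    using \<Omega>\<^sub>m_disjoint op[of Gas] by (simp add: open_Int_closure_eq_empty Int_commute)
  moreover have "frontier (\<Omega>\<^sub>m D Gas) \<subseteq> closure (\<Omega>\<^sub>m D Solid)"
    using frontier_solid by (auto simp: frontier_def)
  ultimately show ?thesis
    using op[of Gas] by (auto simp: \<Sigma>_def frontier_def interior_open)
qed

locale fv_physics =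
  fixes D :: "('i, 'a) fv_data"
  assumes energy_continuous: "\<And>p. continuous_on {0..} (energy D p)"
    and energy_nonneg: "\<And>p \<theta>. \<theta> \<ge> 0 \<Longrightarrow> energy D p \<theta> \<ge> 0"
    and C_energy_pos: "C_energy D > 0"
    and energy_growth: "\<And>p \<theta>1 \<theta>2. 0 \<le> \<theta>1 \<Longrightarrow> \<theta>1 \<le> \<theta>2 \<Longrightarrow>
          energy D p \<theta>2 \<ge> (\<theta>2 - \<theta>1) * C_energy D + energy D p \<theta>1"
    and conductivity_nonneg: "\<And>p. conductivity D p \<ge> 0"
    and source_Linf: "\<And>p. source D p \<in> Linf ({0<..<T_end D} \<times> \<Omega>\<^sub>m D p)"
    and source_nonneg: "\<And>p. AE z in lebesgue_on ({0<..<T_end D} \<times> \<Omega>\<^sub>m D p). source D p z \<ge> 0"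
    and boltzmann_pos: "boltzmann D > 0"
    and \<theta>ext_pos: "\<theta>ext D > 0"
    and \<theta>init_Linf: "\<theta>init D \<in> Linf (\<Omega> D)"
    and \<theta>init_pos: "AE x in lebesgue_on (\<Omega> D). \<theta>init D x > 0"
    and emissivity_range: "\<And>\<theta>. \<theta> \<ge> 0 \<Longrightarrow> emissivity D \<theta> \<in> {0<..1}"
    and emissivity_Lipschitz: "\<And>r. r \<ge> 0 \<Longrightarrow> bdd_above (difference_quotients (emissivity D) r)"

locale fv_mesh =
  fixes D :: "('i, 'a) fv_data"
  assumes time_0: "time D 0 = 0"
    and time_N: "time D (N_steps D) = T_end D"
    and time_mono: "strict_mono_on {0..N_steps D} (time D)"
    and cells_partition: "partition_up_to_boundary (cells D) (\<omega> D) (\<Omega> D)"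
    and \<omega>_nonempty: "\<And>i. i \<in> cells D \<Longrightarrow> \<omega> D i \<noteq> {}"
    and \<omega>_polyhedral: "\<And>i. i \<in> cells D \<Longrightarrow> polyhedral_open (\<omega> D i)"
    and \<omega>_connected: "\<And>i. i \<in> cells D \<Longrightarrow> connected (\<omega> D i)"
    and interface_matching: "\<And>i. i \<in> cells D \<Longrightarrow>
          regular_frontier (\<omega>\<^sub>m D Solid i) \<inter> \<Sigma> D = regular_frontier (\<omega>\<^sub>m D Gas i) \<inter> \<Sigma> D"
    and pt_cell: "\<And>i. i \<in> cells D \<Longrightarrow> pt D i \<in> closure (\<omega> D i)"
    and pt_phase: "\<And>p i. i \<in> cells\<^sub>m D p \<Longrightarrow> pt D i \<in> closure (\<omega>\<^sub>m D p i)"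
    and pt_\<Gamma>\<^sub>\<Omega>: "\<And>i. i \<in> cells D \<Longrightarrow> area (closure (\<omega> D i) \<inter> \<Gamma>\<^sub>\<Omega> D) \<noteq> 0 \<Longrightarrow>
          pt D i \<in> closure (\<omega> D i) \<inter> \<Gamma>\<^sub>\<Omega> D"
    and pt_outer: "\<And>i. i \<in> cells D \<Longrightarrow>
          area (closure (\<omega> D i) \<inter> (frontier (\<Omega> D) - \<Gamma>\<^sub>\<Omega> D)) \<noteq> 0 \<Longrightarrow>
          pt D i \<in> closure (\<omega> D i) \<inter> closure (frontier (\<Omega> D) - \<Gamma>\<^sub>\<Omega> D)"
    and pt_distinct: "\<And>i j. i \<in> cells D \<Longrightarrow> j \<in> nb D i \<Longrightarrow> pt D i \<noteq> pt D j"
    and pt_normal: "\<And>i j. i \<in> cells D \<Longrightarrow> j \<in> nb D i \<Longrightarrow>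
          AE y in surface_measure. y \<in> frontier (\<omega> D i) \<inter> frontier (\<omega> D j) \<longrightarrow>
            outer_unit_normal (\<omega> D i) y ((pt D j - pt D i) /\<^sub>R norm (pt D i - pt D j))"

locale fv_boundary_mesh =
  fixes D :: "('i, 'a) fv_data"
  assumes \<zeta>\<^sub>\<Omega>_partition: "partition_up_to_boundary (I\<^sub>\<Omega> D) (\<zeta> D) (\<Gamma>\<^sub>\<Omega> D)"
    and \<zeta>\<^sub>\<Sigma>_partition: "partition_up_to_boundary (I\<^sub>\<Sigma> D) (\<zeta> D) (\<Sigma> D)"
    and \<zeta>_nonempty: "\<And>\<alpha>. \<alpha> \<in> I\<^sub>\<Omega> D \<union> I\<^sub>\<Sigma> D \<Longrightarrow> \<zeta> D \<alpha> \<noteq> {}"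
    and \<zeta>_polyhedral: "\<And>\<alpha>. \<alpha> \<in> I\<^sub>\<Omega> D \<union> I\<^sub>\<Sigma> D \<Longrightarrow> \<exists>P\<in>planes. polyhedral_open_in P (\<zeta> D \<alpha>)"
    and \<zeta>_connected: "\<And>\<alpha>. \<alpha> \<in> I\<^sub>\<Omega> D \<union> I\<^sub>\<Sigma> D \<Longrightarrow> connected (\<zeta> D \<alpha>)"
    and I_disjoint: "I\<^sub>\<Omega> D \<inter> I\<^sub>\<Sigma> D = {}"
    and ph_notin: "ph D \<notin> I\<^sub>\<Omega> D \<union> I\<^sub>\<Sigma> D"
    and \<zeta>_ph: "\<zeta> D (ph D) = \<Gamma>ph D"
    and cell\<^sub>\<Omega>_unique: "\<And>\<alpha>. \<alpha> \<in> I\<^sub>\<Omega> D \<Longrightarrow>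
          \<exists>!i. i \<in> cells D \<and> \<zeta> D \<alpha> \<subseteq> frontier (\<omega> D i) \<inter> \<Gamma>\<^sub>\<Omega> D"
    and cell\<^sub>\<Sigma>_unique: "\<And>\<alpha>. \<alpha> \<in> I\<^sub>\<Sigma> D \<Longrightarrow>
          \<exists>!i. i \<in> cells D \<and> \<zeta> D \<alpha> \<subseteq> frontier (\<omega>\<^sub>m D Solid i) \<inter> \<Sigma> D"
    and pt_cell\<^sub>\<Omega>: "\<And>\<alpha>. \<alpha> \<in> I\<^sub>\<Omega> D \<Longrightarrow> pt D (cell\<^sub>\<Omega> D \<alpha>) \<in> closure (\<zeta> D \<alpha>)"
    and pt_cell\<^sub>\<Sigma>: "\<And>\<alpha>. \<alpha> \<in> I\<^sub>\<Sigma> D \<Longrightarrow> pt D (cell\<^sub>\<Sigma> D \<alpha>) \<in> closure (\<zeta> D \<alpha>)"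

text \<open>Nonnegativity, reciprocity and the closed-enclosure relations follow from the geometry by
  surface integration; they are taken here as part of the standing assumptions.\<close>

locale fv_view_factors =
  fixes D :: "('i, 'a) fv_data"
  assumes \<Lambda>\<^sub>\<Sigma>_nonneg: "\<And>\<alpha> \<beta>. \<alpha> \<in> I\<^sub>\<Sigma> D \<Longrightarrow> \<beta> \<in> I\<^sub>\<Sigma> D \<Longrightarrow> \<Lambda>\<^sub>\<Sigma> D \<alpha> \<beta> \<ge> 0"
    and \<Lambda>\<^sub>\<Sigma>_sym: "\<And>\<alpha> \<beta>. \<alpha> \<in> I\<^sub>\<Sigma> D \<Longrightarrow> \<beta> \<in> I\<^sub>\<Sigma> D \<Longrightarrow> \<Lambda>\<^sub>\<Sigma> D \<alpha> \<beta> = \<Lambda>\<^sub>\<Sigma> D \<beta> \<alpha>"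
    and \<Lambda>\<^sub>\<Sigma>_sum: "\<And>\<alpha>. \<alpha> \<in> I\<^sub>\<Sigma> D \<Longrightarrow> (\<Sum>\<beta>\<in>I\<^sub>\<Sigma> D. \<Lambda>\<^sub>\<Sigma> D \<alpha> \<beta>) = area (\<zeta> D \<alpha>)"
    and \<Lambda>\<^sub>\<Gamma>_nonneg: "\<And>\<alpha> \<beta>. \<alpha> \<in> I\<^sub>\<Gamma> D \<Longrightarrow> \<beta> \<in> I\<^sub>\<Gamma> D \<Longrightarrow> \<Lambda>\<^sub>\<Gamma> D \<alpha> \<beta> \<ge> 0"
    and \<Lambda>\<^sub>\<Gamma>_sym: "\<And>\<alpha> \<beta>. \<alpha> \<in> I\<^sub>\<Gamma> D \<Longrightarrow> \<beta> \<in> I\<^sub>\<Gamma> D \<Longrightarrow> \<Lambda>\<^sub>\<Gamma> D \<alpha> \<beta> = \<Lambda>\<^sub>\<Gamma> D \<beta> \<alpha>"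
    and \<Lambda>\<^sub>\<Gamma>_sum: "\<And>\<alpha>. \<alpha> \<in> I\<^sub>\<Gamma> D \<Longrightarrow> (\<Sum>\<beta>\<in>I\<^sub>\<Gamma> D. \<Lambda>\<^sub>\<Gamma> D \<alpha> \<beta>) = area (\<zeta> D \<alpha>)"

locale fv_approximation =
  fixes D :: "('i, 'a) fv_data"
  assumes source_approx_bounds: "\<And>p \<nu> i. \<nu> \<in> {1..N_steps D} \<Longrightarrow> i \<in> cells\<^sub>m D p \<Longrightarrow>
        0 \<le> ess_inf ({time D (\<nu> - 1)<..<time D \<nu>} \<times> \<omega>\<^sub>m D p i) (source D p) \<and>
        ess_inf ({time D (\<nu> - 1)<..<time D \<nu>} \<times> \<omega>\<^sub>m D p i) (source D p) \<le> source_approx D p \<nu> i \<and>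
        source_approx D p \<nu> i \<le> Linf_norm ({time D (\<nu> - 1)<..<time D \<nu>} \<times> \<omega>\<^sub>m D p i) (source D p)"
    and init_approx_bounds: "\<And>i. i \<in> cells D \<Longrightarrow>
        0 \<le> ess_inf (\<omega> D i) (\<theta>init D) \<and>
        ess_inf (\<omega> D i) (\<theta>init D) \<le> init_approx D i \<and>
        init_approx D i \<le> Linf_norm (\<omega> D i) (\<theta>init D)"

locale fv_setting =
  fv_domain D + fv_physics D + fv_mesh D + fv_boundary_mesh D + fv_view_factors D + fv_approximation D
  for D :: "('i, 'a) fv_data"

text \<open>Inverse of a matrix indexed by a finite set (which may be empty), padded with zeros.\<close>

definition inverse_matrix_on :: "'a set \<Rightarrow> ('a \<Rightarrow> 'a \<Rightarrow> real) \<Rightarrow> 'a \<Rightarrow> 'a \<Rightarrow> real" where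
  "inverse_matrix_on A G = (THE H.
     (\<forall>\<alpha>\<in>A. \<forall>\<beta>\<in>A. (\<Sum>\<gamma>\<in>A. G \<alpha> \<gamma> * H \<gamma> \<beta>) = of_bool (\<alpha> = \<beta>)) \<and>
     (\<forall>\<alpha>\<in>A. \<forall>\<beta>\<in>A. (\<Sum>\<gamma>\<in>A. H \<alpha> \<gamma> * G \<gamma> \<beta>) = of_bool (\<alpha> = \<beta>)) \<and>
     (\<forall>\<alpha> \<beta>. \<alpha> \<notin> A \<or> \<beta> \<notin> A \<longrightarrow> H \<alpha> \<beta> = 0))"

text \<open>The emission term has the same form on \<open>I\<^sub>\<Omega>\<close> and on \<open>I\<^sub>\<Sigma>\<close>.\<close>

definition E_rad :: "('i, 'a) fv_data \<Rightarrow> ('a \<Rightarrow> real) \<Rightarrow> 'a \<Rightarrow> real" where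
  "E_rad D u \<alpha> = boltzmann D * emissivity D (u \<alpha>) * u \<alpha> ^ 4 * area (\<zeta> D \<alpha>)"

definition E_ph :: "('i, 'a) fv_data \<Rightarrow> ('a \<Rightarrow> real) \<Rightarrow> 'a \<Rightarrow> real" where
  "E_ph D u \<alpha> = boltzmann D * (1 - emissivity D (u \<alpha>)) * \<theta>ext D ^ 4 * \<Lambda>\<^sub>\<Gamma> D \<alpha> (ph D)"

definition G\<^sub>\<Gamma> :: "('i, 'a) fv_data \<Rightarrow> ('a \<Rightarrow> real) \<Rightarrow> 'a \<Rightarrow> 'a \<Rightarrow> real" where
  "G\<^sub>\<Gamma> D u \<alpha> \<beta> = of_bool (\<alpha> = \<beta>) * area (\<zeta> D \<alpha>) - (1 - emissivity D (u \<alpha>)) * \<Lambda>\<^sub>\<Gamma> D \<alpha> \<beta>"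

definition G\<^sub>\<Sigma> :: "('i, 'a) fv_data \<Rightarrow> ('a \<Rightarrow> real) \<Rightarrow> 'a \<Rightarrow> 'a \<Rightarrow> real" where
  "G\<^sub>\<Sigma> D u \<alpha> \<beta> = of_bool (\<alpha> = \<beta>) * area (\<zeta> D \<alpha>) - (1 - emissivity D (u \<alpha>)) * \<Lambda>\<^sub>\<Sigma> D \<alpha> \<beta>"

definition R\<^sub>\<Gamma> :: "('i, 'a) fv_data \<Rightarrow> ('a \<Rightarrow> real) \<Rightarrow> 'a \<Rightarrow> real" where
  "R\<^sub>\<Gamma> D u \<alpha> = (\<Sum>\<beta>\<in>I\<^sub>\<Omega> D. inverse_matrix_on (I\<^sub>\<Omega> D) (G\<^sub>\<Gamma> D u) \<alpha> \<beta> * (E_rad D u \<beta> + E_ph D u \<beta>))"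

definition R\<^sub>\<Sigma> :: "('i, 'a) fv_data \<Rightarrow> ('a \<Rightarrow> real) \<Rightarrow> 'a \<Rightarrow> real" where
  "R\<^sub>\<Sigma> D u \<alpha> = (\<Sum>\<beta>\<in>I\<^sub>\<Sigma> D. inverse_matrix_on (I\<^sub>\<Sigma> D) (G\<^sub>\<Sigma> D u) \<alpha> \<beta> * E_rad D u \<beta>)"

definition V\<^sub>\<Gamma> :: "('i, 'a) fv_data \<Rightarrow> ('a \<Rightarrow> real) \<Rightarrow> 'a \<Rightarrow> real" where
  "V\<^sub>\<Gamma> D u \<alpha> = emissivity D (u \<alpha>) * (\<Sum>\<beta>\<in>I\<^sub>\<Omega> D. R\<^sub>\<Gamma> D u \<beta> * \<Lambda>\<^sub>\<Gamma> D \<alpha> \<beta>)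
     + boltzmann D * emissivity D (u \<alpha>) * \<theta>ext D ^ 4 * \<Lambda>\<^sub>\<Gamma> D \<alpha> (ph D)"

definition V\<^sub>\<Sigma> :: "('i, 'a) fv_data \<Rightarrow> ('a \<Rightarrow> real) \<Rightarrow> 'a \<Rightarrow> real" where
  "V\<^sub>\<Sigma> D u \<alpha> = emissivity D (u \<alpha>) * (\<Sum>\<beta>\<in>I\<^sub>\<Sigma> D. R\<^sub>\<Sigma> D u \<beta> * \<Lambda>\<^sub>\<Sigma> D \<alpha> \<beta>)"

definition step_size :: "('i, 'a) fv_data \<Rightarrow> nat \<Rightarrow> real" where
  "step_size D \<nu> = time D \<nu> - time D (\<nu> - 1)"

definition \<H> :: "('i, 'a) fv_data \<Rightarrow> nat \<Rightarrow> 'i \<Rightarrow> ('i \<Rightarrow> real) \<Rightarrow> ('i \<Rightarrow> real) \<Rightarrow> real" where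
  "\<H> D \<nu> i v u =
     inverse (step_size D \<nu>)
       * (\<Sum>p\<in>{Solid, Gas}. (energy D p (u i) - energy D p (v i)) * volume (\<omega>\<^sub>m D p i))
   - (\<Sum>p\<in>{Solid, Gas}. conductivity D p *
        (\<Sum>j\<in>nb\<^sub>m D p i. (u j - u i) / norm (pt D i - pt D j)
           * area (frontier (\<omega>\<^sub>m D p i) \<inter> frontier (\<omega>\<^sub>m D p j))))
   + boltzmann D * emissivity D (u i) * u i ^ 4 * area (frontier (\<omega>\<^sub>m D Solid i) \<inter> \<Gamma>\<^sub>\<Omega> D)
   - (\<Sum>\<alpha>\<in>J\<^sub>\<Omega> D i. V\<^sub>\<Gamma> D (\<lambda>\<beta>. u (cell\<^sub>\<Omega> D \<beta>)) \<alpha>)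
   + boltzmann D * emissivity D (u i) * (u i ^ 4 - \<theta>ext D ^ 4)
       * area (frontier (\<omega>\<^sub>m D Solid i) \<inter> (frontier (\<Omega> D) - \<Gamma>\<^sub>\<Omega> D))
   + boltzmann D * emissivity D (u i) * u i ^ 4 * area (\<omega> D i \<inter> \<Sigma> D)
   - (\<Sum>\<alpha>\<in>J\<^sub>\<Sigma> D i. V\<^sub>\<Sigma> D (\<lambda>\<beta>. u (cell\<^sub>\<Sigma> D \<beta>)) \<alpha>)
   - (\<Sum>p\<in>{Solid, Gas}. source_approx D p \<nu> i * volume (\<omega>\<^sub>m D p i))"

definition fv_solution :: "('i, 'a) fv_data \<Rightarrow> (nat \<Rightarrow> 'i \<Rightarrow> real) \<Rightarrow> bool" where
  "fv_solution D u \<longleftrightarrow>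
     u \<in> {0..N_steps D} \<rightarrow>\<^sub>E (cells D \<rightarrow>\<^sub>E {0..}) \<and>
     (\<forall>i\<in>cells D. u 0 i = init_approx D i) \<and>
     (\<forall>\<nu>\<in>{1..N_steps D}. \<forall>i\<in>cells D. \<H> D \<nu> i (u (\<nu> - 1)) (u \<nu>) = 0)"

definition lower_bound :: "('i, 'a) fv_data \<Rightarrow> real" where
  "lower_bound D = min (\<theta>ext D) (ess_inf (\<Omega> D) (\<theta>init D))"

definition upper_bound :: "('i, 'a) fv_data \<Rightarrow> nat \<Rightarrow> real" where
  "upper_bound D \<nu> = max (\<theta>ext D) (Linf_norm (\<Omega> D) (\<theta>init D))
     + time D \<nu> / C_energy D *
         (\<Sum>p\<in>{Solid, Gas}. Linf_norm ({0<..<time D \<nu>} \<times> \<Omega>\<^sub>m D p) (source D p))"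

definition LV_\<Gamma>\<^sub>\<Omega> :: "('i, 'a) fv_data \<Rightarrow> real" where
  "LV_\<Gamma>\<^sub>\<Omega> D = boltzmann D *
     (MAX i\<in>cells D. area (frontier (\<omega>\<^sub>m D Solid i) \<inter> \<Gamma>\<^sub>\<Omega> D) / volume (\<omega> D i))"

definition LV_outer :: "('i, 'a) fv_data \<Rightarrow> real" where
  "LV_outer D = boltzmann D *
     (MAX i\<in>cells D. area (frontier (\<omega>\<^sub>m D Solid i) \<inter> (frontier (\<Omega> D) - \<Gamma>\<^sub>\<Omega> D)) / volume (\<omega> D i))"

definition LV_\<Sigma> :: "('i, 'a) fv_data \<Rightarrow> real" where
  "LV_\<Sigma> D = boltzmann D * (MAX i\<in>cells D. area (\<omega> D i \<inter> \<Sigma> D) / volume (\<omega> D i))"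

definition lg1 :: "('i, 'a) fv_data \<Rightarrow> real \<Rightarrow> real" where
  "lg1 D r = 4 * neg_variation (emissivity D) r * r ^ 3 + Lip_const (emissivity D) r * r ^ 4"

definition lg2 :: "('i, 'a) fv_data \<Rightarrow> real \<Rightarrow> real" where
  "lg2 D r = 4 * inverse (min_val (emissivity D) r) * r ^ 3
     + max (r ^ 4) (\<theta>ext D ^ 4) * Lip_const (emissivity D) r
         * (2 * inverse (min_val (emissivity D) r) + 1)"

definition lg3 :: "('i, 'a) fv_data \<Rightarrow> real \<Rightarrow> real" where
  "lg3 D r = Lip_const (emissivity D) r * \<theta>ext D ^ 4"

definition step_factor :: "('i, 'a) fv_data \<Rightarrow> real \<Rightarrow> real" where
  "step_factor D r = (LV_\<Gamma>\<^sub>\<Omega> D + LV_outer D + LV_\<Sigma> D) * lg1 D r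
     + (LV_\<Gamma>\<^sub>\<Omega> D + LV_\<Sigma> D) * lg2 D r + LV_outer D * lg3 D r"

end

theory Submission
  imports Defs
begin

text \<open>Almost every boundary point of a polyhedral open set has an outer normal, so two cells, or
  the solid and the gas part of one cell, sharing a boundary piece of positive area lie on opposite
  sides of it. Hence the radiating area of a cell is the sum of the areas of its boundary elements.
  The irradiation of the elements solves a diagonally dominant system with substochastic rows; it
  obeys a maximum principle and is Lipschitz in the temperatures.

  Writing the scheme operator of cell \<open>i\<close> as a residual in its own temperature \<open>s\<close>, with the values
  \<open>v\<close> entering through conduction and irradiation held separately, a solution exceeding the upper
  bound gives a positive residual at its maximum, and one below the lower bound a negative
  residual at its minimum. Under the step size condition the residual increases in \<open>s\<close> faster than
  it varies with \<open>v\<close>. Its zero in \<open>s\<close> (intermediate value theorem) is then a sup-norm contraction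
  in \<open>v\<close> whose fixed points are the solutions of one time step.\<close>

section \<open>Polyhedral open sets and surface measure\<close>

text \<open>Emissivity may fall with temperature, so neither emission nor absorption need be
  monotone. The a priori bounds survive because both carry the same factor: every element in
  \<open>J\<^sub>\<Omega> D i\<close> or \<open>J\<^sub>\<Sigma> D i\<close> has the temperature of
  cell i, so their difference is e(u_i) times (\<sigma> u_i^4 area - irradiation), and its sign at
  an extremal cell does not depend on e. This requires the element areas to add up exactly to the
  area in the emission term, which is the purpose of the geometric part.

  In one time step conduction contributes the same total conductance to the slope and to the
  Lipschitz constant, so it drops out of their comparison and the step size condition contains no
  conductivity. What remains, per unit of \<sigma> times radiating area, is a loss of slope 2 L r^4
  (L the Lipschitz constant of e on [0,r], r = M_\<nu>), once from e(s) s^4 and once from the factor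
  e(s) of the irradiation, and the Lipschitz constant 4 r^3 + L r^4 / e_min of the irradiation.
  Their sum is at most l_g^1 + l_g^2; at the outer boundary the loss is at most l_g^1 +
  l_g^3.\<close>

lemma hyperplane_in_planes: "a \<noteq> 0 \<Longrightarrow> {x :: real^3. a \<bullet> x = b} \<in> planes"
  by (simp add: planes_def affine_hyperplane)

text \<open>A polyhedron is a finite intersection of half-spaces. One whose bounding plane contains
  \<open>P\<close> imposes nothing on points of \<open>P\<close>; off the other bounding planes the
  remaining inequalities are strict and persist nearby. Discarding the planes that contain
  \<open>P\<close> matters when \<open>P\<close> is itself a plane: those kept differ from
  \<open>P\<close> and meet it in null sets.\<close>

lemma polyhedron_boundary_in_planes:
  fixes p :: "(real^3) set"
  assumes "polyhedron p" "p \<subseteq> P"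
  obtains \<Q> where "finite \<Q>" "\<Q> \<subseteq> planes" "\<And>Q. Q \<in> \<Q> \<Longrightarrow> \<not> P \<subseteq> Q"
    "p - top_of_set P interior_of p \<subseteq> \<Union>\<Q>"
proof -
  obtain H where H: "finite H" "p = \<Inter>H" "\<And>h. h \<in> H \<Longrightarrow> \<exists>a b. a \<noteq> 0 \<and> h = {x. a \<bullet> x \<le> b}"
    using assms(1) unfolding polyhedron_def by blast
  then obtain a b where ab: "\<And>h. h \<in> H \<Longrightarrow> a h \<noteq> 0 \<and> h = {x. a h \<bullet> x \<le> b h}" by metis
  define \<Q> where "\<Q> = {Q \<in> (\<lambda>h. {x. a h \<bullet> x = b h}) ` H. \<not> P \<subseteq> Q}"
  have "x \<in> top_of_set P interior_of p" if x: "x \<in> p" "x \<notin> \<Union>\<Q>" for x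
  proof -
    define U where "U = (\<Inter>h\<in>{h\<in>H. \<not> P \<subseteq> {x. a h \<bullet> x = b h}}. {x. a h \<bullet> x < b h})"
    have "open U" unfolding U_def using H(1) by (intro open_INT) (auto intro: open_halfspace_lt)
    then have op: "openin (top_of_set P) (P \<inter> U)" by auto
    have sub: "P \<inter> U \<subseteq> p"
    proof
      fix y assume y: "y \<in> P \<inter> U"
      have "y \<in> h" if h: "h \<in> H" for h
      proof (cases "P \<subseteq> {x. a h \<bullet> x = b h}")
        case True
        then have "a h \<bullet> y \<le> b h" using y by auto
        then show ?thesis using ab[OF h] by blast
      next
        case False
        then have "a h \<bullet> y < b h" using y h by (auto simp: U_def)
        then show ?thesis using ab[OF h] by (metis (mono_tags, lifting) less_imp_le mem_Collect_eq)
      qed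
      then show "y \<in> p" using H(2) by auto
    qed
    have "x \<in> P \<inter> U"
    proof -
      have "a h \<bullet> x < b h" if h: "h \<in> H" "\<not> P \<subseteq> {x. a h \<bullet> x = b h}" for h
      proof -
        have "x \<in> h" using x(1) H(2) h(1) by auto
        then have "a h \<bullet> x \<le> b h" using ab[OF h(1)] by blast
        moreover have "a h \<bullet> x \<noteq> b h" using x(2) h by (auto simp: \<Q>_def)
        ultimately show ?thesis by linarith
      qed
      then show ?thesis using x(1) assms(2) by (auto simp: U_def)
    qed
    then show ?thesis using interior_of_maximal[OF sub op] by auto
  qed
  moreover have "\<Q> \<subseteq> planes" using ab hyperplane_in_planes by (auto simp: \<Q>_def)
  moreover have "finite \<Q>" using H(1) by (auto simp: \<Q>_def)
  moreover have "p - top_of_set P interior_of p \<subseteq> \<Union>\<Q>" using calculation(1) by blast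
  ultimately show ?thesis by (intro that[of \<Q>]) (auto simp: \<Q>_def)
qed

text \<open>The finite union of polytopes is closed, so it contains \<open>closure S\<close>; a
  point of it outside \<open>S\<close> is not interior (relative to \<open>P\<close>) to any of the
  polytopes and thus lies on one of finitely many planes.\<close>

lemma polyhedral_open_in_boundary:
  fixes S :: "(real^3) set"
  assumes "polyhedral_open_in P S"
  obtains \<Q> where "finite \<Q>" "\<Q> \<subseteq> planes" "\<And>Q. Q \<in> \<Q> \<Longrightarrow> \<not> P \<subseteq> Q" "closure S - S \<subseteq> \<Union>\<Q>"
proof -
  obtain F where F: "finite F" "\<And>p. p \<in> F \<Longrightarrow> polytope p \<and> p \<subseteq> P" "S = top_of_set P interior_of (\<Union>F)"
    using assms by (auto simp: polyhedral_open_in_def)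
  have "\<forall>p\<in>F. \<exists>\<Q>. finite \<Q> \<and> \<Q> \<subseteq> planes \<and> (\<forall>Q\<in>\<Q>. \<not> P \<subseteq> Q) \<and> p - top_of_set P interior_of p \<subseteq> \<Union>\<Q>"
    using F(2) polytope_imp_polyhedron polyhedron_boundary_in_planes by metis
  then obtain \<Q> where \<Q>: "\<And>p. p \<in> F \<Longrightarrow> finite (\<Q> p) \<and> \<Q> p \<subseteq> planes \<and> (\<forall>Q\<in>\<Q> p. \<not> P \<subseteq> Q) \<and>
      p - top_of_set P interior_of p \<subseteq> \<Union>(\<Q> p)"
    by metis
  have "closed (\<Union>F)" using F(1,2) polytope_imp_closed by (intro closed_Union) auto
  then have cl: "closure S \<subseteq> \<Union>F"
    by (intro closure_minimal) (simp_all add: F(3) interior_of_subset)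
  have "p - S \<subseteq> \<Union>(\<Q> p)" if p: "p \<in> F" for p
  proof -
    have "top_of_set P interior_of p \<subseteq> S"
      unfolding F(3) using p by (intro interior_of_mono) auto
    then have "p - S \<subseteq> p - top_of_set P interior_of p" by (rule Diff_mono[OF order_refl])
    also have "\<dots> \<subseteq> \<Union>(\<Q> p)" using \<Q>[OF p] by simp
    finally show ?thesis .
  qed
  then have "(\<Union>p\<in>F. p - S) \<subseteq> (\<Union>p\<in>F. \<Union>(\<Q> p))" by (intro UN_mono order_refl)
  moreover have "closure S - S \<subseteq> (\<Union>p\<in>F. p - S)" using cl by auto
  ultimately have "closure S - S \<subseteq> (\<Union>p\<in>F. \<Union>(\<Q> p))" by (rule order_trans[rotated])
  also have "\<dots> = \<Union>(\<Union>p\<in>F. \<Q> p)" by auto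
  finally have "closure S - S \<subseteq> \<Union>(\<Union>p\<in>F. \<Q> p)" .
  then have "closure S - S \<subseteq> \<Union>(\<Union>p\<in>F. \<Q> p)" using cl by blast
  moreover have "finite (\<Union>p\<in>F. \<Q> p)" "(\<Union>p\<in>F. \<Q> p) \<subseteq> planes"
    using F(1) \<Q> by (simp_all add: UN_least)
  ultimately show ?thesis using \<Q> by (intro that[of "\<Union>p\<in>F. \<Q> p"]) blast+
qed

lemma polyhedral_open_in_bounded:
  assumes "polyhedral_open_in P S"
  shows "bounded S"
proof -
  obtain F where F: "finite F" "\<And>p. p \<in> F \<Longrightarrow> polytope p" "S = top_of_set P interior_of (\<Union>F)"
    using assms by (auto simp: polyhedral_open_in_def)
  have "bounded (\<Union>F)" using F(1,2) polytope_imp_bounded by (intro bounded_Union) auto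
  then show ?thesis using F(3) interior_of_subset bounded_subset by metis
qed

lemma polyhedral_open_imp_open: "polyhedral_open S \<Longrightarrow> open S"
  by (auto simp: polyhedral_open_in_def)

text \<open>Slits are excluded because \<open>S\<close> is the interior of a closed set. This
  regularity yields the later contradictions: a point having the set on both sides already belongs
  to it.\<close>

lemma polyhedral_open_interior_closure:
  assumes "polyhedral_open S"
  shows "interior (closure S) = S"
proof -
  obtain F where F: "finite F" "\<And>p. p \<in> F \<Longrightarrow> polytope p" "S = interior (\<Union>F)"
    using assms by (auto simp: polyhedral_open_in_def)
  have "closed (\<Union>F)" using F(1,2) polytope_imp_closed by (intro closed_Union) auto
  then have "closure S \<subseteq> \<Union>F" using F(3) interior_subset closure_minimal by metis
  then have "interior (closure S) \<subseteq> S" using F(3) interior_mono by metis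
  moreover have "S \<subseteq> interior (closure S)"
    using polyhedral_open_imp_open[OF assms] by (simp add: closure_subset interior_maximal)
  ultimately show ?thesis by auto
qed

lemma polyhedral_open_Int:
  assumes "polyhedral_open S" "polyhedral_open T"
  shows "polyhedral_open (S \<inter> T)"
proof -
  obtain F where F: "finite F" "\<And>p. p \<in> F \<Longrightarrow> polytope p" "S = interior (\<Union>F)"
    using assms by (auto simp: polyhedral_open_in_def)
  obtain G where G: "finite G" "\<And>p. p \<in> G \<Longrightarrow> polytope p" "T = interior (\<Union>G)"
    using assms by (auto simp: polyhedral_open_in_def)
  let ?H = "(\<lambda>(p, q). p \<inter> q) ` (F \<times> G)"
  have "\<Union>F \<inter> \<Union>G = \<Union>?H" by auto
  then have "S \<inter> T = interior (\<Union>?H)" using F(3) G(3) by (metis interior_Int)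
  moreover have "\<forall>p\<in>?H. polytope p" using F(2) G(2) by (auto intro: polytope_Int)
  ultimately show ?thesis using F(1) G(1) unfolding polyhedral_open_in_def
    by (intro exI[of _ ?H]) auto
qed

lemma polyhedral_open_frontier:
  fixes S :: "(real^3) set"
  assumes "polyhedral_open S"
  obtains \<Q> where "finite \<Q>" "\<Q> \<subseteq> planes" "frontier S \<subseteq> \<Union>\<Q>"
proof -
  obtain \<Q> where "finite \<Q>" "\<Q> \<subseteq> planes" "closure S - S \<subseteq> \<Union>\<Q>"
    by (rule polyhedral_open_in_boundary[OF assms]) (rule that)
  then show ?thesis
    using polyhedral_open_imp_open[OF assms] by (intro that[of \<Q>]) (auto simp: frontier_def interior_open)
qed

lemma negligible_polyhedral_frontier:
  fixes S :: "(real^3) set"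
  assumes "polyhedral_open S"
  shows "negligible (frontier S)"
proof -
  obtain \<Q> where \<Q>: "finite \<Q>" "\<Q> \<subseteq> planes" "frontier S \<subseteq> \<Union>\<Q>"
    by (rule polyhedral_open_frontier[OF assms])
  have "negligible Q" if "Q \<in> \<Q>" for Q
  proof -
    have "Q \<in> planes" using that \<Q>(2) by auto
    then obtain n c where "Q = {y. n \<bullet> y = c}" "n \<noteq> 0" by (rule plane_eq_hyperplane)
    then show ?thesis using negligible_hyperplane[of n c] by auto
  qed
  then show ?thesis using \<Q> negligible_Union negligible_subset by blast
qed

lemma plane_closed: "P \<in> planes \<Longrightarrow> closed P"
  by (metis plane_eq_hyperplane closed_hyperplane)

lemma plane_Int_null:
  assumes "P \<in> planes" "Q \<in> planes" "P \<noteq> Q"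
  shows "P \<inter> Q \<in> null_sets surface_measure"
proof -
  have b: "P \<in> sets borel" "Q \<in> sets borel" using assms plane_closed by auto
  have "emeasure surface_measure (P \<inter> Q) = emeasure (plane_area P) (P \<inter> Q)"
    by (rule emeasure_surface_measure_plane) (use assms b in auto)
  also have "\<dots> \<le> emeasure (plane_area P) Q"
    using b by (intro emeasure_mono) auto
  also have "\<dots> = 0" using emeasure_plane_area_Int[of Q P] assms by auto
  finally show ?thesis using b by (auto simp: null_sets_def)
qed

text \<open>Finiteness is needed because \<open>area\<close> is a real-valued
  \<open>measure\<close>, which assigns 0 to sets of infinite measure. The isometric parametrization
  pulls a bounded set back to a bounded set.\<close>

lemma emeasure_surface_bounded_plane:
  assumes P: "P \<in> planes" and A: "A \<in> sets borel" "A \<subseteq> P" "bounded A"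
  shows "emeasure surface_measure A < \<infinity>"
proof -
  obtain f :: "real^2 \<Rightarrow> real^3" and a where f: "linear f"
    "\<And>x y. dist (f x + a) (f y + a) = dist x y" "range (\<lambda>x. f x + a) = P"
    by (rule plane_parametrization[OF P]) (rule that)
  let ?\<phi> = "\<lambda>x. f x + a"
  have m: "?\<phi> \<in> borel_measurable borel"
    using f(2) by (auto simp: continuous_on_iff intro!: borel_measurable_continuous_onI)
  have "bounded (?\<phi> -` A)"
  proof -
    obtain e where e: "\<And>x y. x \<in> A \<Longrightarrow> y \<in> A \<Longrightarrow> dist x y \<le> e"
      using A(3) bounded_two_points by metis
    show ?thesis unfolding bounded_two_points
      by (rule exI[of _ e]) (use e f(2) in fastforce)
  qed
  then have "emeasure lborel (?\<phi> -` A) < \<infinity>"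
    by (rule emeasure_bounded_finite)
  then show ?thesis
    using emeasure_surface_measure_plane[OF P A(1,2)] plane_area_range[of ?\<phi>, OF f(2)] m A(1)
    by (simp add: f(3) emeasure_distr)
qed

text \<open>The preimage under the parametrization is open and nonempty in two dimensions.
  Positivity allows division by the areas of boundary elements.\<close>

lemma emeasure_surface_open_pos:
  assumes P: "P \<in> planes" and A: "openin (top_of_set P) A" "A \<noteq> {}"
  shows "emeasure surface_measure A > 0"
proof -
  obtain f :: "real^2 \<Rightarrow> real^3" and a where f: "linear f"
    "\<And>x y. dist (f x + a) (f y + a) = dist x y" "range (\<lambda>x. f x + a) = P"
    by (rule plane_parametrization[OF P]) (rule that)
  let ?\<phi> = "\<lambda>x. f x + a"
  have m: "?\<phi> \<in> borel_measurable borel"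
    using f(2) by (auto simp: continuous_on_iff intro!: borel_measurable_continuous_onI)
  have c: "continuous_on UNIV ?\<phi>" using f(2) by (auto simp: continuous_on_iff)
  obtain U where U: "open U" "A = P \<inter> U" using A(1) by (auto simp: openin_open)
  have AP: "A \<subseteq> P" and b: "A \<in> sets borel" using U plane_closed[OF P] by auto
  have eq: "?\<phi> -` A = ?\<phi> -` U" using U(2) f(3) by auto
  have op: "open (?\<phi> -` U)" using U(1) c by (simp add: continuous_on_open_vimage)
  have ne: "?\<phi> -` A \<noteq> {}" using A(2) AP f(3) by blast
  have "?\<phi> -` U \<notin> null_sets lborel"
    using open_not_negligible[OF op] ne eq op by (auto simp: negligible_iff_null_sets null_sets_def)
  then have "emeasure lborel (?\<phi> -` A) \<noteq> 0"
    using op eq by (auto simp: null_sets_def)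
  then have "emeasure lborel (?\<phi> -` A) > 0" by (simp add: zero_less_iff_neq_zero)
  then show ?thesis
    using emeasure_surface_measure_plane[OF P b AP] plane_area_range[of ?\<phi>, OF f(2)] m b
    by (simp add: f(3) emeasure_distr)
qed

text \<open>Unless the normals are opposite, the direction -(n + m) makes an obtuse angle with both,
  so a short step along it from \<open>x\<close> enters \<open>D\<close> and \<open>E\<close> at
  once.\<close>

lemma outer_unit_normals_opposite:
  fixes D :: "'a::euclidean_space set"
  assumes "outer_unit_normal D x n" "outer_unit_normal E x m" "D \<inter> E = {}"
  shows "m = - n"
proof (rule ccontr)
  assume ne: "m \<noteq> - n"
  obtain r where r: "r > 0" "\<forall>y\<in>ball x r. y \<in> D \<longleftrightarrow> (y - x) \<bullet> n < 0" and n: "norm n = 1"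
    using assms(1) by (auto simp: outer_unit_normal_def)
  obtain s where s: "s > 0" "\<forall>y\<in>ball x s. y \<in> E \<longleftrightarrow> (y - x) \<bullet> m < 0" and m: "norm m = 1"
    using assms(2) by (auto simp: outer_unit_normal_def)
  \<comment> \<open>As n + m has norm at most 2, the displacement is at most half of the smaller
    radius.\<close>
  define t where "t = min r s / 4"
  define y where "y = x - t *\<^sub>R (n + m)"
  have t: "t > 0" using r s by (auto simp: t_def)
  have "norm (n + m) \<le> 2" using n m norm_triangle_ineq[of n m] by simp
  then have "norm (t *\<^sub>R (n + m)) \<le> t * 2" using t by simp
  then have "dist x y < min r s" using r(1) s(1) by (simp add: y_def dist_norm t_def)
  then have y: "y \<in> ball x r" "y \<in> ball x s" by auto
  have nm: "n \<bullet> m > -1"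
  proof -
    have "n \<bullet> m \<noteq> -1"
    proof
      assume "n \<bullet> m = -1"
      then have "(m + n) \<bullet> (m + n) = 0" using n m
        by (simp add: inner_add_left inner_add_right inner_commute norm_eq_1)
      then show False using ne by (simp add: add_eq_0_iff)
    qed
    moreover have "\<bar>n \<bullet> m\<bar> \<le> 1" using Cauchy_Schwarz_ineq2[of n m] n m by simp
    ultimately show ?thesis by linarith
  qed
  have "(y - x) \<bullet> n = - t * (1 + n \<bullet> m)" "(y - x) \<bullet> m = - t * (1 + n \<bullet> m)"
    using n m inner_commute[of m n] by (simp_all add: y_def inner_add_left norm_eq_1 algebra_simps)
  moreover have "t * (1 + n \<bullet> m) > 0" using t nm by auto
  ultimately have "y \<in> D" "y \<in> E" using r(2) s(2) y by auto
  then show False using assms(3) by auto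
qed

lemma outer_unit_normal_unique:
  fixes D :: "'a::euclidean_space set"
  assumes "outer_unit_normal D x n" "outer_unit_normal D x m"
  shows "m = n"
proof -
  obtain r where r: "r > 0" "\<forall>y\<in>ball x r. y \<in> D \<longleftrightarrow> (y - x) \<bullet> m < 0" and m: "norm m = 1"
    using assms(2) by (auto simp: outer_unit_normal_def)
  \<comment> \<open>Locally this is the other side of \<open>D\<close>, disjoint from
    \<open>D\<close> by construction and with outer normal -m, so the comparison of opposite normals
    applies to it.\<close>
  let ?E = "{y. (y - x) \<bullet> m > 0} - D"
  have "outer_unit_normal ?E x (- m)"
    unfolding outer_unit_normal_def using r m by (auto intro!: exI[of _ r])
  then have "- m = - n" by (rule outer_unit_normals_opposite[OF assms(1)]) auto
  then show ?thesis by simp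
qed

text \<open>Near \<open>x\<close> the two sets fill the two open half-balls; only points of the
  common hyperplane can be missing, and its complement is dense.\<close>

lemma opposite_normals_interior:
  fixes D :: "'a::euclidean_space set"
  assumes "outer_unit_normal D x n" "outer_unit_normal E x m" "D \<inter> E = {}"
  shows "x \<in> interior (closure (D \<union> E))"
proof -
  obtain r where r: "r > 0" "\<forall>y\<in>ball x r. y \<in> D \<longleftrightarrow> (y - x) \<bullet> n < 0" and n: "norm n = 1"
    using assms(1) by (auto simp: outer_unit_normal_def)
  have m: "m = - n" by (rule outer_unit_normals_opposite[OF assms])
  obtain s where s: "s > 0" "\<forall>y\<in>ball x s. y \<in> E \<longleftrightarrow> (y - x) \<bullet> m < 0"
    using assms(2) by (auto simp: outer_unit_normal_def)
  define B where "B = ball x (min r s)"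
  have "B \<inter> - {y. n \<bullet> y = n \<bullet> x} \<subseteq> D \<union> E"
    using r(2) s(2) m by (auto simp: B_def inner_diff_left inner_diff_right inner_commute)
  moreover have "B \<subseteq> closure (B \<inter> - {y. n \<bullet> y = n \<bullet> x})"
  proof -
    have "interior {y. n \<bullet> y = n \<bullet> x} = {}" using n by (intro interior_hyperplane) auto
    then have "closure (- {y. n \<bullet> y = n \<bullet> x}) = UNIV" by (simp add: closure_complement)
    moreover have "open B" by (simp add: B_def)
    ultimately show ?thesis using open_Int_closure_subset[of B "- {y. n \<bullet> y = n \<bullet> x}"] by auto
  qed
  ultimately have "B \<subseteq> closure (D \<union> E)" by (meson closure_mono order_trans)
  moreover have "open B" "x \<in> B" using r s by (auto simp: B_def)
  ultimately show ?thesis by (meson interior_maximal subsetD)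
qed

lemma connected_disjoint_frontier:
  assumes "connected S" "S \<inter> frontier D = {}"
  shows "S \<subseteq> D \<or> S \<inter> D = {}"
  using connected_Int_frontier[OF assms(1), of D] assms(2) by blast

text \<open>Off the pairwise intersections of the finitely many boundary planes, the frontier near
  \<open>x\<close> lies in a single plane, which cuts a small ball into two halves. Each half, being
  connected and free of frontier points, is inside or outside \<open>D\<close>, and exactly one is
  inside.\<close>

lemma polyhedral_outer_unit_normal:
  fixes D :: "(real^3) set"
  assumes D: "polyhedral_open D"
  obtains N where "N \<in> null_sets surface_measure"
    "\<And>x. x \<in> frontier D \<Longrightarrow> x \<notin> N \<Longrightarrow> \<exists>n. outer_unit_normal D x n"
proof -
  obtain \<Q> where \<Q>: "finite \<Q>" "\<Q> \<subseteq> planes" "frontier D \<subseteq> \<Union>\<Q>"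
    by (rule polyhedral_open_frontier[OF D])
  define N where "N = (\<Union>P\<in>\<Q>. \<Union>Q\<in>\<Q> - {P}. P \<inter> Q)"
  have "N \<in> null_sets surface_measure" unfolding N_def using \<Q>(1,2)
    by (intro null_sets.finite_UN plane_Int_null) auto
  moreover have "\<exists>n. outer_unit_normal D x n" if x: "x \<in> frontier D" "x \<notin> N" for x
  proof -
    have opD: "open D" by (rule polyhedral_open_imp_open[OF D])
    obtain P where P: "P \<in> \<Q>" "x \<in> P" using \<Q>(3) x(1) by auto
    obtain a c where P_eq: "P = {y. a \<bullet> y = c}" and "a \<noteq> 0" using plane_eq_hyperplane[of P] P(1) \<Q>(2) by blast
    have ax: "a \<bullet> x = c" using P P_eq by auto
    have "closed (\<Union>(\<Q> - {P}))" using \<Q>(1,2) plane_closed by (intro closed_Union) auto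
    moreover have "x \<notin> \<Union>(\<Q> - {P})" using x(2) P by (auto simp: N_def)
    ultimately obtain r where r: "r > 0" "ball x r \<subseteq> - \<Union>(\<Q> - {P})"
      by (metis Compl_iff open_Compl open_contains_ball)
    define B1 where "B1 = ball x r \<inter> {y. a \<bullet> y < c}"
    define B2 where "B2 = ball x r \<inter> {y. a \<bullet> y > c}"
    have fr: "frontier D \<inter> ball x r \<subseteq> P" using r(2) \<Q>(3) by blast
    have "B1 \<subseteq> D \<or> B1 \<inter> D = {}" unfolding B1_def using fr P_eq
      by (intro connected_disjoint_frontier convex_connected convex_Int convex_halfspace_lt) auto
    moreover have "B2 \<subseteq> D \<or> B2 \<inter> D = {}" unfolding B2_def using fr P_eq
      by (intro connected_disjoint_frontier convex_connected convex_Int convex_halfspace_gt) auto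
    moreover have dense: "y \<in> closure B1" "y \<in> closure B2" if y: "y \<in> ball x r" "y \<in> P" for y
    proof -
      have "y \<in> closure {y. a \<bullet> y < c}" "y \<in> closure {y. a \<bullet> y > c}"
        using \<open>a \<noteq> 0\<close> y P_eq by (auto simp: closure_halfspace_lt closure_halfspace_gt)
      then show "y \<in> closure B1" "y \<in> closure B2"
        using y open_Int_closure_subset[OF open_ball, of x r] unfolding B1_def B2_def by blast+
    qed
    have part: "ball x r \<subseteq> B1 \<union> B2 \<union> P" unfolding B1_def B2_def P_eq by auto
    have xc: "x \<in> closure D" "x \<notin> D" using x(1) opD by (auto simp: frontier_def interior_open)
    \<comment> \<open>Otherwise \<open>x\<close> would be interior to \<open>closure D\<close>,
      hence in \<open>D\<close> by regularity.\<close>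
    have "\<not> (B1 \<subseteq> D \<and> B2 \<subseteq> D)"
    proof
      assume *: "B1 \<subseteq> D \<and> B2 \<subseteq> D"
      have "ball x r \<subseteq> closure D"
      proof
        fix y assume y: "y \<in> ball x r"
        show "y \<in> closure D"
        proof (cases "y \<in> P")
          case True
          then show ?thesis using dense(1)[OF y] * closure_mono by blast
        next
          case False
          then show ?thesis using part y * closure_subset by blast
        qed
      qed
      then have "x \<in> interior (closure D)" using r(1) by (meson centre_in_ball interior_maximal open_ball subsetD)
      then show False using xc polyhedral_open_interior_closure[OF D] by auto
    qed
    \<comment> \<open>Points of the plane are limits of both halves, so they cannot lie in the open
      set \<open>D\<close> when one half misses it.\<close>
    moreover have noP: "y \<notin> D" if "B1 \<inter> D = {} \<or> B2 \<inter> D = {}" "y \<in> ball x r" "y \<in> P" for y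
      using dense[OF that(2,3)] that(1) opD open_Int_closure_eq_empty[of D] by (metis Int_commute disjoint_iff)
    moreover have "\<not> (B1 \<inter> D = {} \<and> B2 \<inter> D = {})"
    proof
      assume *: "B1 \<inter> D = {} \<and> B2 \<inter> D = {}"
      then have "ball x r \<inter> D = {}" using part noP by blast
      then show False using xc(1) r(1) open_Int_closure_eq_empty[of "ball x r" D] centre_in_ball[of x r] by blast
    qed
    ultimately consider "B1 \<subseteq> D" "B2 \<inter> D = {}" | "B2 \<subseteq> D" "B1 \<inter> D = {}" by blast
    then obtain n :: "real^3" where "norm n = 1" "\<forall>y\<in>ball x r. y \<in> D \<longleftrightarrow> (y - x) \<bullet> n < 0"
    proof cases
      case 1
      let ?n = "a /\<^sub>R norm a"
      have "(y \<in> D) = ((y - x) \<bullet> ?n < 0)" if y: "y \<in> ball x r" for y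
      proof -
        have "(y - x) \<bullet> ?n < 0 \<longleftrightarrow> a \<bullet> y < c"
          using \<open>a \<noteq> 0\<close> ax by (simp add: inner_diff_right inner_commute[of _ a] divide_simps)
        then show ?thesis using 1 y noP[OF _ y] unfolding B1_def B2_def P_eq
          by (cases "a \<bullet> y" c rule: linorder_cases) auto
      qed
      then show ?thesis using \<open>a \<noteq> 0\<close> by (intro that[of ?n]) auto
    next
      case 2
      let ?n = "- (a /\<^sub>R norm a)"
      have "(y \<in> D) = ((y - x) \<bullet> ?n < 0)" if y: "y \<in> ball x r" for y
      proof -
        have "(y - x) \<bullet> ?n < 0 \<longleftrightarrow> a \<bullet> y > c"
          using \<open>a \<noteq> 0\<close> ax by (simp add: inner_diff_right inner_commute[of _ a] divide_simps)
        then show ?thesis using 2 y noP[OF _ y] unfolding B1_def B2_def P_eq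
          by (cases "a \<bullet> y" c rule: linorder_cases) auto
      qed
      then show ?thesis using \<open>a \<noteq> 0\<close> by (intro that[of ?n]) auto
    qed
    then show ?thesis using r(1) by (auto simp: outer_unit_normal_def)
  qed
  ultimately show ?thesis by (rule that)
qed

lemma polyhedral_open_in_openin: "polyhedral_open_in P S \<Longrightarrow> openin (top_of_set P) S"
  by (auto simp: polyhedral_open_in_def)

lemma polyhedral_open_in_plane_borel:
  assumes P: "P \<in> planes" and S: "polyhedral_open_in P S"
  shows "S \<in> sets borel"
proof -
  obtain U where "open U" "S = P \<inter> U"
    using polyhedral_open_in_openin[OF S] by (auto simp: openin_open)
  then show ?thesis using plane_closed[OF P] by auto
qed

text \<open>The relative boundary lies on planes other than \<open>P\<close>, each meeting
  \<open>P\<close> in a null set. Closures of boundary elements may thus be replaced by the elements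
  themselves when areas are computed.\<close>

lemma polyhedral_open_in_plane_boundary_null:
  assumes P: "P \<in> planes" and S: "polyhedral_open_in P S"
  shows "closure S - S \<in> null_sets surface_measure"
proof -
  obtain \<Q> where \<Q>: "finite \<Q>" "\<Q> \<subseteq> planes" "\<And>Q. Q \<in> \<Q> \<Longrightarrow> \<not> P \<subseteq> Q" "closure S - S \<subseteq> \<Union>\<Q>"
    by (rule polyhedral_open_in_boundary[OF S]) (rule that)
  have "S \<subseteq> P" using polyhedral_open_in_openin[OF S] openin_imp_subset by auto
  then have "closure S \<subseteq> P" using plane_closed[OF P] by (simp add: closure_minimal)
  then have sub: "closure S - S \<subseteq> (\<Union>Q\<in>\<Q>. P \<inter> Q)" using \<Q>(4) by fastforce
  have "(\<Union>Q\<in>\<Q>. P \<inter> Q) \<in> null_sets surface_measure"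
    using P \<Q>(1-3) by (intro null_sets.finite_UN plane_Int_null) auto
  then show ?thesis
    by (rule null_sets_subset) (use sub polyhedral_open_in_plane_borel[OF P S] in auto)
qed

lemma polyhedral_open_in_plane_finite:
  assumes P: "P \<in> planes" and S: "polyhedral_open_in P S"
  shows "emeasure surface_measure S < \<infinity>"
  using polyhedral_open_in_openin[OF S] openin_imp_subset
  by (intro emeasure_surface_bounded_plane[OF P] polyhedral_open_in_plane_borel[OF P S]
        polyhedral_open_in_bounded[OF S]) auto

lemma polyhedral_open_in_plane_area_pos:
  assumes P: "P \<in> planes" and S: "polyhedral_open_in P S" and "S \<noteq> {}"
  shows "area S > 0"
  using emeasure_surface_open_pos[OF P polyhedral_open_in_openin[OF S] \<open>S \<noteq> {}\<close>]
    polyhedral_open_in_plane_finite[OF P S]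
  by (simp add: measure_def enn2real_positive_iff)

text \<open>This serves both kinds of boundary: \<open>F\<close> is the frontier that selects the
  elements, \<open>B\<close> the part whose area occurs in the scheme, and on an element they may
  differ by the null set \<open>N\<close>. By \<open>sub\<close> an element meeting \<open>F\<close>
  in positive area lies in \<open>F\<close> completely, so no element is counted partially.\<close>

lemma area_eq_sum_elements:
  fixes Z :: "'b \<Rightarrow> (real^3) set"
  assumes A: "finite A" "disjoint_family_on Z A"
    and Z: "\<And>\<alpha>. \<alpha> \<in> A \<Longrightarrow> \<exists>P\<in>planes. polyhedral_open_in P (Z \<alpha>)"
    and B: "B \<in> sets borel" "B \<subseteq> (\<Union>\<alpha>\<in>A. closure (Z \<alpha>))" and F: "F \<in> sets borel"
    and N: "N \<in> null_sets surface_measure" "\<And>\<alpha>. \<alpha> \<in> A \<Longrightarrow> B \<inter> Z \<alpha> - N = Z \<alpha> \<inter> F - N"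
    and sub: "\<And>\<alpha>. \<alpha> \<in> A \<Longrightarrow> area (Z \<alpha> \<inter> F) \<noteq> 0 \<Longrightarrow> Z \<alpha> \<subseteq> F"
  shows "(\<Sum>\<alpha>\<in>{\<alpha>\<in>A. area (Z \<alpha> \<inter> F) \<noteq> 0}. area (Z \<alpha>)) = area B"
proof -
  have bor: "Z \<alpha> \<in> sets borel" and fin: "emeasure surface_measure (Z \<alpha>) < \<infinity>"
    and null: "closure (Z \<alpha>) - Z \<alpha> \<in> null_sets surface_measure" if "\<alpha> \<in> A" for \<alpha>
    using Z[OF that] polyhedral_open_in_plane_borel polyhedral_open_in_plane_finite
      polyhedral_open_in_plane_boundary_null by blast+
  \<comment> \<open>The relative boundaries of the elements join the exceptional set, since only
    their closures are assumed to cover \<open>B\<close>.\<close>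
  define M where "M = N \<union> (\<Union>\<alpha>\<in>A. closure (Z \<alpha>) - Z \<alpha>)"
  have M: "M \<in> null_sets surface_measure"
    unfolding M_def using N(1) A(1) null by (intro null_sets.Un null_sets.finite_UN) auto
  have "x \<in> B \<longleftrightarrow> x \<in> (\<Union>\<alpha>\<in>A. Z \<alpha> \<inter> F)" if "x \<notin> M" for x
  proof
    assume x: "x \<in> B"
    then obtain \<alpha> where \<alpha>: "\<alpha> \<in> A" "x \<in> closure (Z \<alpha>)" using B(2) by auto
    then have "x \<in> Z \<alpha>" "x \<notin> N" using that by (auto simp: M_def)
    then have "x \<in> B \<inter> Z \<alpha> - N" using x by simp
    then show "x \<in> (\<Union>\<alpha>\<in>A. Z \<alpha> \<inter> F)" unfolding N(2)[OF \<alpha>(1)] using \<alpha>(1) by auto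
  next
    assume "x \<in> (\<Union>\<alpha>\<in>A. Z \<alpha> \<inter> F)"
    then obtain \<alpha> where \<alpha>: "\<alpha> \<in> A" "x \<in> Z \<alpha> \<inter> F" by auto
    then have "x \<in> Z \<alpha> \<inter> F - N" using that by (auto simp: M_def)
    then show "x \<in> B" unfolding N(2)[OF \<alpha>(1), symmetric] by simp
  qed
  then have "AE x in surface_measure. x \<in> B \<longleftrightarrow> x \<in> (\<Union>\<alpha>\<in>A. Z \<alpha> \<inter> F)"
    using AE_not_in[OF M] by (rule eventually_mono[rotated])
  then have "area B = area (\<Union>\<alpha>\<in>A. Z \<alpha> \<inter> F)"
    using A(1) B(1) F bor by (intro measure_eq_AE) auto
  also have "\<dots> = (\<Sum>\<alpha>\<in>A. area (Z \<alpha> \<inter> F))"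
  proof (rule measure_finite_Union[OF A(1)])
    show "(\<lambda>\<alpha>. Z \<alpha> \<inter> F) ` A \<subseteq> sets surface_measure" using bor F by auto
    show "disjoint_family_on (\<lambda>\<alpha>. Z \<alpha> \<inter> F) A" using A(2) by (auto simp: disjoint_family_on_def)
    show "emeasure surface_measure (Z \<alpha> \<inter> F) \<noteq> \<infinity>" if "\<alpha> \<in> A" for \<alpha>
    proof -
      have "emeasure surface_measure (Z \<alpha> \<inter> F) \<le> emeasure surface_measure (Z \<alpha>)"
        using bor[OF that] F by (intro emeasure_mono) auto
      then show ?thesis using fin[OF that] by (auto simp: top_unique)
    qed
  qed
  also have "\<dots> = (\<Sum>\<alpha>\<in>{\<alpha>\<in>A. area (Z \<alpha> \<inter> F) \<noteq> 0}. area (Z \<alpha> \<inter> F))"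
    using A(1) by (intro sum.mono_neutral_right) auto
  also have "\<dots> = (\<Sum>\<alpha>\<in>{\<alpha>\<in>A. area (Z \<alpha> \<inter> F) \<noteq> 0}. area (Z \<alpha>))"
    by (rule sum.cong[OF refl]) (metis (mono_tags, lifting) Int_absorb2[OF sub] mem_Collect_eq)
  finally show ?thesis by simp
qed

lemma area_eq_0_null: "A \<subseteq> N \<Longrightarrow> N \<in> null_sets surface_measure \<Longrightarrow> A \<in> sets borel \<Longrightarrow> area A = 0"
  by (metis measure_eq_0_null_sets null_sets_subset sets_surface_measure)

lemma frontier_Int_local:
  assumes "open U" "x \<in> U" "A \<inter> U = B \<inter> U"
  shows "x \<in> frontier A \<longleftrightarrow> x \<in> frontier B"
proof -
  have "x \<in> closure S \<longleftrightarrow> x \<in> closure (S \<inter> U)" for S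
    using open_Int_closure_subset[OF assms(1), of S] closure_mono[of "S \<inter> U" S] assms(2)
    by (auto simp: Int_commute)
  moreover have "x \<in> interior S \<longleftrightarrow> x \<in> interior (S \<inter> U)" for S
    using assms(1,2) by (simp add: interior_open)
  ultimately show ?thesis unfolding frontier_def using assms(3) by (metis Diff_iff)
qed

section \<open>Cells, interface and boundary elements\<close>

context fv_setting
begin

lemma open_\<Omega>: "open (\<Omega> D)"
  by (rule polyhedral_open_imp_open[OF \<Omega>_polyhedral])

lemma open_\<Omega>\<^sub>m: "open (\<Omega>\<^sub>m D p)"
  by (rule polyhedral_open_imp_open[OF \<Omega>\<^sub>m_polyhedral])

lemma finite_cells: "finite (cells D)"
  using cells_partition by (simp add: partition_up_to_boundary_def)

lemma cell_subset: "i \<in> cells D \<Longrightarrow> \<omega> D i \<subseteq> \<Omega> D"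
  using cells_partition by (simp add: partition_up_to_boundary_def)

lemma cells_disjoint: "i \<in> cells D \<Longrightarrow> j \<in> cells D \<Longrightarrow> i \<noteq> j \<Longrightarrow> \<omega> D i \<inter> \<omega> D j = {}"
  using cells_partition by (simp add: partition_up_to_boundary_def disjoint_family_on_def)

lemma cells_nonempty: "cells D \<noteq> {}"
  using cells_partition \<Omega>_nonempty by (auto simp: partition_up_to_boundary_def)

lemma open_cell: "i \<in> cells D \<Longrightarrow> open (\<omega> D i)"
  by (rule polyhedral_open_imp_open[OF \<omega>_polyhedral])

lemma polyhedral_\<omega>\<^sub>m: "i \<in> cells D \<Longrightarrow> polyhedral_open (\<omega>\<^sub>m D p i)"
  unfolding \<omega>\<^sub>m_def by (intro polyhedral_open_Int \<omega>_polyhedral \<Omega>\<^sub>m_polyhedral)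

lemma open_\<omega>\<^sub>m: "i \<in> cells D \<Longrightarrow> open (\<omega>\<^sub>m D p i)"
  by (rule polyhedral_open_imp_open[OF polyhedral_\<omega>\<^sub>m])

lemma finite_elements: "finite (I\<^sub>\<Omega> D)" "finite (I\<^sub>\<Sigma> D)"
  using \<zeta>\<^sub>\<Omega>_partition \<zeta>\<^sub>\<Sigma>_partition by (auto simp: partition_up_to_boundary_def)

lemma area_element_pos: "\<alpha> \<in> I\<^sub>\<Omega> D \<union> I\<^sub>\<Sigma> D \<Longrightarrow> area (\<zeta> D \<alpha>) > 0"
  using \<zeta>_polyhedral \<zeta>_nonempty polyhedral_open_in_plane_area_pos by metis

lemma \<zeta>_borel: "\<alpha> \<in> I\<^sub>\<Omega> D \<union> I\<^sub>\<Sigma> D \<Longrightarrow> \<zeta> D \<alpha> \<in> sets borel"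
  using \<zeta>_polyhedral polyhedral_open_in_plane_borel by metis

lemma \<Gamma>\<^sub>\<Omega>_not_\<Omega>: "x \<in> \<Gamma>\<^sub>\<Omega> D \<Longrightarrow> x \<notin> \<Omega> D"
proof -
  have "\<Omega> D \<inter> open_rad D = {}" using closure_subset by (auto simp: open_rad_def)
  then have "\<Omega> D \<inter> closure (open_rad D) = {}"
    using open_\<Omega> open_Int_closure_eq_empty by blast
  then show "x \<in> \<Gamma>\<^sub>\<Omega> D \<Longrightarrow> x \<notin> \<Omega> D" by (auto simp: \<Gamma>\<^sub>\<Omega>_def)
qed

lemma \<Gamma>\<^sub>\<Omega>_frontier: "\<Gamma>\<^sub>\<Omega> D \<subseteq> frontier (\<Omega> D)"
  using \<Gamma>\<^sub>\<Omega>_not_\<Omega> open_\<Omega> by (auto simp: \<Gamma>\<^sub>\<Omega>_def frontier_def interior_open)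

text \<open>The outer boundary is disjoint from the gas boundary, so \<open>x\<close> has a
  neighbourhood missing the closure of the gas region. There \<Omega> lies in the closure of the
  solid region and, by regularity, in the solid region itself.\<close>

lemma frontier_cell_solid:
  assumes "x \<in> frontier (\<Omega> D)"
  shows "x \<in> frontier (\<omega>\<^sub>m D Solid i) \<longleftrightarrow> x \<in> frontier (\<omega> D i \<inter> \<Omega> D)"
proof -
  have sub: "\<Omega>\<^sub>m D p \<subseteq> \<Omega> D" for p
  proof -
    have "\<Omega>\<^sub>m D p \<subseteq> closure (\<Omega> D)" using closure_\<Omega> closure_subset by (cases p) auto
    then show ?thesis
      using polyhedral_open_interior_closure[OF \<Omega>_polyhedral] open_\<Omega>\<^sub>m interior_maximal by metis
  qed
  define U where "U = - closure (\<Omega>\<^sub>m D Gas)"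
  have "x \<notin> \<Omega>\<^sub>m D Gas" using assms sub open_\<Omega> by (auto simp: frontier_def interior_open)
  moreover have "x \<notin> frontier (\<Omega>\<^sub>m D Gas)" using assms frontier_disjoint by auto
  ultimately have x: "x \<in> U" unfolding U_def closure_Un_frontier by auto
  have U: "open U" by (simp add: U_def open_Compl)
  have "\<Omega> D \<inter> U \<subseteq> closure (\<Omega>\<^sub>m D Solid)" using closure_\<Omega> closure_subset by (auto simp: U_def)
  then have "\<Omega> D \<inter> U \<subseteq> \<Omega>\<^sub>m D Solid"
    using polyhedral_open_interior_closure[OF \<Omega>\<^sub>m_polyhedral, of Solid] open_\<Omega> U
    by (metis interior_maximal open_Int)
  then have "\<omega>\<^sub>m D Solid i \<inter> U = (\<omega> D i \<inter> \<Omega> D) \<inter> U" using sub by (auto simp: \<omega>\<^sub>m_def)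
  then show ?thesis by (rule frontier_Int_local[OF U x])
qed

lemma frontier_cell_\<Gamma>\<^sub>\<Omega>:
  assumes "i \<in> cells D"
  shows "frontier (\<omega>\<^sub>m D Solid i) \<inter> \<Gamma>\<^sub>\<Omega> D = frontier (\<omega> D i) \<inter> \<Gamma>\<^sub>\<Omega> D"
  using frontier_cell_solid \<Gamma>\<^sub>\<Omega>_frontier cell_subset[OF assms] by (auto simp: Int_absorb2)

lemma cell\<^sub>\<Omega>_props:
  assumes "\<alpha> \<in> I\<^sub>\<Omega> D"
  shows "cell\<^sub>\<Omega> D \<alpha> \<in> cells D" "\<zeta> D \<alpha> \<subseteq> frontier (\<omega> D (cell\<^sub>\<Omega> D \<alpha>)) \<inter> \<Gamma>\<^sub>\<Omega> D"
  using theI'[OF cell\<^sub>\<Omega>_unique[OF assms], folded cell\<^sub>\<Omega>_def] by blast+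

lemma cell\<^sub>\<Sigma>_props:
  assumes "\<alpha> \<in> I\<^sub>\<Sigma> D"
  shows "cell\<^sub>\<Sigma> D \<alpha> \<in> cells D" "\<zeta> D \<alpha> \<subseteq> frontier (\<omega>\<^sub>m D Solid (cell\<^sub>\<Sigma> D \<alpha>)) \<inter> \<Sigma> D"
  using theI'[OF cell\<^sub>\<Sigma>_unique[OF assms], folded cell\<^sub>\<Sigma>_def] by blast+

text \<open>Two cells on opposite sides of an element would put it into the interior of \<open>\<Omega>\<close>.\<close>

lemma cell\<^sub>\<Omega>_eq:
  assumes i: "i \<in> cells D" and \<alpha>: "\<alpha> \<in> J\<^sub>\<Omega> D i"
  shows "cell\<^sub>\<Omega> D \<alpha> = i"
proof (rule ccontr)
  define j where "j = cell\<^sub>\<Omega> D \<alpha>"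
  assume "cell\<^sub>\<Omega> D \<alpha> \<noteq> i"
  then have "j \<noteq> i" by (simp add: j_def)
  have \<alpha>': "\<alpha> \<in> I\<^sub>\<Omega> D" "area (\<zeta> D \<alpha> \<inter> frontier (\<omega> D i)) \<noteq> 0" using \<alpha> by (auto simp: J\<^sub>\<Omega>_def)
  have j: "j \<in> cells D" "\<zeta> D \<alpha> \<subseteq> frontier (\<omega> D j) \<inter> \<Gamma>\<^sub>\<Omega> D"
    using cell\<^sub>\<Omega>_props[OF \<alpha>'(1)] by (simp_all add: j_def)
  obtain N1 where N1: "N1 \<in> null_sets surface_measure"
    "\<And>x. x \<in> frontier (\<omega> D i) \<Longrightarrow> x \<notin> N1 \<Longrightarrow> \<exists>n. outer_unit_normal (\<omega> D i) x n"
    by (rule polyhedral_outer_unit_normal[OF \<omega>_polyhedral[OF i]]) (rule that)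
  obtain N2 where N2: "N2 \<in> null_sets surface_measure"
    "\<And>x. x \<in> frontier (\<omega> D j) \<Longrightarrow> x \<notin> N2 \<Longrightarrow> \<exists>n. outer_unit_normal (\<omega> D j) x n"
    by (rule polyhedral_outer_unit_normal[OF \<omega>_polyhedral[OF j(1)]]) (rule that)
  have "\<zeta> D \<alpha> \<inter> frontier (\<omega> D i) \<subseteq> N1 \<union> N2"
  proof
    fix x assume x: "x \<in> \<zeta> D \<alpha> \<inter> frontier (\<omega> D i)"
    show "x \<in> N1 \<union> N2"
    proof (rule ccontr)
      assume "x \<notin> N1 \<union> N2"
      then obtain n m where "outer_unit_normal (\<omega> D i) x n" "outer_unit_normal (\<omega> D j) x m"
        using N1(2) N2(2) x j(2) by blast
      then have "x \<in> interior (closure (\<omega> D i \<union> \<omega> D j))"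
        by (rule opposite_normals_interior) (use cells_disjoint i j \<open>j \<noteq> i\<close> in auto)
      also have "\<dots> \<subseteq> interior (closure (\<Omega> D))"
        using cell_subset i j by (intro interior_mono closure_mono) auto
      also have "\<dots> = \<Omega> D" by (rule polyhedral_open_interior_closure[OF \<Omega>_polyhedral])
      finally show False using x j(2) \<Gamma>\<^sub>\<Omega>_not_\<Omega> by blast
    qed
  qed
  then have "area (\<zeta> D \<alpha> \<inter> frontier (\<omega> D i)) = 0"
    using N1(1) N2(1) \<zeta>_borel \<alpha>'(1) by (intro area_eq_0_null[of _ "N1 \<union> N2"]) auto
  then show False using \<alpha>'(2) by simp
qed

lemma sum_area_J\<^sub>\<Omega>:
  assumes i: "i \<in> cells D"
  shows "(\<Sum>\<alpha>\<in>J\<^sub>\<Omega> D i. area (\<zeta> D \<alpha>)) = area (frontier (\<omega>\<^sub>m D Solid i) \<inter> \<Gamma>\<^sub>\<Omega> D)"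
proof -
  have part: "disjoint_family_on (\<zeta> D) (I\<^sub>\<Omega> D)" "\<And>\<alpha>. \<alpha> \<in> I\<^sub>\<Omega> D \<Longrightarrow> \<zeta> D \<alpha> \<subseteq> \<Gamma>\<^sub>\<Omega> D"
      "\<Gamma>\<^sub>\<Omega> D \<subseteq> (\<Union>\<alpha>\<in>I\<^sub>\<Omega> D. closure (\<zeta> D \<alpha>))"
    using \<zeta>\<^sub>\<Omega>_partition by (auto simp: partition_up_to_boundary_def)
  show ?thesis unfolding J\<^sub>\<Omega>_def frontier_cell_\<Gamma>\<^sub>\<Omega>[OF i]
  \<comment> \<open>Elements lie in \<open>\<Gamma>\<^sub>\<Omega> D\<close>, so intersecting with
    it changes nothing on an element and no exceptional set arises.\<close>
  proof (rule area_eq_sum_elements[where N = "{}"])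
    show "frontier (\<omega> D i) \<inter> \<Gamma>\<^sub>\<Omega> D \<in> sets borel" by (auto simp: \<Gamma>\<^sub>\<Omega>_def)
    show "\<zeta> D \<alpha> \<subseteq> frontier (\<omega> D i)" if "\<alpha> \<in> I\<^sub>\<Omega> D" "area (\<zeta> D \<alpha> \<inter> frontier (\<omega> D i)) \<noteq> 0" for \<alpha>
      using cell\<^sub>\<Omega>_props(2)[OF that(1)] cell\<^sub>\<Omega>_eq[OF i, of \<alpha>] that by (auto simp: J\<^sub>\<Omega>_def)
    show "frontier (\<omega> D i) \<inter> \<Gamma>\<^sub>\<Omega> D \<inter> \<zeta> D \<alpha> - {} = \<zeta> D \<alpha> \<inter> frontier (\<omega> D i) - {}" if "\<alpha> \<in> I\<^sub>\<Omega> D" for \<alpha>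
      using part(2)[OF that] by auto
  qed (use part finite_elements \<zeta>_polyhedral in auto)
qed

text \<open>Interface matching gives both parts of the cell a normal at a regular point, so they lie on
  opposite sides of the interface there.\<close>

lemma frontier_solid_cell_interface:
  assumes i: "i \<in> cells D"
  obtains N where "N \<in> null_sets surface_measure"
    "frontier (\<omega>\<^sub>m D Solid i) \<inter> \<Sigma> D - N = \<omega> D i \<inter> \<Sigma> D - N"
proof -
  obtain N where N: "N \<in> null_sets surface_measure"
    "\<And>x. x \<in> frontier (\<omega>\<^sub>m D Solid i) \<Longrightarrow> x \<notin> N \<Longrightarrow> \<exists>n. outer_unit_normal (\<omega>\<^sub>m D Solid i) x n"
    by (rule polyhedral_outer_unit_normal[OF polyhedral_\<omega>\<^sub>m[OF i]]) (rule that)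
  have "x \<in> \<omega> D i" if x: "x \<in> frontier (\<omega>\<^sub>m D Solid i)" "x \<in> \<Sigma> D" "x \<notin> N" for x
  proof -
    obtain n where n: "outer_unit_normal (\<omega>\<^sub>m D Solid i) x n" using N(2) x by blast
    then have "x \<in> regular_frontier (\<omega>\<^sub>m D Solid i)"
      using x(1) outer_unit_normal_unique unfolding regular_frontier_def by blast
    then have "x \<in> regular_frontier (\<omega>\<^sub>m D Gas i)" using interface_matching[OF i] x(2) by blast
    then obtain m where m: "outer_unit_normal (\<omega>\<^sub>m D Gas i) x m"
      unfolding regular_frontier_def by blast
    have "x \<in> interior (closure (\<omega>\<^sub>m D Solid i \<union> \<omega>\<^sub>m D Gas i))"
      using n m by (rule opposite_normals_interior) (use \<Omega>\<^sub>m_disjoint in \<open>auto simp: \<omega>\<^sub>m_def\<close>)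
    also have "\<dots> \<subseteq> interior (closure (\<omega> D i))"
      by (intro interior_mono closure_mono) (auto simp: \<omega>\<^sub>m_def)
    also have "\<dots> = \<omega> D i" by (rule polyhedral_open_interior_closure[OF \<omega>_polyhedral[OF i]])
    finally show ?thesis .
  qed
  \<comment> \<open>This inclusion holds everywhere: inside the open cell the solid part coincides
    with the solid region, and the interface belongs to the frontier of that region.\<close>
  moreover have "x \<in> frontier (\<omega>\<^sub>m D Solid i)" if x: "x \<in> \<omega> D i" "x \<in> \<Sigma> D" for x
  proof -
    have "x \<in> frontier (\<Omega>\<^sub>m D Solid)" using x(2) frontier_solid by (auto simp: \<Sigma>_def)
    moreover have "\<omega>\<^sub>m D Solid i \<inter> \<omega> D i = \<Omega>\<^sub>m D Solid \<inter> \<omega> D i" by (auto simp: \<omega>\<^sub>m_def)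
    ultimately show ?thesis using frontier_Int_local[OF open_cell[OF i] x(1)] by blast
  qed
  ultimately show ?thesis by (intro that[OF N(1)]) blast
qed

text \<open>Up to a null set, the part of the interface on the frontier of a solid cell part lies
  inside the open cell. What the element shares with a second cell would lie, almost everywhere, in
  two disjoint cells.\<close>

lemma cell\<^sub>\<Sigma>_eq:
  assumes i: "i \<in> cells D" and \<alpha>: "\<alpha> \<in> J\<^sub>\<Sigma> D i"
  shows "cell\<^sub>\<Sigma> D \<alpha> = i"
proof (rule ccontr)
  define j where "j = cell\<^sub>\<Sigma> D \<alpha>"
  assume "cell\<^sub>\<Sigma> D \<alpha> \<noteq> i"
  then have "j \<noteq> i" by (simp add: j_def)
  have \<alpha>': "\<alpha> \<in> I\<^sub>\<Sigma> D" "area (\<zeta> D \<alpha> \<inter> frontier (\<omega>\<^sub>m D Solid i)) \<noteq> 0" using \<alpha> by (auto simp: J\<^sub>\<Sigma>_def)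
  have j: "j \<in> cells D" "\<zeta> D \<alpha> \<subseteq> frontier (\<omega>\<^sub>m D Solid j) \<inter> \<Sigma> D"
    using cell\<^sub>\<Sigma>_props[OF \<alpha>'(1)] by (simp_all add: j_def)
  obtain N1 where N1: "N1 \<in> null_sets surface_measure"
    "frontier (\<omega>\<^sub>m D Solid i) \<inter> \<Sigma> D - N1 = \<omega> D i \<inter> \<Sigma> D - N1"
    by (rule frontier_solid_cell_interface[OF i])
  obtain N2 where N2: "N2 \<in> null_sets surface_measure"
    "frontier (\<omega>\<^sub>m D Solid j) \<inter> \<Sigma> D - N2 = \<omega> D j \<inter> \<Sigma> D - N2"
    by (rule frontier_solid_cell_interface[OF j(1)])
  have "\<zeta> D \<alpha> \<inter> frontier (\<omega>\<^sub>m D Solid i) \<subseteq> N1 \<union> N2"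
    using j(2) N1(2) N2(2) cells_disjoint[OF i j(1)] \<open>j \<noteq> i\<close> by blast
  then have "area (\<zeta> D \<alpha> \<inter> frontier (\<omega>\<^sub>m D Solid i)) = 0"
    using N1(1) N2(1) \<zeta>_borel \<alpha>'(1) by (intro area_eq_0_null[of _ "N1 \<union> N2"]) auto
  then show False using \<alpha>'(2) by simp
qed

text \<open>\<open>J\<^sub>\<Sigma> D i\<close> is defined through the frontier of the solid part,
  whereas the scheme weights emission by the interface inside the open cell; interface matching
  makes the two agree up to a null set.\<close>

lemma sum_area_J\<^sub>\<Sigma>:
  assumes i: "i \<in> cells D"
  shows "(\<Sum>\<alpha>\<in>J\<^sub>\<Sigma> D i. area (\<zeta> D \<alpha>)) = area (\<omega> D i \<inter> \<Sigma> D)"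
proof -
  have part: "disjoint_family_on (\<zeta> D) (I\<^sub>\<Sigma> D)" "\<And>\<alpha>. \<alpha> \<in> I\<^sub>\<Sigma> D \<Longrightarrow> \<zeta> D \<alpha> \<subseteq> \<Sigma> D"
      "\<Sigma> D \<subseteq> (\<Union>\<alpha>\<in>I\<^sub>\<Sigma> D. closure (\<zeta> D \<alpha>))"
    using \<zeta>\<^sub>\<Sigma>_partition by (auto simp: partition_up_to_boundary_def)
  obtain N where N: "N \<in> null_sets surface_measure"
    "frontier (\<omega>\<^sub>m D Solid i) \<inter> \<Sigma> D - N = \<omega> D i \<inter> \<Sigma> D - N"
    by (rule frontier_solid_cell_interface[OF i])
  show ?thesis unfolding J\<^sub>\<Sigma>_def
  proof (rule area_eq_sum_elements[OF _ _ _ _ _ _ N(1)])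
    show "\<omega> D i \<inter> \<Sigma> D \<in> sets borel" using open_cell[OF i] by (auto simp: \<Sigma>_def)
    show "\<zeta> D \<alpha> \<subseteq> frontier (\<omega>\<^sub>m D Solid i)"
      if "\<alpha> \<in> I\<^sub>\<Sigma> D" "area (\<zeta> D \<alpha> \<inter> frontier (\<omega>\<^sub>m D Solid i)) \<noteq> 0" for \<alpha>
      using cell\<^sub>\<Sigma>_props(2)[OF that(1)] cell\<^sub>\<Sigma>_eq[OF i, of \<alpha>] that by (auto simp: J\<^sub>\<Sigma>_def)
    show "\<omega> D i \<inter> \<Sigma> D \<inter> \<zeta> D \<alpha> - N = \<zeta> D \<alpha> \<inter> frontier (\<omega>\<^sub>m D Solid i) - N" if "\<alpha> \<in> I\<^sub>\<Sigma> D" for \<alpha>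
      using part(2)[OF that] N(2) by blast
  qed (use part finite_elements \<zeta>_polyhedral in auto)
qed

lemma volume_cell_pos: "i \<in> cells D \<Longrightarrow> volume (\<omega> D i) > 0"
proof -
  assume i: "i \<in> cells D"
  have "\<omega> D i \<notin> null_sets lborel"
    using open_not_negligible[OF open_cell[OF i] \<omega>_nonempty[OF i]] open_cell[OF i]
    by (auto simp: negligible_iff_null_sets null_sets_def)
  then have "emeasure lborel (\<omega> D i) \<noteq> 0" using open_cell[OF i] by (auto simp: null_sets_def)
  moreover have "emeasure lborel (\<omega> D i) < \<infinity>"
    using polyhedral_open_in_bounded[OF \<omega>_polyhedral[OF i]] by (rule emeasure_bounded_finite)
  ultimately show ?thesis by (simp add: measure_def enn2real_positive_iff zero_less_iff_neq_zero)
qed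

text \<open>The phase boundaries lie in finitely many planes and have volume zero. Energy growth in
  the two phases therefore adds up to the full cell volume, the denominator in the geometric
  constants.\<close>

lemma volume_cell:
  assumes i: "i \<in> cells D"
  shows "(\<Sum>p\<in>{Solid, Gas}. volume (\<omega>\<^sub>m D p i)) = volume (\<omega> D i)"
proof -
  have "negligible (frontier (\<Omega>\<^sub>m D Solid) \<union> frontier (\<Omega>\<^sub>m D Gas))"
    using negligible_polyhedral_frontier \<Omega>\<^sub>m_polyhedral by (intro negligible_Un) auto
  then have null: "frontier (\<Omega>\<^sub>m D Solid) \<union> frontier (\<Omega>\<^sub>m D Gas) \<in> null_sets lborel"
    by (auto simp: negligible_iff_null_sets null_sets_def)
  have op: "open (\<omega>\<^sub>m D p i)" for p by (rule open_\<omega>\<^sub>m[OF i])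
  have fin: "emeasure lborel (\<omega>\<^sub>m D p i) \<noteq> \<infinity>" for p
    using emeasure_bounded_finite[OF polyhedral_open_in_bounded[OF polyhedral_\<omega>\<^sub>m[OF i]]] by (metis less_irrefl)
  have "\<omega> D i \<subseteq> closure (\<Omega>\<^sub>m D Solid) \<union> closure (\<Omega>\<^sub>m D Gas)"
    using cell_subset[OF i] closure_\<Omega> closure_subset by blast
  then have "x \<in> \<omega> D i \<longleftrightarrow> x \<in> \<omega>\<^sub>m D Solid i \<union> \<omega>\<^sub>m D Gas i"
    if "x \<notin> frontier (\<Omega>\<^sub>m D Solid) \<union> frontier (\<Omega>\<^sub>m D Gas)" for x
    using that unfolding closure_Un_frontier \<omega>\<^sub>m_def by blast
  then have "AE x in lborel. x \<in> \<omega> D i \<longleftrightarrow> x \<in> \<omega>\<^sub>m D Solid i \<union> \<omega>\<^sub>m D Gas i"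
    using AE_not_in[OF null] by (rule eventually_mono[rotated])
  then have "volume (\<omega> D i) = volume (\<omega>\<^sub>m D Solid i \<union> \<omega>\<^sub>m D Gas i)"
    using op open_cell[OF i] by (intro measure_eq_AE) auto
  also have "\<dots> = volume (\<omega>\<^sub>m D Solid i) + volume (\<omega>\<^sub>m D Gas i)"
    using op fin \<Omega>\<^sub>m_disjoint by (intro measure_Union) (auto simp: \<omega>\<^sub>m_def)
  finally show ?thesis by simp
qed

end

section \<open>Implicit systems and enclosures\<close>

text \<open>Banach iteration for the sup distance over the coordinates in \<open>A\<close>. The
  contraction hypothesis quantifies over common bounds \<delta> instead of a norm, since values
  outside \<open>A\<close> are uncontrolled; the iterates converge coordinatewise by comparison with
  a geometric series.\<close>

lemma finite_sup_contraction:
  fixes T :: "('i \<Rightarrow> real) \<Rightarrow> 'i \<Rightarrow> real"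
  assumes A: "finite A" and S: "closed S" and q: "0 \<le> q" "q < 1"
    and w: "w \<in> A \<rightarrow> S" and T: "\<And>v. v \<in> A \<rightarrow> S \<Longrightarrow> T v \<in> A \<rightarrow> S"
    and contr: "\<And>v w \<delta> i. v \<in> A \<rightarrow> S \<Longrightarrow> w \<in> A \<rightarrow> S \<Longrightarrow> (\<And>j. j \<in> A \<Longrightarrow> \<bar>v j - w j\<bar> \<le> \<delta>) \<Longrightarrow> i \<in> A \<Longrightarrow>
      \<bar>T v i - T w i\<bar> \<le> q * \<delta>"
  obtains v where "v \<in> A \<rightarrow> S" "\<And>i. i \<in> A \<Longrightarrow> T v i = v i"
proof -
  define x where "x n = (T ^^ n) w" for n
  \<comment> \<open>The sum of the first displacements bounds each of them and is defined for empty
    \<open>A\<close> as well.\<close>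
  define \<delta> where "\<delta> = (\<Sum>j\<in>A. \<bar>T w j - w j\<bar>)"
  have xS: "x n \<in> A \<rightarrow> S" for n by (induction n) (simp_all add: x_def w T)
  have step: "\<bar>x (Suc n) j - x n j\<bar> \<le> q ^ n * \<delta>" if "j \<in> A" for n j
    using that
  proof (induction n arbitrary: j)
    case 0
    then show ?case using A member_le_sum[of j A "\<lambda>j. \<bar>T w j - w j\<bar>"] by (simp add: x_def \<delta>_def)
  next
    case (Suc n)
    have "\<bar>T (x (Suc n)) j - T (x n) j\<bar> \<le> q * (q ^ n * \<delta>)"
      by (rule contr[OF xS xS Suc.IH Suc.prems])
    then show ?case by (simp add: x_def mult.assoc)
  qed
  have "convergent (\<lambda>n. x n j)" if j: "j \<in> A" for j
  proof -
    have "summable (\<lambda>n. q ^ n * \<delta>)" using q by (intro summable_mult2 summable_geometric) simp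
    then have "summable (\<lambda>n. x (Suc n) j - x n j)"
      by (rule summable_comparison_test') (use step[OF j] in simp)
    then have "convergent (\<lambda>n. x n j - x 0 j)"
      by (simp add: summable_iff_convergent sum_lessThan_telescope[of "\<lambda>n. x n j"])
    then show ?thesis by (simp add: convergent_diff_const_right_iff)
  qed
  then obtain v where v: "\<And>j. j \<in> A \<Longrightarrow> (\<lambda>n. x n j) \<longlonglongrightarrow> v j"
    unfolding convergent_def by metis
  have vS: "v \<in> A \<rightarrow> S"
  proof
    fix j assume j: "j \<in> A"
    have "x n j \<in> S" for n using xS j by blast
    then show "v j \<in> S" by (rule closed_sequentially[OF S _ v[OF j]])
  qed
  moreover have "T v i = v i" if i: "i \<in> A" for i
  proof -
    define d where "d n = (\<Sum>j\<in>A. \<bar>x n j - v j\<bar>)" for n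
    have "d \<longlonglongrightarrow> (\<Sum>j\<in>A. \<bar>v j - v j\<bar>)" unfolding d_def by (intro tendsto_intros v)
    then have d0: "(\<lambda>n. q * d n) \<longlonglongrightarrow> 0" using tendsto_mult_left[of d 0 _ q] by simp
    have "\<bar>T (x n) i - T v i\<bar> \<le> q * d n" for n
      using A by (intro contr[OF xS vS _ i]) (auto simp: d_def intro: member_le_sum)
    then have "(\<lambda>n. T (x n) i - T v i) \<longlonglongrightarrow> 0"
      by (intro Lim_null_comparison[OF always_eventually d0]) simp
    then have "(\<lambda>n. T (x n) i) \<longlonglongrightarrow> T v i" by (rule LIM_zero_cancel)
    moreover have "(\<lambda>n. T (x n) i) \<longlonglongrightarrow> v i"
      using LIMSEQ_Suc[OF v[OF i]] by (simp add: x_def)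
    ultimately show ?thesis by (rule LIMSEQ_unique)
  qed
  ultimately show ?thesis by (rule that)
qed

lemma obtain_maximum:
  fixes f :: "'i \<Rightarrow> real"
  assumes "finite A" "A \<noteq> {}"
  obtains i where "i \<in> A" "\<And>j. j \<in> A \<Longrightarrow> f j \<le> f i"
proof -
  have "Max (f ` A) \<in> f ` A" using assms by (intro Max_in) auto
  then obtain i where "i \<in> A" "f i = Max (f ` A)" by auto
  then show ?thesis using assms by (intro that[of i]) auto
qed

text \<open>For fixed \<open>v\<close> the sign conditions give a zero in \<open>s\<close>. Its
  response to a change of \<open>v\<close> is governed by Lipschitz constant over slope, (d + q)/(d
  + p) < 1, so the common part \<open>d\<close> may be large: only q < p decides.\<close>

lemma implicit_system_solution:
  fixes F :: "'i \<Rightarrow> real \<Rightarrow> ('i \<Rightarrow> real) \<Rightarrow> real"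
  assumes I: "finite I" and lr: "l \<le> r"
    and lower: "\<And>i v. i \<in> I \<Longrightarrow> v \<in> I \<rightarrow> {l..r} \<Longrightarrow> F i l v \<le> 0"
    and upper: "\<And>i v. i \<in> I \<Longrightarrow> v \<in> I \<rightarrow> {l..r} \<Longrightarrow> 0 \<le> F i r v"
    and cont: "\<And>i v. i \<in> I \<Longrightarrow> v \<in> I \<rightarrow> {l..r} \<Longrightarrow> continuous_on {l..r} (\<lambda>s. F i s v)"
    and slope: "\<And>i v s t. i \<in> I \<Longrightarrow> v \<in> I \<rightarrow> {l..r} \<Longrightarrow> l \<le> s \<Longrightarrow> s \<le> t \<Longrightarrow> t \<le> r \<Longrightarrow>
      (d i + p i) * (t - s) \<le> F i t v - F i s v"
    and lip: "\<And>i v w s \<delta>. i \<in> I \<Longrightarrow> v \<in> I \<rightarrow> {l..r} \<Longrightarrow> w \<in> I \<rightarrow> {l..r} \<Longrightarrow> s \<in> {l..r} \<Longrightarrow>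
      (\<And>j. j \<in> I \<Longrightarrow> \<bar>v j - w j\<bar> \<le> \<delta>) \<Longrightarrow> \<bar>F i s v - F i s w\<bar> \<le> (d i + q i) * \<delta>"
    and dpq: "\<And>i. i \<in> I \<Longrightarrow> 0 \<le> d i \<and> 0 \<le> q i \<and> q i < p i"
  obtains u where "u \<in> I \<rightarrow> {l..r}" "\<And>i. i \<in> I \<Longrightarrow> F i (u i) u = 0"
    "\<forall>v\<in>I \<rightarrow> {l..r}. (\<forall>i\<in>I. F i (v i) v = 0) \<longrightarrow> (\<forall>i\<in>I. v i = u i)"
proof -
  have "\<exists>s. s \<in> {l..r} \<and> F i s v = 0" if "i \<in> I" "v \<in> I \<rightarrow> {l..r}" for i v
    using IVT'[of "\<lambda>s. F i s v" l 0 r, OF lower[OF that] upper[OF that] lr cont[OF that]] by auto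
  then have "\<forall>v i. \<exists>s. i \<in> I \<and> v \<in> I \<rightarrow> {l..r} \<longrightarrow> s \<in> {l..r} \<and> F i s v = 0" by blast
  then obtain T where T: "\<And>i v. i \<in> I \<Longrightarrow> v \<in> I \<rightarrow> {l..r} \<Longrightarrow> T v i \<in> {l..r} \<and> F i (T v i) v = 0"
    unfolding choice_iff by blast
  \<comment> \<open>Inserting 0 covers empty \<open>I\<close> and gives c \<ge> 0 at once.\<close>
  define c where "c = Max (insert 0 ((\<lambda>i. (d i + q i) / (d i + p i)) ` I))"
  have ratio: "(d i + q i) / (d i + p i) < 1" if "i \<in> I" for i
    using dpq[OF that] by (simp add: divide_less_eq)
  have c: "0 \<le> c" and c1: "c < 1" and ci: "\<And>i. i \<in> I \<Longrightarrow> (d i + q i) / (d i + p i) \<le> c"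
    unfolding c_def using I ratio by (simp_all add: Max_less_iff)
  \<comment> \<open>The slope bound in the frozen variable turns a perturbation of the others into a
     perturbation of the zero.\<close>
  have key: "\<bar>s - t\<bar> \<le> c * \<delta>"
    if i: "i \<in> I" and v: "v \<in> I \<rightarrow> {l..r}" and w: "w \<in> I \<rightarrow> {l..r}"
      and s: "s \<in> {l..r}" "F i s v = 0" and t: "t \<in> {l..r}" "F i t w = 0"
      and \<delta>: "\<And>j. j \<in> I \<Longrightarrow> \<bar>v j - w j\<bar> \<le> \<delta>" for i v w s t \<delta>
  proof -
    have pos: "d i + p i > 0" using dpq[OF i] by linarith
    have \<delta>0: "\<delta> \<ge> 0" using \<delta>[OF i] by linarith
    have "(d i + p i) * \<bar>s - t\<bar> \<le> (d i + q i) * \<delta>"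
    proof (cases "s \<le> t")
      case True
      then have "(d i + p i) * (t - s) \<le> F i t v - F i s v" using s t by (intro slope[OF i v]) auto
      \<comment> \<open>Both F i s v and F i t w vanish, so the increment from s to t equals a
        difference between \<open>v\<close> and \<open>w\<close> at the same t.\<close>
      also have "\<dots> \<le> \<bar>F i t v - F i t w\<bar>" using s t by simp
      also have "\<dots> \<le> (d i + q i) * \<delta>" by (rule lip[OF i v w t(1) \<delta>])
      finally show ?thesis using True by simp
    next
      case False
      then have "(d i + p i) * (s - t) \<le> F i s v - F i t v" using s t by (intro slope[OF i v]) auto
      also have "\<dots> \<le> \<bar>F i t v - F i t w\<bar>" using s t by simp
      also have "\<dots> \<le> (d i + q i) * \<delta>" by (rule lip[OF i v w t(1) \<delta>])
      finally show ?thesis using False by simp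
    qed
    then have "\<bar>s - t\<bar> \<le> (d i + q i) / (d i + p i) * \<delta>" using pos by (simp add: field_simps)
    also have "\<dots> \<le> c * \<delta>" by (rule mult_right_mono[OF ci[OF i] \<delta>0])
    finally show ?thesis .
  qed
  obtain u where u: "u \<in> I \<rightarrow> {l..r}" "\<And>i. i \<in> I \<Longrightarrow> T u i = u i"
  proof (rule finite_sup_contraction[where A = I and S = "{l..r}" and T = T and q = c and w = "\<lambda>_. l"])
    show "\<bar>T v i - T w i\<bar> \<le> c * \<delta>" if "v \<in> I \<rightarrow> {l..r}" "w \<in> I \<rightarrow> {l..r}"
      "\<And>j. j \<in> I \<Longrightarrow> \<bar>v j - w j\<bar> \<le> \<delta>" "i \<in> I" for v w \<delta> i
      using key[OF that(4,1,2) _ _ _ _ that(3)] T that by blast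
  qed (use I c c1 lr T in auto)
  have zero: "F i (u i) u = 0" if "i \<in> I" for i using T[OF that u(1)] u(2)[OF that] by simp
  moreover have "v i = u i" if v: "v \<in> I \<rightarrow> {l..r}" "\<And>i. i \<in> I \<Longrightarrow> F i (v i) v = 0" and i: "i \<in> I" for v i
  proof -
    \<comment> \<open>Two solutions are compared at the index of largest deviation; with that
      deviation as \<delta>, \<open>key\<close> bounds it by \<open>c\<close> times itself.\<close>
    obtain k where k: "k \<in> I" "\<And>j. j \<in> I \<Longrightarrow> \<bar>v j - u j\<bar> \<le> \<bar>v k - u k\<bar>"
      using obtain_maximum[of I "\<lambda>j. \<bar>v j - u j\<bar>"] I i by blast
    have "\<bar>v k - u k\<bar> \<le> c * \<bar>v k - u k\<bar>"
      using k(1) v(1) u(1) by (intro key[OF k(1) v(1) u(1) _ v(2)[OF k(1)] _ zero[OF k(1)] k(2)]) auto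
    then have "(1 - c) * \<bar>v k - u k\<bar> \<le> 0" by (simp add: algebra_simps)
    then have "\<bar>v k - u k\<bar> = 0" using c1 by (simp add: mult_le_0_iff)
    then show ?thesis using k(2)[OF i] by simp
  qed
  ultimately show ?thesis by (intro that[OF u(1)]) blast+
qed

text \<open>The definite description is meaningful once a two-sided inverse exists and is unique.
  Solvability supplies a right inverse column by column; injectivity makes it a left inverse and
  determines the entries on \<open>A\<close>, and zero padding fixes all others.\<close>

lemma inverse_matrix_on_right:
  fixes G :: "'a \<Rightarrow> 'a \<Rightarrow> real"
  assumes A: "finite A"
    and surj: "\<And>b. \<exists>x. \<forall>\<alpha>\<in>A. (\<Sum>\<gamma>\<in>A. G \<alpha> \<gamma> * x \<gamma>) = b \<alpha>"
    and inj: "\<And>x \<alpha>. (\<And>\<alpha>. \<alpha> \<in> A \<Longrightarrow> (\<Sum>\<gamma>\<in>A. G \<alpha> \<gamma> * x \<gamma>) = 0) \<Longrightarrow> \<alpha> \<in> A \<Longrightarrow> x \<alpha> = 0"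
    and \<alpha>\<beta>: "\<alpha> \<in> A" "\<beta> \<in> A"
  shows "(\<Sum>\<gamma>\<in>A. G \<alpha> \<gamma> * inverse_matrix_on A G \<gamma> \<beta>) = of_bool (\<alpha> = \<beta>)"
proof -
  let ?inv = "\<lambda>H. (\<forall>\<alpha>\<in>A. \<forall>\<beta>\<in>A. (\<Sum>\<gamma>\<in>A. G \<alpha> \<gamma> * H \<gamma> \<beta>) = of_bool (\<alpha> = \<beta>)) \<and>
     (\<forall>\<alpha>\<in>A. \<forall>\<beta>\<in>A. (\<Sum>\<gamma>\<in>A. H \<alpha> \<gamma> * G \<gamma> \<beta>) = of_bool (\<alpha> = \<beta>)) \<and>
     (\<forall>\<alpha> \<beta>. \<alpha> \<notin> A \<or> \<beta> \<notin> A \<longrightarrow> H \<alpha> \<beta> = 0)"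
  have "\<forall>\<beta>. \<exists>x. \<forall>\<alpha>\<in>A. (\<Sum>\<gamma>\<in>A. G \<alpha> \<gamma> * x \<gamma>) = of_bool (\<alpha> = \<beta>)"
    by (intro allI surj)
  then obtain X where X: "\<And>\<alpha> \<beta>. \<alpha> \<in> A \<Longrightarrow> (\<Sum>\<gamma>\<in>A. G \<alpha> \<gamma> * X \<beta> \<gamma>) = of_bool (\<alpha> = \<beta>)" by metis
  define H where "H \<gamma> \<beta> = (if \<gamma> \<in> A \<and> \<beta> \<in> A then X \<beta> \<gamma> else 0)" for \<gamma> \<beta>
  have right: "(\<Sum>\<gamma>\<in>A. G \<alpha> \<gamma> * H \<gamma> \<beta>) = of_bool (\<alpha> = \<beta>)" if "\<alpha> \<in> A" "\<beta> \<in> A" for \<alpha> \<beta>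
    using X[OF that(1), of \<beta>] that by (simp add: H_def)
  have left: "(\<Sum>\<gamma>\<in>A. H \<alpha> \<gamma> * G \<gamma> \<beta>) = of_bool (\<alpha> = \<beta>)" if "\<alpha> \<in> A" "\<beta> \<in> A" for \<alpha> \<beta>
  proof -
    \<comment> \<open>Column \<beta> of H G - 1; it is annihilated by G because G H G = G.\<close>
    define y where "y \<gamma> = (\<Sum>\<eta>\<in>A. H \<gamma> \<eta> * G \<eta> \<beta>) - of_bool (\<gamma> = \<beta>)" for \<gamma>
    have "(\<Sum>\<gamma>\<in>A. G \<alpha> \<gamma> * y \<gamma>) = 0" if "\<alpha> \<in> A" for \<alpha>
    proof -
      have "(\<Sum>\<gamma>\<in>A. G \<alpha> \<gamma> * y \<gamma>) = (\<Sum>\<gamma>\<in>A. \<Sum>\<eta>\<in>A. G \<alpha> \<gamma> * (H \<gamma> \<eta> * G \<eta> \<beta>)) - (\<Sum>\<gamma>\<in>A. G \<alpha> \<gamma> * of_bool (\<gamma> = \<beta>))"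
        by (simp add: y_def right_diff_distrib sum_subtractf sum_distrib_left)
      also have "(\<Sum>\<gamma>\<in>A. \<Sum>\<eta>\<in>A. G \<alpha> \<gamma> * (H \<gamma> \<eta> * G \<eta> \<beta>)) = (\<Sum>\<eta>\<in>A. (\<Sum>\<gamma>\<in>A. G \<alpha> \<gamma> * H \<gamma> \<eta>) * G \<eta> \<beta>)"
        by (subst sum.swap) (simp add: sum_distrib_right mult.assoc)
      also have "\<dots> = (\<Sum>\<eta>\<in>A. of_bool (\<alpha> = \<eta>) * G \<eta> \<beta>)"
        using right that by (intro sum.cong) auto
      also have "\<dots> = G \<alpha> \<beta>" using A that by (simp add: of_bool_def if_distrib[of "\<lambda>x. x * _"] cong: if_cong)
      also have "(\<Sum>\<gamma>\<in>A. G \<alpha> \<gamma> * of_bool (\<gamma> = \<beta>)) = G \<alpha> \<beta>"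
        using A \<open>\<beta> \<in> A\<close> by (simp add: of_bool_def if_distrib[of "\<lambda>x. _ * x"] cong: if_cong)
      finally show ?thesis by simp
    qed
    then have "y \<alpha> = 0" using inj that(1) by blast
    then show ?thesis by (simp add: y_def)
  qed
  have "?inv H" using right left by (auto simp: H_def)
  moreover have "H' = H" if H': "?inv H'" for H'
  proof (intro ext)
    fix \<alpha> \<beta>
    show "H' \<alpha> \<beta> = H \<alpha> \<beta>"
    proof (cases "\<alpha> \<in> A \<and> \<beta> \<in> A")
      case True
      have "(\<Sum>\<gamma>\<in>A. G \<alpha> \<gamma> * (H' \<gamma> \<beta> - H \<gamma> \<beta>)) = 0" if "\<alpha> \<in> A" for \<alpha>
        using right[OF that] H' that True by (simp add: right_diff_distrib sum_subtractf)
      then have "H' \<alpha> \<beta> - H \<alpha> \<beta> = 0" using True by (intro inj[of "\<lambda>\<alpha>. H' \<alpha> \<beta> - H \<alpha> \<beta>"]) auto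
      then show ?thesis by simp
    next
      case False
      then show ?thesis using H' by (auto simp: H_def)
    qed
  qed
  ultimately have "?inv (inverse_matrix_on A G)"
    unfolding inverse_matrix_on_def by (rule theI)
  then show ?thesis using \<alpha>\<beta> by blast
qed

text \<open>Each of the four monomials in the cofactor of s - t is at most r^3; this is the origin
  of 4 r^3 in the Lipschitz constant of the irradiation.\<close>

lemma power4_diff_le:
  fixes s t r :: real
  assumes "0 \<le> s" "s \<le> r" "0 \<le> t" "t \<le> r" "\<bar>s - t\<bar> \<le> \<delta>"
  shows "s ^ 4 - t ^ 4 \<le> 4 * r ^ 3 * \<delta>"
proof -
  have "s ^ 4 - t ^ 4 = (s - t) * (s ^ 3 + s ^ 2 * t + s * t ^ 2 + t ^ 3)"
    by (simp add: algebra_simps power4_eq_xxxx power3_eq_cube power2_eq_square)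
  also have "\<dots> \<le> \<delta> * (4 * r ^ 3)"
  proof (rule mult_mono)
    have "s ^ 3 \<le> r ^ 3" "t ^ 3 \<le> r ^ 3" "s ^ 2 * t \<le> r ^ 2 * r" "s * t ^ 2 \<le> r * r ^ 2"
      using assms by (auto intro!: power_mono mult_mono)
    then show "s ^ 3 + s ^ 2 * t + s * t ^ 2 + t ^ 3 \<le> 4 * r ^ 3"
      by (simp add: power3_eq_cube power2_eq_square)
  qed (use assms in auto)
  finally show ?thesis by (simp add: algebra_simps)
qed

section \<open>Radiation in an enclosure\<close>

text \<open>\<open>K\<close> and \<open>k\<close> are the view factors between the elements and towards the exterior at
  temperature \<open>\<theta>\<close>; \<open>W\<close> below is the irradiation, and the emissivity times \<open>W\<close> gives the paper's
  \<open>V\<close>.\<close>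

locale enclosure =
  fixes A :: "'a set" and a :: "'a \<Rightarrow> real" and K :: "'a \<Rightarrow> 'a \<Rightarrow> real" and k :: "'a \<Rightarrow> real"
    and e :: "real \<Rightarrow> real" and \<sigma> \<theta> :: real
  assumes finite_A: "finite A" and a_pos: "\<And>\<alpha>. \<alpha> \<in> A \<Longrightarrow> a \<alpha> > 0"
    and K_nonneg: "\<And>\<alpha> \<beta>. \<alpha> \<in> A \<Longrightarrow> \<beta> \<in> A \<Longrightarrow> K \<alpha> \<beta> \<ge> 0" and k_nonneg: "\<And>\<alpha>. \<alpha> \<in> A \<Longrightarrow> k \<alpha> \<ge> 0"
    and row_sum: "\<And>\<alpha>. \<alpha> \<in> A \<Longrightarrow> (\<Sum>\<beta>\<in>A. K \<alpha> \<beta>) + k \<alpha> = a \<alpha>"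
    and e_range: "\<And>s. s \<ge> 0 \<Longrightarrow> 0 < e s \<and> e s \<le> 1"
    and \<sigma>_pos: "\<sigma> > 0" and \<theta>_pos: "\<theta> > 0"
begin

definition G :: "('a \<Rightarrow> real) \<Rightarrow> 'a \<Rightarrow> 'a \<Rightarrow> real" where
  "G u \<alpha> \<beta> = of_bool (\<alpha> = \<beta>) * a \<alpha> - (1 - e (u \<alpha>)) * K \<alpha> \<beta>"

definition E :: "('a \<Rightarrow> real) \<Rightarrow> 'a \<Rightarrow> real" where
  "E u \<alpha> = \<sigma> * e (u \<alpha>) * u \<alpha> ^ 4 * a \<alpha> + \<sigma> * (1 - e (u \<alpha>)) * \<theta> ^ 4 * k \<alpha>"

definition R :: "('a \<Rightarrow> real) \<Rightarrow> 'a \<Rightarrow> real" where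
  "R u \<alpha> = (\<Sum>\<beta>\<in>A. inverse_matrix_on A (G u) \<alpha> \<beta> * E u \<beta>)"

definition W :: "('a \<Rightarrow> real) \<Rightarrow> 'a \<Rightarrow> real" where
  "W u \<alpha> = (\<Sum>\<beta>\<in>A. R u \<beta> * K \<alpha> \<beta>) + \<sigma> * \<theta> ^ 4 * k \<alpha>"

text \<open>Divided by \<open>a \<alpha>\<close>, the left side is by \<open>row_sum\<close> a
  weighted average of the values of \<open>x\<close> and of \<open>t\<close>, the exterior acting as
  one further element.\<close>

lemma irradiation_le:
  assumes "\<alpha> \<in> A" "\<And>\<beta>. \<beta> \<in> A \<Longrightarrow> x \<beta> \<le> B" "t \<le> B"
  shows "(\<Sum>\<beta>\<in>A. x \<beta> * K \<alpha> \<beta>) + t * k \<alpha> \<le> B * a \<alpha>"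
proof -
  have "(\<Sum>\<beta>\<in>A. x \<beta> * K \<alpha> \<beta>) \<le> (\<Sum>\<beta>\<in>A. B * K \<alpha> \<beta>)"
    using assms K_nonneg by (intro sum_mono mult_right_mono) auto
  moreover have "t * k \<alpha> \<le> B * k \<alpha>" using assms k_nonneg by (intro mult_right_mono) auto
  moreover have "B * a \<alpha> = (\<Sum>\<beta>\<in>A. B * K \<alpha> \<beta>) + B * k \<alpha>"
    using row_sum[OF assms(1)] by (metis distrib_left sum_distrib_left)
  ultimately show ?thesis by linarith
qed

text \<open>Where \<open>x\<close> is maximal and exceeds \<open>B\<close>, the averaged term is at
  most x a, so the equation leaves \<epsilon> x \<le> \<epsilon> c, and \<epsilon> > 0 gives x \<le>
  c. General data \<open>c\<close> and \<open>t\<close> let one statement serve injectivity, upper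
  and lower bounds, and differences of two solutions.\<close>

lemma maximum_principle:
  fixes c \<epsilon> x :: "'a \<Rightarrow> real"
  assumes \<epsilon>: "\<And>\<alpha>. \<alpha> \<in> A \<Longrightarrow> 0 < \<epsilon> \<alpha> \<and> \<epsilon> \<alpha> \<le> 1"
    and eq: "\<And>\<alpha>. \<alpha> \<in> A \<Longrightarrow> x \<alpha> * a \<alpha> = \<epsilon> \<alpha> * c \<alpha> * a \<alpha> + (1 - \<epsilon> \<alpha>) * ((\<Sum>\<beta>\<in>A. x \<beta> * K \<alpha> \<beta>) + t * k \<alpha>)"
    and c: "\<And>\<alpha>. \<alpha> \<in> A \<Longrightarrow> c \<alpha> \<le> B" and t: "t \<le> B" and \<beta>: "\<beta> \<in> A"
  shows "x \<beta> \<le> B"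
proof -
  obtain \<alpha> where \<alpha>: "\<alpha> \<in> A" "\<And>\<beta>. \<beta> \<in> A \<Longrightarrow> x \<beta> \<le> x \<alpha>"
    using obtain_maximum[of A x] finite_A \<beta> by blast
  have "x \<alpha> \<le> B"
  proof (rule ccontr)
    assume "\<not> x \<alpha> \<le> B"
    then have B: "B < x \<alpha>" by simp
    have "(\<Sum>\<beta>\<in>A. x \<beta> * K \<alpha> \<beta>) + t * k \<alpha> \<le> x \<alpha> * a \<alpha>"
      using \<alpha> t B by (intro irradiation_le) auto
    then have "(1 - \<epsilon> \<alpha>) * ((\<Sum>\<beta>\<in>A. x \<beta> * K \<alpha> \<beta>) + t * k \<alpha>) \<le> (1 - \<epsilon> \<alpha>) * (x \<alpha> * a \<alpha>)"
      using \<epsilon>[OF \<alpha>(1)] by (intro mult_left_mono) auto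
    then have "\<epsilon> \<alpha> * a \<alpha> * x \<alpha> \<le> \<epsilon> \<alpha> * a \<alpha> * c \<alpha>" using eq[OF \<alpha>(1)] by (simp add: algebra_simps)
    then have "x \<alpha> \<le> c \<alpha>" using \<epsilon>[OF \<alpha>(1)] a_pos[OF \<alpha>(1)] by simp
    then show False using c[OF \<alpha>(1)] B by linarith
  qed
  then show ?thesis using \<alpha>(2)[OF \<beta>] by linarith
qed

lemma G_mult:
  assumes "\<alpha> \<in> A"
  shows "(\<Sum>\<gamma>\<in>A. G u \<alpha> \<gamma> * x \<gamma>) = x \<alpha> * a \<alpha> - (1 - e (u \<alpha>)) * (\<Sum>\<gamma>\<in>A. x \<gamma> * K \<alpha> \<gamma>)"
proof -
  have "(\<Sum>\<gamma>\<in>A. G u \<alpha> \<gamma> * x \<gamma>)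
      = (\<Sum>\<gamma>\<in>A. (if \<alpha> = \<gamma> then a \<alpha> * x \<gamma> else 0)) - (\<Sum>\<gamma>\<in>A. (1 - e (u \<alpha>)) * (x \<gamma> * K \<alpha> \<gamma>))"
    unfolding sum_subtractf[symmetric] by (intro sum.cong) (auto simp: G_def algebra_simps)
  then show ?thesis using assms finite_A by (simp add: sum_distrib_left)
qed

text \<open>\<open>R\<close> is built from \<open>inverse_matrix_on\<close>, so invertibility of
  \<open>G u\<close> has to be shown: injectivity by the maximum principle for x and -x with zero
  data, surjectivity by the Jacobi iteration, which contracts because 1 - e(u) stays below a
  constant less than 1.\<close>

lemma G_R:
  assumes u: "\<And>\<alpha>. \<alpha> \<in> A \<Longrightarrow> u \<alpha> \<ge> 0" and \<alpha>: "\<alpha> \<in> A"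
  shows "(\<Sum>\<gamma>\<in>A. G u \<alpha> \<gamma> * R u \<gamma>) = E u \<alpha>"
proof -
  have inj: "x \<alpha> = 0" if G0: "\<And>\<alpha>. \<alpha> \<in> A \<Longrightarrow> (\<Sum>\<gamma>\<in>A. G u \<alpha> \<gamma> * x \<gamma>) = 0" and "\<alpha> \<in> A" for x \<alpha>
  proof -
    have eq: "x \<alpha> * a \<alpha> = (1 - e (u \<alpha>)) * (\<Sum>\<gamma>\<in>A. x \<gamma> * K \<alpha> \<gamma>)" if "\<alpha> \<in> A" for \<alpha>
      using G0[OF that] G_mult[OF that] by simp
    have "x \<alpha> \<le> 0"
      by (rule maximum_principle[where \<epsilon> = "\<lambda>\<alpha>. e (u \<alpha>)" and c = "\<lambda>_. 0" and t = 0])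
        (use e_range u eq \<open>\<alpha> \<in> A\<close> in auto)
    moreover have "- x \<alpha> \<le> 0"
      by (rule maximum_principle[where \<epsilon> = "\<lambda>\<alpha>. e (u \<alpha>)" and c = "\<lambda>_. 0" and t = 0])
        (use e_range u eq \<open>\<alpha> \<in> A\<close> in \<open>auto simp: sum_negf\<close>)
    ultimately show ?thesis by simp
  qed
  have surj: "\<exists>x. \<forall>\<alpha>\<in>A. (\<Sum>\<gamma>\<in>A. G u \<alpha> \<gamma> * x \<gamma>) = b \<alpha>" for b
  proof -
    define T where "T x \<alpha> = (b \<alpha> + (1 - e (u \<alpha>)) * (\<Sum>\<gamma>\<in>A. x \<gamma> * K \<alpha> \<gamma>)) / a \<alpha>" for x \<alpha>
    define q where "q = Max (insert 0 ((\<lambda>\<alpha>. 1 - e (u \<alpha>)) ` A))"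
    have q: "0 \<le> q" "q < 1" and qi: "\<And>\<alpha>. \<alpha> \<in> A \<Longrightarrow> 1 - e (u \<alpha>) \<le> q"
      unfolding q_def using finite_A e_range u by (auto intro!: Max_ge)
    obtain x where x: "\<And>\<alpha>. \<alpha> \<in> A \<Longrightarrow> T x \<alpha> = x \<alpha>"
    proof (rule finite_sup_contraction[where A = A and S = UNIV and T = T and q = q and w = "\<lambda>_. 0"])
      fix v w :: "'a \<Rightarrow> real" and \<delta> \<alpha> assume \<delta>: "\<And>j. j \<in> A \<Longrightarrow> \<bar>v j - w j\<bar> \<le> \<delta>" and \<alpha>: "\<alpha> \<in> A"
      have pos: "a \<alpha> > 0" by (rule a_pos[OF \<alpha>])
      have "\<delta> \<ge> 0" using \<delta>[OF \<alpha>] by linarith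
      have "(\<Sum>\<gamma>\<in>A. (v \<gamma> - w \<gamma>) * K \<alpha> \<gamma>) + 0 * k \<alpha> \<le> \<delta> * a \<alpha>"
        using \<delta> \<open>\<delta> \<ge> 0\<close> by (intro irradiation_le[OF \<alpha>]) (force simp: abs_le_iff)+
      moreover have "(\<Sum>\<gamma>\<in>A. (w \<gamma> - v \<gamma>) * K \<alpha> \<gamma>) + 0 * k \<alpha> \<le> \<delta> * a \<alpha>"
        using \<delta> \<open>\<delta> \<ge> 0\<close> by (intro irradiation_le[OF \<alpha>]) (force simp: abs_le_iff)+
      ultimately have "\<bar>(\<Sum>\<gamma>\<in>A. v \<gamma> * K \<alpha> \<gamma>) - (\<Sum>\<gamma>\<in>A. w \<gamma> * K \<alpha> \<gamma>)\<bar> \<le> \<delta> * a \<alpha>"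
        by (simp add: left_diff_distrib sum_subtractf abs_le_iff)
      then have "(1 - e (u \<alpha>)) * \<bar>(\<Sum>\<gamma>\<in>A. v \<gamma> * K \<alpha> \<gamma>) - (\<Sum>\<gamma>\<in>A. w \<gamma> * K \<alpha> \<gamma>)\<bar> \<le> q * (\<delta> * a \<alpha>)"
        using qi[OF \<alpha>] q e_range[OF u[OF \<alpha>]] by (intro mult_mono) auto
      moreover have "T v \<alpha> - T w \<alpha> = (1 - e (u \<alpha>)) * ((\<Sum>\<gamma>\<in>A. v \<gamma> * K \<alpha> \<gamma>) - (\<Sum>\<gamma>\<in>A. w \<gamma> * K \<alpha> \<gamma>)) / a \<alpha>"
        by (simp add: T_def diff_divide_distrib[symmetric] right_diff_distrib)
      then have "\<bar>T v \<alpha> - T w \<alpha>\<bar> = (1 - e (u \<alpha>)) * \<bar>(\<Sum>\<gamma>\<in>A. v \<gamma> * K \<alpha> \<gamma>) - (\<Sum>\<gamma>\<in>A. w \<gamma> * K \<alpha> \<gamma>)\<bar> / a \<alpha>"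
        using e_range[OF u[OF \<alpha>]] pos by (simp add: abs_mult)
      ultimately show "\<bar>T v \<alpha> - T w \<alpha>\<bar> \<le> q * \<delta>" using pos by (simp add: divide_le_eq mult.assoc)
    qed (use finite_A q in auto)
    have "(\<Sum>\<gamma>\<in>A. G u \<alpha> \<gamma> * x \<gamma>) = b \<alpha>" if "\<alpha> \<in> A" for \<alpha>
    proof -
      have "x \<alpha> * a \<alpha> = b \<alpha> + (1 - e (u \<alpha>)) * (\<Sum>\<gamma>\<in>A. x \<gamma> * K \<alpha> \<gamma>)"
        using x[OF that] a_pos[OF that] by (simp add: T_def divide_eq_eq)
      then show ?thesis using G_mult[OF that] by simp
    qed
    then show ?thesis by blast
  qed
  have "(\<Sum>\<gamma>\<in>A. G u \<alpha> \<gamma> * R u \<gamma>) = (\<Sum>\<gamma>\<in>A. \<Sum>\<beta>\<in>A. G u \<alpha> \<gamma> * (inverse_matrix_on A (G u) \<gamma> \<beta> * E u \<beta>))"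
    by (simp add: R_def sum_distrib_left)
  also have "\<dots> = (\<Sum>\<beta>\<in>A. (\<Sum>\<gamma>\<in>A. G u \<alpha> \<gamma> * inverse_matrix_on A (G u) \<gamma> \<beta>) * E u \<beta>)"
    by (subst sum.swap) (simp add: sum_distrib_right mult.assoc)
  also have "\<dots> = (\<Sum>\<beta>\<in>A. of_bool (\<alpha> = \<beta>) * E u \<beta>)"
  proof (intro sum.cong refl)
    fix \<beta> assume "\<beta> \<in> A"
    then show "(\<Sum>\<gamma>\<in>A. G u \<alpha> \<gamma> * inverse_matrix_on A (G u) \<gamma> \<beta>) * E u \<beta> = of_bool (\<alpha> = \<beta>) * E u \<beta>"
      by (subst inverse_matrix_on_right[of A "G u", OF finite_A surj _ \<alpha>]) (use inj in auto)
  qed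
  also have "\<dots> = E u \<alpha>" using finite_A \<alpha> by (simp add: of_bool_def if_distrib[of "\<lambda>x. x * _"] cong: if_cong)
  finally show ?thesis .
qed

text \<open>The radiosity balance: outgoing radiation is emission plus reflected irradiation. In
  this form the maximum principle applies with c = \<sigma> u^4.\<close>

lemma R_eq:
  assumes u: "\<And>\<alpha>. \<alpha> \<in> A \<Longrightarrow> u \<alpha> \<ge> 0" and \<alpha>: "\<alpha> \<in> A"
  shows "R u \<alpha> * a \<alpha> = e (u \<alpha>) * (\<sigma> * u \<alpha> ^ 4) * a \<alpha> + (1 - e (u \<alpha>)) * W u \<alpha>"
  using G_R[of u \<alpha>, OF u \<alpha>] G_mult[OF \<alpha>, of u "R u"] by (simp add: E_def W_def algebra_simps)

lemma R_le:
  assumes u: "\<And>\<alpha>. \<alpha> \<in> A \<Longrightarrow> 0 \<le> u \<alpha> \<and> u \<alpha> \<le> r" and \<theta>: "\<theta> \<le> r" and \<alpha>: "\<alpha> \<in> A"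
  shows "R u \<alpha> \<le> \<sigma> * r ^ 4"
proof (rule maximum_principle[where \<epsilon> = "\<lambda>\<alpha>. e (u \<alpha>)" and c = "\<lambda>\<alpha>. \<sigma> * u \<alpha> ^ 4" and t = "\<sigma> * \<theta> ^ 4"])
  show "\<sigma> * u \<alpha> ^ 4 \<le> \<sigma> * r ^ 4" if "\<alpha> \<in> A" for \<alpha>
    using u[OF that] \<sigma>_pos by (intro mult_left_mono power_mono) auto
  show "\<sigma> * \<theta> ^ 4 \<le> \<sigma> * r ^ 4" using \<theta> \<theta>_pos \<sigma>_pos by (intro mult_left_mono power_mono) auto
qed (use e_range u R_eq \<alpha> in \<open>auto simp: W_def\<close>)

lemma R_ge:
  assumes u: "\<And>\<alpha>. \<alpha> \<in> A \<Longrightarrow> l \<le> u \<alpha>" and l: "0 \<le> l" "l \<le> \<theta>" and \<alpha>: "\<alpha> \<in> A"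
  shows "\<sigma> * l ^ 4 \<le> R u \<alpha>"
proof -
  have u0: "\<And>\<alpha>. \<alpha> \<in> A \<Longrightarrow> u \<alpha> \<ge> 0" using u l(1) by force
  have "- R u \<alpha> \<le> - (\<sigma> * l ^ 4)"
  proof (rule maximum_principle[where \<epsilon> = "\<lambda>\<alpha>. e (u \<alpha>)" and c = "\<lambda>\<alpha>. - (\<sigma> * u \<alpha> ^ 4)" and t = "- (\<sigma> * \<theta> ^ 4)"])
    show "- (\<sigma> * u \<alpha> ^ 4) \<le> - (\<sigma> * l ^ 4)" if "\<alpha> \<in> A" for \<alpha>
      using u[OF that] \<sigma>_pos l by (auto intro!: mult_left_mono power_mono)
    show "- (\<sigma> * \<theta> ^ 4) \<le> - (\<sigma> * l ^ 4)" using l \<sigma>_pos by (auto intro!: mult_left_mono power_mono)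
    show "- R u \<alpha> * a \<alpha> = e (u \<alpha>) * - (\<sigma> * u \<alpha> ^ 4) * a \<alpha>
        + (1 - e (u \<alpha>)) * ((\<Sum>\<beta>\<in>A. - R u \<beta> * K \<alpha> \<beta>) + - (\<sigma> * \<theta> ^ 4) * k \<alpha>)" if "\<alpha> \<in> A" for \<alpha>
      using R_eq[of u \<alpha>, OF u0 that] by (simp add: W_def sum_negf algebra_simps)
  qed (use e_range u0 \<alpha> in auto)
  then show ?thesis by simp
qed

lemma W_le:
  assumes u: "\<And>\<alpha>. \<alpha> \<in> A \<Longrightarrow> 0 \<le> u \<alpha> \<and> u \<alpha> \<le> r" and \<theta>: "\<theta> \<le> r" and \<alpha>: "\<alpha> \<in> A"
  shows "W u \<alpha> \<le> \<sigma> * r ^ 4 * a \<alpha>"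
  unfolding W_def
proof (rule irradiation_le[OF \<alpha>])
  show "R u \<beta> \<le> \<sigma> * r ^ 4" if "\<beta> \<in> A" for \<beta> by (rule R_le[OF u \<theta> that])
  show "\<sigma> * \<theta> ^ 4 \<le> \<sigma> * r ^ 4" using \<theta> \<theta>_pos \<sigma>_pos by (intro mult_left_mono power_mono) auto
qed

lemma W_ge:
  assumes u: "\<And>\<alpha>. \<alpha> \<in> A \<Longrightarrow> l \<le> u \<alpha>" and l: "0 \<le> l" "l \<le> \<theta>" and \<alpha>: "\<alpha> \<in> A"
  shows "\<sigma> * l ^ 4 * a \<alpha> \<le> W u \<alpha>"
proof -
  have "(\<Sum>\<beta>\<in>A. - R u \<beta> * K \<alpha> \<beta>) + - (\<sigma> * \<theta> ^ 4) * k \<alpha> \<le> - (\<sigma> * l ^ 4) * a \<alpha>"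
    using R_ge[OF u l] l \<sigma>_pos by (intro irradiation_le[OF \<alpha>]) (auto intro!: mult_left_mono power_mono)
  then show ?thesis by (simp add: W_def sum_negf)
qed

text \<open>The difference of two radiosities solves the system with reflectivities 1 - e(u). The
  mismatch of emissivities moves into the data, and bringing these into the form e(u) c costs a
  division by e(u); hence the factor 1/\<epsilon>.\<close>

lemma R_diff_le:
  assumes u: "\<And>\<alpha>. \<alpha> \<in> A \<Longrightarrow> 0 \<le> u \<alpha> \<and> u \<alpha> \<le> r" and v: "\<And>\<alpha>. \<alpha> \<in> A \<Longrightarrow> 0 \<le> v \<alpha> \<and> v \<alpha> \<le> r"
    and \<theta>: "\<theta> \<le> r" and \<delta>: "\<And>\<alpha>. \<alpha> \<in> A \<Longrightarrow> \<bar>u \<alpha> - v \<alpha>\<bar> \<le> \<delta>"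
    and L: "\<And>s t. s \<in> {0..r} \<Longrightarrow> t \<in> {0..r} \<Longrightarrow> \<bar>e s - e t\<bar> \<le> L * \<bar>s - t\<bar>" "L \<ge> 0"
    and \<epsilon>: "\<And>s. s \<in> {0..r} \<Longrightarrow> \<epsilon> \<le> e s" "\<epsilon> > 0" and \<alpha>: "\<alpha> \<in> A"
  shows "R u \<alpha> - R v \<alpha> \<le> \<sigma> * (4 * r ^ 3 + L * r ^ 4 / \<epsilon>) * \<delta>"
proof (rule maximum_principle[where \<epsilon> = "\<lambda>\<alpha>. e (u \<alpha>)" and t = 0
      and c = "\<lambda>\<alpha>. \<sigma> * (u \<alpha> ^ 4 - v \<alpha> ^ 4) + (e (u \<alpha>) - e (v \<alpha>)) * (\<sigma> * v \<alpha> ^ 4 - W v \<alpha> / a \<alpha>) / e (u \<alpha>)"])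
  have r: "r \<ge> 0" using \<theta> \<theta>_pos by linarith
  have \<delta>0: "\<delta> \<ge> 0" using \<delta>[OF \<alpha>] by linarith
  have u0: "\<And>\<alpha>. \<alpha> \<in> A \<Longrightarrow> u \<alpha> \<ge> 0" and v0: "\<And>\<alpha>. \<alpha> \<in> A \<Longrightarrow> v \<alpha> \<ge> 0" using u v by auto
  show "0 \<le> \<sigma> * (4 * r ^ 3 + L * r ^ 4 / \<epsilon>) * \<delta>" using \<sigma>_pos r L(2) \<epsilon>(2) \<delta>0 by simp
  fix \<alpha> assume \<alpha>: "\<alpha> \<in> A"
  show "0 < e (u \<alpha>) \<and> e (u \<alpha>) \<le> 1" using e_range u0[OF \<alpha>] by blast
  have pos: "a \<alpha> > 0" "e (u \<alpha>) > 0" using a_pos[OF \<alpha>] e_range u0[OF \<alpha>] by auto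
  have "(R u \<alpha> - R v \<alpha>) * a \<alpha> = \<sigma> * (e (u \<alpha>) * u \<alpha> ^ 4 - e (v \<alpha>) * v \<alpha> ^ 4) * a \<alpha>
      + ((1 - e (u \<alpha>)) * W u \<alpha> - (1 - e (v \<alpha>)) * W v \<alpha>)"
    using R_eq[of u \<alpha>, OF u0 \<alpha>] R_eq[of v \<alpha>, OF v0 \<alpha>] by (simp add: algebra_simps)
  also have "\<dots> = e (u \<alpha>) * (\<sigma> * (u \<alpha> ^ 4 - v \<alpha> ^ 4) + (e (u \<alpha>) - e (v \<alpha>)) * (\<sigma> * v \<alpha> ^ 4 - W v \<alpha> / a \<alpha>) / e (u \<alpha>)) * a \<alpha>
      + (1 - e (u \<alpha>)) * (W u \<alpha> - W v \<alpha>)"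
    using pos by (simp add: field_simps)
  also have "W u \<alpha> - W v \<alpha> = (\<Sum>\<beta>\<in>A. (R u \<beta> - R v \<beta>) * K \<alpha> \<beta>) + 0 * k \<alpha>"
    by (simp add: W_def left_diff_distrib sum_subtractf)
  finally show "(R u \<alpha> - R v \<alpha>) * a \<alpha> = e (u \<alpha>) * (\<sigma> * (u \<alpha> ^ 4 - v \<alpha> ^ 4) + (e (u \<alpha>) - e (v \<alpha>)) * (\<sigma> * v \<alpha> ^ 4 - W v \<alpha> / a \<alpha>) / e (u \<alpha>)) * a \<alpha>
      + (1 - e (u \<alpha>)) * ((\<Sum>\<beta>\<in>A. (R u \<beta> - R v \<beta>) * K \<alpha> \<beta>) + 0 * k \<alpha>)" .
  have "\<sigma> * (u \<alpha> ^ 4 - v \<alpha> ^ 4) \<le> \<sigma> * (4 * r ^ 3 * \<delta>)"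
    using u[OF \<alpha>] v[OF \<alpha>] \<delta>[OF \<alpha>] \<sigma>_pos by (intro mult_left_mono power4_diff_le) auto
  moreover have "(e (u \<alpha>) - e (v \<alpha>)) * (\<sigma> * v \<alpha> ^ 4 - W v \<alpha> / a \<alpha>) / e (u \<alpha>) \<le> \<sigma> * (L * r ^ 4 / \<epsilon>) * \<delta>"
  proof -
    have "\<bar>e (u \<alpha>) - e (v \<alpha>)\<bar> \<le> L * \<delta>"
      using L(1)[of "u \<alpha>" "v \<alpha>"] u[OF \<alpha>] v[OF \<alpha>] mult_left_mono[OF \<delta>[OF \<alpha>] L(2)] by fastforce
    \<comment> \<open>Both quantities lie between 0 and \<sigma> r^4, so their difference costs
      \<sigma> r^4 only once.\<close>
    moreover have "\<bar>\<sigma> * v \<alpha> ^ 4 - W v \<alpha> / a \<alpha>\<bar> \<le> \<sigma> * r ^ 4"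
    proof -
      have "W v \<alpha> / a \<alpha> \<le> \<sigma> * r ^ 4" using W_le[OF v \<theta> \<alpha>] pos by (simp add: divide_le_eq)
      moreover have "0 \<le> W v \<alpha>" using W_ge[of 0 v \<alpha>] v0 \<theta>_pos \<alpha> by simp
      then have "0 \<le> W v \<alpha> / a \<alpha>" using pos by simp
      moreover have "\<sigma> * v \<alpha> ^ 4 \<le> \<sigma> * r ^ 4" using v[OF \<alpha>] \<sigma>_pos by (intro mult_left_mono power_mono) auto
      moreover have "0 \<le> \<sigma> * v \<alpha> ^ 4" using \<sigma>_pos by simp
      ultimately show ?thesis by linarith
    qed
    ultimately have "\<bar>(e (u \<alpha>) - e (v \<alpha>)) * (\<sigma> * v \<alpha> ^ 4 - W v \<alpha> / a \<alpha>)\<bar> \<le> L * \<delta> * (\<sigma> * r ^ 4)"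
      unfolding abs_mult by (intro mult_mono) (use L(2) \<delta>0 in auto)
    then have "(e (u \<alpha>) - e (v \<alpha>)) * (\<sigma> * v \<alpha> ^ 4 - W v \<alpha> / a \<alpha>) / e (u \<alpha>) \<le> L * \<delta> * (\<sigma> * r ^ 4) / \<epsilon>"
      using \<epsilon>(1)[of "u \<alpha>"] u[OF \<alpha>] \<epsilon>(2) pos by (intro frac_le) (use L(2) \<delta>0 \<sigma>_pos in auto)
    then show ?thesis by (simp add: algebra_simps)
  qed
  ultimately show "\<sigma> * (u \<alpha> ^ 4 - v \<alpha> ^ 4) + (e (u \<alpha>) - e (v \<alpha>)) * (\<sigma> * v \<alpha> ^ 4 - W v \<alpha> / a \<alpha>) / e (u \<alpha>)
      \<le> \<sigma> * (4 * r ^ 3 + L * r ^ 4 / \<epsilon>) * \<delta>"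
    by (simp add: algebra_simps)
qed (rule \<alpha>)

text \<open>The exterior contribution cancels in the difference, so the bound on R u - R v passes to
  the irradiation by averaging.\<close>

lemma W_Lipschitz:
  assumes u: "\<And>\<alpha>. \<alpha> \<in> A \<Longrightarrow> 0 \<le> u \<alpha> \<and> u \<alpha> \<le> r" and v: "\<And>\<alpha>. \<alpha> \<in> A \<Longrightarrow> 0 \<le> v \<alpha> \<and> v \<alpha> \<le> r"
    and \<theta>: "\<theta> \<le> r" and \<delta>: "\<And>\<alpha>. \<alpha> \<in> A \<Longrightarrow> \<bar>u \<alpha> - v \<alpha>\<bar> \<le> \<delta>"
    and L: "\<And>s t. s \<in> {0..r} \<Longrightarrow> t \<in> {0..r} \<Longrightarrow> \<bar>e s - e t\<bar> \<le> L * \<bar>s - t\<bar>" "L \<ge> 0"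
    and \<epsilon>: "\<And>s. s \<in> {0..r} \<Longrightarrow> \<epsilon> \<le> e s" "\<epsilon> > 0" and \<alpha>: "\<alpha> \<in> A"
  shows "\<bar>W u \<alpha> - W v \<alpha>\<bar> \<le> \<sigma> * (4 * r ^ 3 + L * r ^ 4 / \<epsilon>) * \<delta> * a \<alpha>"
proof -
  let ?B = "\<sigma> * (4 * r ^ 3 + L * r ^ 4 / \<epsilon>) * \<delta>"
  have "\<delta> \<ge> 0" "r \<ge> 0" using \<delta>[OF \<alpha>] \<theta> \<theta>_pos by linarith+
  then have B: "0 \<le> ?B" using \<sigma>_pos L(2) \<epsilon>(2) by simp
  have \<delta>': "\<bar>v \<alpha> - u \<alpha>\<bar> \<le> \<delta>" if "\<alpha> \<in> A" for \<alpha> using \<delta>[OF that] by (simp add: abs_minus_commute)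
  have "(\<Sum>\<beta>\<in>A. (R u \<beta> - R v \<beta>) * K \<alpha> \<beta>) + 0 * k \<alpha> \<le> ?B * a \<alpha>"
    by (rule irradiation_le[OF \<alpha> R_diff_le[OF u v \<theta> \<delta> L \<epsilon>] B])
  moreover have "(\<Sum>\<beta>\<in>A. (R v \<beta> - R u \<beta>) * K \<alpha> \<beta>) + 0 * k \<alpha> \<le> ?B * a \<alpha>"
    by (rule irradiation_le[OF \<alpha> R_diff_le[OF v u \<theta> \<delta>' L \<epsilon>] B])
  ultimately show ?thesis by (simp add: W_def left_diff_distrib sum_subtractf abs_le_iff)
qed

end

section \<open>Data bounds\<close>

lemma AE_lebesgue_on_subset:
  assumes "S \<subseteq> S'" "S \<in> sets lebesgue" "S' \<in> sets lebesgue" "AE x in lebesgue_on S'. P x"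
  shows "AE x in lebesgue_on S. P x"
proof -
  have "AE x in lebesgue. x \<in> S' \<longrightarrow> P x" using assms by (subst AE_restrict_space_iff[symmetric]) auto
  then have "AE x in lebesgue. x \<in> S \<longrightarrow> P x" using assms(1) by (auto elim!: eventually_mono)
  then show ?thesis using assms by (subst AE_restrict_space_iff) auto
qed

lemma esssup_lebesgue_on_mono:
  fixes g :: "'a::euclidean_space \<Rightarrow> ereal"
  assumes "S \<subseteq> S'" "S \<in> sets lebesgue" "S' \<in> sets lebesgue" "g \<in> borel_measurable (lebesgue_on S')"
  shows "esssup (lebesgue_on S) g \<le> esssup (lebesgue_on S') g"
proof (rule esssup_I)
  show "g \<in> borel_measurable (lebesgue_on S)"
    using measurable_restrict_mono[OF assms(4,1)] .
  show "AE x in lebesgue_on S. g x \<le> esssup (lebesgue_on S') g"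
    by (rule AE_lebesgue_on_subset[OF assms(1-3) esssup_AE])
qed

text \<open>The alternative -\<infinity> is the essential supremum over a null space; on positive
  measure the lower bound and the essential upper bound hold at a common point.\<close>

lemma esssup_eq_bot_or_ge:
  fixes g :: "'a \<Rightarrow> ereal"
  assumes "g \<in> borel_measurable M" "AE x in M. c \<le> g x"
  shows "esssup M g = - \<infinity> \<or> c \<le> esssup M g"
proof (cases "emeasure M (space M) = 0")
  case True
  then show ?thesis using esssup_zero_space[OF True] assms(1) by auto
next
  case False
  have "AE x in M. c \<le> esssup M g" using assms(2) esssup_AE[of g M] by eventually_elim auto
  then show ?thesis using False by (auto simp: AE_iff_null null_sets_def)
qed

lemma Linf_norm_nonneg:
  fixes g :: "'a::euclidean_space \<Rightarrow> real"
  assumes "g \<in> borel_measurable (lebesgue_on S)"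
  shows "0 \<le> Linf_norm S g"
  using esssup_eq_bot_or_ge[of "\<lambda>x. ereal \<bar>g x\<bar>" "lebesgue_on S" 0] assms
  by (auto simp: Linf_norm_def real_of_ereal_pos)

lemma Linf_norm_mono:
  fixes g :: "'a::euclidean_space \<Rightarrow> real"
  assumes S: "S \<subseteq> S'" "S \<in> sets lebesgue" "S' \<in> sets lebesgue" and g: "g \<in> Linf S'"
  shows "Linf_norm S g \<le> Linf_norm S' g"
proof -
  have meas: "g \<in> borel_measurable (lebesgue_on S')" and fin: "esssup (lebesgue_on S') (\<lambda>x. ereal \<bar>g x\<bar>) < \<infinity>"
    using g by (auto simp: Linf_def)
  have le: "esssup (lebesgue_on S) (\<lambda>x. ereal \<bar>g x\<bar>) \<le> esssup (lebesgue_on S') (\<lambda>x. ereal \<bar>g x\<bar>)"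
    using meas by (intro esssup_lebesgue_on_mono S) auto
  show ?thesis
  proof (cases "esssup (lebesgue_on S) (\<lambda>x. ereal \<bar>g x\<bar>) = - \<infinity>")
    \<comment> \<open>Here \<open>S\<close> is a null set, for instance the empty cylinder at time
      0, and \<open>real_of_ereal\<close> turns -\<infinity> into norm 0.\<close>
    case True
    then show ?thesis using Linf_norm_nonneg[OF meas] by (simp add: Linf_norm_def)
  next
    case False
    then have "0 \<le> esssup (lebesgue_on S) (\<lambda>x. ereal \<bar>g x\<bar>)"
      using esssup_eq_bot_or_ge[of "\<lambda>x. ereal \<bar>g x\<bar>" "lebesgue_on S" 0]
        measurable_restrict_mono[OF meas S(1)] by simp
    then show ?thesis unfolding Linf_norm_def using le fin
      by (intro real_of_ereal_positive_mono) auto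
  qed
qed

lemma Linf_subset:
  fixes g :: "'a::euclidean_space \<Rightarrow> real"
  assumes S: "S \<subseteq> S'" "S \<in> sets lebesgue" "S' \<in> sets lebesgue" and g: "g \<in> Linf S'"
  shows "g \<in> Linf S"
proof -
  have meas: "g \<in> borel_measurable (lebesgue_on S')" and fin: "esssup (lebesgue_on S') (\<lambda>x. ereal \<bar>g x\<bar>) < \<infinity>"
    using g by (auto simp: Linf_def)
  have "esssup (lebesgue_on S) (\<lambda>x. ereal \<bar>g x\<bar>) \<le> esssup (lebesgue_on S') (\<lambda>x. ereal \<bar>g x\<bar>)"
    using meas by (intro esssup_lebesgue_on_mono S) auto
  then show ?thesis using fin measurable_restrict_mono[OF meas S(1)] by (auto simp: Linf_def)
qed

text \<open>Conversion to a real number is monotone on finite nonnegative values. Positivity of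
  \<open>g\<close> keeps the infimum nonnegative, and positive measure of \<open>S\<close> prevents
  the essential infimum over \<open>S\<close> from being \<infinity>, which would be converted to
  0.\<close>

lemma ess_inf_antimono:
  fixes g :: "'a::euclidean_space \<Rightarrow> real"
  assumes S: "S \<subseteq> S'" "S \<in> sets lebesgue" "S' \<in> sets lebesgue" and g: "g \<in> Linf S'"
    and S_pos: "emeasure lebesgue S \<noteq> 0" and pos: "AE x in lebesgue_on S'. 0 < g x"
  shows "ess_inf S' g \<le> ess_inf S g" "0 \<le> ess_inf S' g"
proof -
  have meas: "g \<in> borel_measurable (lebesgue_on S')" using g by (auto simp: Linf_def)
  let ?h = "\<lambda>x. - ereal (g x)"
  let ?e = "esssup (lebesgue_on S) ?h" and ?e' = "esssup (lebesgue_on S') ?h"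
  have le: "?e \<le> ?e'" using meas by (intro esssup_lebesgue_on_mono S) auto
  have e': "?e' \<le> 0" using meas pos by (intro esssup_I) (auto elim!: eventually_mono)
  have fin: "?e \<noteq> - \<infinity>"
  proof
    assume e: "?e = - \<infinity>"
    have "AE x in lebesgue_on S. ?h x \<le> ?e" by (rule esssup_AE)
    then have "AE x in lebesgue_on S. False" unfolding e by (auto elim!: eventually_mono)
    then have "emeasure (lebesgue_on S) (space (lebesgue_on S)) = 0"
      by (auto simp: AE_iff_null null_sets_def)
    then show False using S_pos S(2) by (simp add: emeasure_restrict_space)
  qed
  show "0 \<le> ess_inf S' g" unfolding ess_inf_def using e' by (intro real_of_ereal_pos) auto
  have "- ?e \<le> \<infinity>" "- ?e \<noteq> \<infinity>" "- ?e' \<le> - ?e" "0 \<le> - ?e'" using fin le e' by (auto simp: ereal_uminus_eq_reorder)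
  then show "ess_inf S' g \<le> ess_inf S g" unfolding ess_inf_def
    by (intro real_of_ereal_positive_mono) auto
qed

lemma neg_variation_set_nonempty:
  assumes "r > (0::real)"
  shows "{\<Sum>l=1..n. - min 0 (e (s l) - e (s (l - 1))) | (n::nat) s.
            s 0 = 0 \<and> s n = r \<and> strict_mono_on {0..n} s} \<noteq> ({} :: real set)"
proof -
  define s where "s n = (if n = 0 then 0 else r)" for n :: nat
  have "s 0 = 0 \<and> s 1 = r \<and> strict_mono_on {0..1} s"
    using assms by (auto simp: s_def strict_mono_on_def)
  then show ?thesis by blast
qed

lemma partition_bounds:
  fixes s :: "nat \<Rightarrow> real"
  assumes "s 0 = 0" "s n = r" "strict_mono_on {0..n} s" "l \<le> n"
  shows "0 \<le> s l" "s l \<le> r"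
proof -
  show "0 \<le> s l" using strict_mono_onD[OF assms(3), of 0 l] assms(1,4) by (cases "l = 0") auto
  show "s l \<le> r" using strict_mono_onD[OF assms(3), of l n] assms(2,4) by (cases "l = n") auto
qed

context fv_physics
begin

lemma emissivity_lip:
  assumes "s \<in> {0..r}" "t \<in> {0..r}"
  shows "\<bar>emissivity D s - emissivity D t\<bar> \<le> Lip_const (emissivity D) r * \<bar>s - t\<bar>"
proof (cases "s = t")
  case False
  then have "r > 0" using assms by auto
  have "\<bar>emissivity D s - emissivity D t\<bar> / \<bar>s - t\<bar> \<le> Lip_const (emissivity D) r"
    using \<open>r > 0\<close> assms False emissivity_Lipschitz[of r]
    by (auto simp: Lip_const_def difference_quotients_def intro!: cSup_upper)
  then show ?thesis using False by (simp add: divide_le_eq)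
qed simp

lemma Lip_const_nonneg: "r \<ge> 0 \<Longrightarrow> 0 \<le> Lip_const (emissivity D) r"
proof (cases "r = 0")
  case False
  assume "r \<ge> 0"
  then have "0 \<le> Lip_const (emissivity D) r * \<bar>0 - r\<bar>"
    using emissivity_lip[of 0 r r] by (intro order_trans[OF abs_ge_zero]) auto
  then show ?thesis using False by (simp add: zero_le_mult_iff)
qed (simp add: Lip_const_def)

lemma Lip_const_mono:
  assumes "0 < r" "r \<le> r'"
  shows "Lip_const (emissivity D) r \<le> Lip_const (emissivity D) r'"
proof -
  have "\<bar>emissivity D 0 - emissivity D r\<bar> / \<bar>0 - r\<bar> \<in> difference_quotients (emissivity D) r"
    unfolding difference_quotients_def using assms by fastforce
  then have "difference_quotients (emissivity D) r \<noteq> {}" by blast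
  moreover have "difference_quotients (emissivity D) r \<subseteq> difference_quotients (emissivity D) r'"
    unfolding difference_quotients_def using assms by fastforce
  ultimately show ?thesis
    using assms emissivity_Lipschitz[of r'] by (auto simp: Lip_const_def intro!: cSup_subset_mono)
qed

lemma emissivity_continuous: "continuous_on {0..r} (emissivity D)"
proof (cases "r \<ge> 0")
  case True
  have "(Lip_const (emissivity D) r)-lipschitz_on {0..r} (emissivity D)"
    using emissivity_lip Lip_const_nonneg[OF True] by (auto simp: lipschitz_on_def dist_real_def)
  then show ?thesis by (rule lipschitz_on_continuous_on)
qed auto

lemma emissivity_bdd_below: "bdd_below (emissivity D ` {0..r})"
proof (rule bdd_belowI2)
  fix s assume "s \<in> {0..r}"
  then show "0 \<le> emissivity D s" using emissivity_range[of s] by auto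
qed

lemma min_val_le: "s \<in> {0..r} \<Longrightarrow> min_val (emissivity D) r \<le> emissivity D s"
  unfolding min_val_def by (rule cINF_lower[OF emissivity_bdd_below])

lemma min_val_pos:
  assumes "r \<ge> 0"
  shows "0 < min_val (emissivity D) r"
proof -
  obtain s where s: "s \<in> {0..r}" "\<And>t. t \<in> {0..r} \<Longrightarrow> emissivity D s \<le> emissivity D t"
    using continuous_attains_inf[of "{0..r}" "emissivity D"] emissivity_continuous assms by auto
  have "0 < emissivity D s" using emissivity_range[of s] s(1) by auto
  also have "\<dots> \<le> min_val (emissivity D) r"
    unfolding min_val_def using s assms by (intro cINF_greatest) auto
  finally show ?thesis .
qed

lemma min_val_le_1: "r \<ge> 0 \<Longrightarrow> min_val (emissivity D) r \<le> 1"
  using min_val_le[of 0 r] emissivity_range[of 0] by auto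

lemma min_val_antimono: "0 \<le> r \<Longrightarrow> r \<le> r' \<Longrightarrow> min_val (emissivity D) r' \<le> min_val (emissivity D) r"
  unfolding min_val_def by (rule cINF_superset_mono[OF _ emissivity_bdd_below]) auto

text \<open>Every drop of the emissivity is at most the Lipschitz constant times the length of the
  subinterval, and the lengths add up to r. Boundedness gives the supremum in the negative variation
  its meaning.\<close>

lemma neg_variation_bdd:
  "bdd_above {\<Sum>l=1..n. - min 0 (emissivity D (s l) - emissivity D (s (l - 1))) | (n::nat) s.
            s 0 = 0 \<and> s n = r \<and> strict_mono_on {0..n} s}"
  (is "bdd_above ?X")
proof (rule bdd_aboveI)
  fix x assume "x \<in> ?X"
  then obtain n :: nat and s where x: "x = (\<Sum>l=1..n. - min 0 (emissivity D (s l) - emissivity D (s (l - 1))))"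
    and s: "s 0 = 0" "s n = r" "strict_mono_on {0..n} s"
    by blast
  let ?L = "Lip_const (emissivity D) r"
  have "(\<Sum>l=1..n. - min 0 (emissivity D (s l) - emissivity D (s (l - 1)))) \<le> (\<Sum>l=1..n. ?L * (s l - s (l - 1)))"
  proof (rule sum_mono)
    fix l assume l: "l \<in> {1..n}"
    have "s (l - 1) < s l" using strict_mono_onD[OF s(3), of "l - 1" l] l by auto
    moreover have "\<bar>emissivity D (s l) - emissivity D (s (l - 1))\<bar> \<le> ?L * \<bar>s l - s (l - 1)\<bar>"
      using partition_bounds[OF s] l by (intro emissivity_lip) auto
    ultimately show "- min 0 (emissivity D (s l) - emissivity D (s (l - 1))) \<le> ?L * (s l - s (l - 1))"
      by (auto simp: min_def)
  qed
  also have "\<dots> = ?L * r"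
    using s(2) sum_telescope''[of 0 n s] s(1) by (simp add: sum_distrib_left[symmetric] atLeastSucAtMost_greaterThanAtMost)
  finally show "x \<le> ?L * r" unfolding x .
qed

lemma neg_variation_nonneg:
  assumes "r \<ge> 0"
  shows "0 \<le> neg_variation (emissivity D) r"
proof (cases "r = 0")
  case False
  let ?X = "{\<Sum>l=1..n. - min 0 (emissivity D (s l) - emissivity D (s (l - 1))) | (n::nat) s.
            s 0 = 0 \<and> s n = r \<and> strict_mono_on {0..n} s}"
  have "?X \<noteq> {}" by (rule neg_variation_set_nonempty) (use assms False in simp)
  then obtain x where x: "x \<in> ?X" by blast
  then have "0 \<le> x" by (auto intro!: sum_nonneg simp: min_def)
  also have "x \<le> Sup ?X" by (rule cSup_upper[OF x neg_variation_bdd])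
  finally show ?thesis using False by (simp add: neg_variation_def)
qed (simp add: neg_variation_def)

text \<open>A partition of [0,r] is extended by the point \<open>r'\<close>, which adds one
  nonnegative summand.\<close>

lemma neg_variation_mono:
  assumes "0 < r" "r \<le> r'"
  shows "neg_variation (emissivity D) r \<le> neg_variation (emissivity D) r'"
proof (cases "r = r'")
  case False
  let ?e = "emissivity D"
  let ?X = "\<lambda>r. {\<Sum>l=1..n. - min 0 (?e (s l) - ?e (s (l - 1))) | (n::nat) s.
            s 0 = 0 \<and> s n = r \<and> strict_mono_on {0..n} s}"
  have "Sup (?X r) \<le> Sup (?X r')"
  proof (rule cSup_mono)
    show "?X r \<noteq> {}" by (rule neg_variation_set_nonempty[OF assms(1)])
    show "bdd_above (?X r')" by (rule neg_variation_bdd)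
    fix x assume "x \<in> ?X r"
    then obtain n :: nat and s where s: "x = (\<Sum>l=1..n. - min 0 (?e (s l) - ?e (s (l - 1))))"
      "s 0 = 0" "s n = r" "strict_mono_on {0..n} s"
    by blast
    define s' where "s' = s(Suc n := r')"
    have "strict_mono_on {0..Suc n} s'"
    proof (rule strict_mono_onI)
      fix i j assume ij: "i \<in> {0..Suc n}" "j \<in> {0..Suc n}" "i < j"
      show "s' i < s' j"
      proof (cases "j = Suc n")
        case True
        then have "s' i = s i" "s' j = r'" "i \<le> n" using ij by (auto simp: s'_def)
        then show ?thesis using partition_bounds(2)[OF s(2-4), of i] assms False by auto
      next
        case False
        then show ?thesis using ij strict_mono_onD[OF s(4), of i j] by (auto simp: s'_def)
      qed
    qed
    moreover have "s' 0 = 0" "s' (Suc n) = r'" using s(2) by (auto simp: s'_def)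
    ultimately have mem: "(\<Sum>l=1..Suc n. - min 0 (?e (s' l) - ?e (s' (l - 1)))) \<in> ?X r'" by blast
    have "x = (\<Sum>l=1..n. - min 0 (?e (s' l) - ?e (s' (l - 1))))"
      unfolding s(1) by (intro sum.cong) (auto simp: s'_def)
    then have "x \<le> (\<Sum>l=1..Suc n. - min 0 (?e (s' l) - ?e (s' (l - 1))))"
      by (simp add: min_def)
    then show "\<exists>y\<in>?X r'. x \<le> y" using mem by blast
  qed
  then show ?thesis using assms by (simp add: neg_variation_def)
qed simp

end

section \<open>The finite volume scheme\<close>

text \<open>In e(t) (t^4 - s^4) + (e(t) - e(s)) s^4 the first part is nonnegative, so only a drop of
  the emissivity can make the difference negative.\<close>

lemma power4_weighted_diff_ge:
  fixes e :: "real \<Rightarrow> real"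
  assumes "0 \<le> s" "s \<le> t" "t \<le> r" "0 \<le> e t" "\<bar>e t - e s\<bar> \<le> L * (t - s)"
  shows "- (L * r ^ 4) * (t - s) \<le> e t * t ^ 4 - e s * s ^ 4"
proof -
  have "\<bar>(e t - e s) * s ^ 4\<bar> \<le> L * (t - s) * r ^ 4"
    unfolding abs_mult using assms by (intro mult_mono) (auto intro!: power_mono)
  moreover have "0 \<le> e t * (t ^ 4 - s ^ 4)" using assms by (simp add: power_mono)
  moreover have "e t * t ^ 4 - e s * s ^ 4 = e t * (t ^ 4 - s ^ 4) + (e t - e s) * s ^ 4"
    by (simp add: algebra_simps)
  moreover have "- (L * r ^ 4) * (t - s) = - (L * (t - s) * r ^ 4)" by simp
  ultimately show ?thesis by linarith
qed

text \<open>Surface through which the cell exchanges radiation within one of the two enclosures.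
  Both enter the estimates for the residual in the same way, so their areas are merged.\<close>

definition radiating_area :: "('i, 'a) fv_data \<Rightarrow> 'i \<Rightarrow> real" where
  "radiating_area D i = area (frontier (\<omega>\<^sub>m D Solid i) \<inter> \<Gamma>\<^sub>\<Omega> D) + area (\<omega> D i \<inter> \<Sigma> D)"

definition outer_area :: "('i, 'a) fv_data \<Rightarrow> 'i \<Rightarrow> real" where
  "outer_area D i = area (frontier (\<omega>\<^sub>m D Solid i) \<inter> (frontier (\<Omega> D) - \<Gamma>\<^sub>\<Omega> D))"

definition conductance :: "('i, 'a) fv_data \<Rightarrow> 'i \<Rightarrow> phase \<Rightarrow> 'i \<Rightarrow> real" where
  "conductance D i p j = conductivity D p / norm (pt D i - pt D j)
     * area (frontier (\<omega>\<^sub>m D p i) \<inter> frontier (\<omega>\<^sub>m D p j))"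

text \<open>Derivative of the conduction term in the cell's own temperature; it becomes the common
  part \<open>d\<close> of \<open>implicit_system_solution\<close>.\<close>

definition total_conductance :: "('i, 'a) fv_data \<Rightarrow> 'i \<Rightarrow> real" where
  "total_conductance D i = (\<Sum>p\<in>{Solid, Gas}. \<Sum>j\<in>nb\<^sub>m D p i. conductance D i p j)"

context fv_setting
begin

sublocale outer: enclosure "I\<^sub>\<Omega> D" "\<lambda>\<alpha>. area (\<zeta> D \<alpha>)" "\<Lambda>\<^sub>\<Gamma> D" "\<lambda>\<alpha>. \<Lambda>\<^sub>\<Gamma> D \<alpha> (ph D)"
  "emissivity D" "boltzmann D" "\<theta>ext D"
proof
  show "(\<Sum>\<beta>\<in>I\<^sub>\<Omega> D. \<Lambda>\<^sub>\<Gamma> D \<alpha> \<beta>) + \<Lambda>\<^sub>\<Gamma> D \<alpha> (ph D) = area (\<zeta> D \<alpha>)" if "\<alpha> \<in> I\<^sub>\<Omega> D" for \<alpha>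
    using \<Lambda>\<^sub>\<Gamma>_sum[of \<alpha>] that ph_notin finite_elements by (simp add: I\<^sub>\<Gamma>_def)
qed (use finite_elements area_element_pos \<Lambda>\<^sub>\<Gamma>_nonneg emissivity_range boltzmann_pos \<theta>ext_pos in
      \<open>auto simp: I\<^sub>\<Gamma>_def\<close>)

text \<open>The gas cavity is closed, hence exterior view factors 0. Taking
  \<open>\<theta>ext D\<close> as its exterior temperature gives both enclosures the same side
  conditions \<theta> \<le> r and l \<le> \<theta>.\<close>

sublocale inner: enclosure "I\<^sub>\<Sigma> D" "\<lambda>\<alpha>. area (\<zeta> D \<alpha>)" "\<Lambda>\<^sub>\<Sigma> D" "\<lambda>_. 0"
  "emissivity D" "boltzmann D" "\<theta>ext D"
  by standard (use finite_elements area_element_pos \<Lambda>\<^sub>\<Sigma>_nonneg \<Lambda>\<^sub>\<Sigma>_sum emissivity_range boltzmann_pos \<theta>ext_pos in auto)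

lemma V\<^sub>\<Gamma>_eq: "V\<^sub>\<Gamma> D u \<alpha> = emissivity D (u \<alpha>) * outer.W u \<alpha>"
proof -
  have G: "G\<^sub>\<Gamma> D u = outer.G u" by (intro ext) (simp add: G\<^sub>\<Gamma>_def outer.G_def)
  have "R\<^sub>\<Gamma> D u = outer.R u"
    by (intro ext) (simp add: R\<^sub>\<Gamma>_def outer.R_def G outer.E_def E_rad_def E_ph_def)
  then show ?thesis by (simp add: V\<^sub>\<Gamma>_def outer.W_def algebra_simps)
qed

lemma V\<^sub>\<Sigma>_eq: "V\<^sub>\<Sigma> D u \<alpha> = emissivity D (u \<alpha>) * inner.W u \<alpha>"
proof -
  have G: "G\<^sub>\<Sigma> D u = inner.G u" by (intro ext) (simp add: G\<^sub>\<Sigma>_def inner.G_def)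
  have "R\<^sub>\<Sigma> D u = inner.R u"
    by (intro ext) (simp add: R\<^sub>\<Sigma>_def inner.R_def G inner.E_def E_rad_def)
  then show ?thesis by (simp add: V\<^sub>\<Sigma>_def inner.W_def)
qed

definition irradiation :: "('i \<Rightarrow> real) \<Rightarrow> 'i \<Rightarrow> real" where
  "irradiation u i = (\<Sum>\<alpha>\<in>J\<^sub>\<Omega> D i. outer.W (\<lambda>\<beta>. u (cell\<^sub>\<Omega> D \<beta>)) \<alpha>)
     + (\<Sum>\<alpha>\<in>J\<^sub>\<Sigma> D i. inner.W (\<lambda>\<beta>. u (cell\<^sub>\<Sigma> D \<beta>)) \<alpha>)"

text \<open>The scheme operator with the own unknown \<open>s\<close> of cell \<open>i\<close> separated from the values
  \<open>v\<close> entering through conduction and irradiation.\<close>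

definition residual :: "nat \<Rightarrow> ('i \<Rightarrow> real) \<Rightarrow> 'i \<Rightarrow> real \<Rightarrow> ('i \<Rightarrow> real) \<Rightarrow> real" where
  "residual \<nu> w i s v =
     inverse (step_size D \<nu>)
       * (\<Sum>p\<in>{Solid, Gas}. (energy D p s - energy D p (w i)) * volume (\<omega>\<^sub>m D p i))
   + (\<Sum>p\<in>{Solid, Gas}. \<Sum>j\<in>nb\<^sub>m D p i. conductance D i p j * (s - v j))
   + emissivity D s * (boltzmann D * s ^ 4 * radiating_area D i - irradiation v i)
   + boltzmann D * outer_area D i * (emissivity D s * s ^ 4 - emissivity D s * \<theta>ext D ^ 4)
   - (\<Sum>p\<in>{Solid, Gas}. source_approx D p \<nu> i * volume (\<omega>\<^sub>m D p i))"

lemma J\<^sub>\<Omega>_subset: "J\<^sub>\<Omega> D i \<subseteq> I\<^sub>\<Omega> D" and J\<^sub>\<Sigma>_subset: "J\<^sub>\<Sigma> D i \<subseteq> I\<^sub>\<Sigma> D"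
  by (auto simp: J\<^sub>\<Omega>_def J\<^sub>\<Sigma>_def)

text \<open>Each element of the two sums belongs to cell \<open>i\<close> and has temperature u i,
  so its emissivity can be pulled out of all absorption terms. In the residual this factor goes with
  the own variable \<open>s\<close>, while the irradiation keeps the values
  \<open>v\<close>.\<close>

lemma \<H>_eq_residual:
  assumes i: "i \<in> cells D"
  shows "\<H> D \<nu> i w u = residual \<nu> w i (u i) u"
proof -
  have "(\<Sum>\<alpha>\<in>J\<^sub>\<Omega> D i. V\<^sub>\<Gamma> D (\<lambda>\<beta>. u (cell\<^sub>\<Omega> D \<beta>)) \<alpha>)
      = emissivity D (u i) * (\<Sum>\<alpha>\<in>J\<^sub>\<Omega> D i. outer.W (\<lambda>\<beta>. u (cell\<^sub>\<Omega> D \<beta>)) \<alpha>)"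
    unfolding sum_distrib_left V\<^sub>\<Gamma>_eq using cell\<^sub>\<Omega>_eq[OF i] by (intro sum.cong) auto
  moreover have "(\<Sum>\<alpha>\<in>J\<^sub>\<Sigma> D i. V\<^sub>\<Sigma> D (\<lambda>\<beta>. u (cell\<^sub>\<Sigma> D \<beta>)) \<alpha>)
      = emissivity D (u i) * (\<Sum>\<alpha>\<in>J\<^sub>\<Sigma> D i. inner.W (\<lambda>\<beta>. u (cell\<^sub>\<Sigma> D \<beta>)) \<alpha>)"
    unfolding sum_distrib_left V\<^sub>\<Sigma>_eq using cell\<^sub>\<Sigma>_eq[OF i] by (intro sum.cong) auto
  moreover have "conductivity D p * (\<Sum>j\<in>nb\<^sub>m D p i. (u j - u i) / norm (pt D i - pt D j)
           * area (frontier (\<omega>\<^sub>m D p i) \<inter> frontier (\<omega>\<^sub>m D p j)))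
      = - (\<Sum>j\<in>nb\<^sub>m D p i. conductance D i p j * (u i - u j))" for p
    unfolding sum_distrib_left sum_negf[symmetric]
    by (intro sum.cong) (auto simp: conductance_def algebra_simps diff_divide_distrib)
  ultimately show ?thesis
    by (simp add: \<H>_def residual_def irradiation_def radiating_area_def outer_area_def algebra_simps)
qed

lemma areas_nonneg: "0 \<le> radiating_area D i" "0 \<le> outer_area D i" "0 \<le> conductance D i p j"
  "0 \<le> total_conductance D i"
  using conductivity_nonneg
  by (auto simp: radiating_area_def outer_area_def conductance_def total_conductance_def intro!: sum_nonneg add_nonneg_nonneg)

text \<open>Element areas add up to the radiating area, so the irradiation is bounded by black-body
  emission at the largest temperature, weighted by the same area as the emission term of the
  residual.\<close>

lemma irradiation_upper:
  assumes i: "i \<in> cells D" and u: "\<And>j. j \<in> cells D \<Longrightarrow> 0 \<le> u j \<and> u j \<le> r" and "\<theta>ext D \<le> r"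
  shows "irradiation u i \<le> boltzmann D * r ^ 4 * radiating_area D i"
proof -
  have "irradiation u i \<le> (\<Sum>\<alpha>\<in>J\<^sub>\<Omega> D i. boltzmann D * r ^ 4 * area (\<zeta> D \<alpha>))
      + (\<Sum>\<alpha>\<in>J\<^sub>\<Sigma> D i. boltzmann D * r ^ 4 * area (\<zeta> D \<alpha>))"
    unfolding irradiation_def
    using J\<^sub>\<Omega>_subset J\<^sub>\<Sigma>_subset u cell\<^sub>\<Omega>_props(1) cell\<^sub>\<Sigma>_props(1) assms(3)
    by (intro add_mono sum_mono outer.W_le inner.W_le) blast+
  then show ?thesis
    by (simp add: sum_distrib_left[symmetric] sum_area_J\<^sub>\<Omega>[OF i] sum_area_J\<^sub>\<Sigma>[OF i] radiating_area_def distrib_left)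
qed

lemma irradiation_lower:
  assumes i: "i \<in> cells D" and u: "\<And>j. j \<in> cells D \<Longrightarrow> l \<le> u j" and l: "0 \<le> l" "l \<le> \<theta>ext D"
  shows "boltzmann D * l ^ 4 * radiating_area D i \<le> irradiation u i"
proof -
  have "(\<Sum>\<alpha>\<in>J\<^sub>\<Omega> D i. boltzmann D * l ^ 4 * area (\<zeta> D \<alpha>))
      + (\<Sum>\<alpha>\<in>J\<^sub>\<Sigma> D i. boltzmann D * l ^ 4 * area (\<zeta> D \<alpha>)) \<le> irradiation u i"
    unfolding irradiation_def
    using J\<^sub>\<Omega>_subset J\<^sub>\<Sigma>_subset u cell\<^sub>\<Omega>_props(1) cell\<^sub>\<Sigma>_props(1) l
    by (intro add_mono sum_mono outer.W_ge inner.W_ge) blast+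
  then show ?thesis
    by (simp add: sum_distrib_left[symmetric] sum_area_J\<^sub>\<Omega>[OF i] sum_area_J\<^sub>\<Sigma>[OF i] radiating_area_def distrib_left)
qed

lemma irradiation_Lipschitz:
  assumes i: "i \<in> cells D" and u: "\<And>j. j \<in> cells D \<Longrightarrow> 0 \<le> u j \<and> u j \<le> r"
    and v: "\<And>j. j \<in> cells D \<Longrightarrow> 0 \<le> v j \<and> v j \<le> r" and r: "\<theta>ext D \<le> r"
    and \<delta>: "\<And>j. j \<in> cells D \<Longrightarrow> \<bar>u j - v j\<bar> \<le> \<delta>"
  shows "\<bar>irradiation u i - irradiation v i\<bar> \<le> boltzmann D *
    (4 * r ^ 3 + Lip_const (emissivity D) r * r ^ 4 / min_val (emissivity D) r) * \<delta> * radiating_area D i"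
proof -
  let ?B = "boltzmann D * (4 * r ^ 3 + Lip_const (emissivity D) r * r ^ 4 / min_val (emissivity D) r) * \<delta>"
  have "r \<ge> 0" using r \<theta>ext_pos by linarith
  note facts = emissivity_lip[of _ r] Lip_const_nonneg[OF \<open>r \<ge> 0\<close>] min_val_le[of _ r] min_val_pos[OF \<open>r \<ge> 0\<close>]
  have "\<bar>outer.W (\<lambda>\<beta>. u (cell\<^sub>\<Omega> D \<beta>)) \<alpha> - outer.W (\<lambda>\<beta>. v (cell\<^sub>\<Omega> D \<beta>)) \<alpha>\<bar> \<le> ?B * area (\<zeta> D \<alpha>)"
    if "\<alpha> \<in> J\<^sub>\<Omega> D i" for \<alpha>
    using that J\<^sub>\<Omega>_subset u v \<delta> cell\<^sub>\<Omega>_props(1) r by (intro outer.W_Lipschitz facts) blast+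
  then have "\<bar>\<Sum>\<alpha>\<in>J\<^sub>\<Omega> D i. outer.W (\<lambda>\<beta>. u (cell\<^sub>\<Omega> D \<beta>)) \<alpha> - outer.W (\<lambda>\<beta>. v (cell\<^sub>\<Omega> D \<beta>)) \<alpha>\<bar>
      \<le> (\<Sum>\<alpha>\<in>J\<^sub>\<Omega> D i. ?B * area (\<zeta> D \<alpha>))"
    by (intro order_trans[OF sum_abs] sum_mono)
  moreover have "\<bar>inner.W (\<lambda>\<beta>. u (cell\<^sub>\<Sigma> D \<beta>)) \<alpha> - inner.W (\<lambda>\<beta>. v (cell\<^sub>\<Sigma> D \<beta>)) \<alpha>\<bar> \<le> ?B * area (\<zeta> D \<alpha>)"
    if "\<alpha> \<in> J\<^sub>\<Sigma> D i" for \<alpha>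
    using that J\<^sub>\<Sigma>_subset u v \<delta> cell\<^sub>\<Sigma>_props(1) r by (intro inner.W_Lipschitz facts) blast+
  then have "\<bar>\<Sum>\<alpha>\<in>J\<^sub>\<Sigma> D i. inner.W (\<lambda>\<beta>. u (cell\<^sub>\<Sigma> D \<beta>)) \<alpha> - inner.W (\<lambda>\<beta>. v (cell\<^sub>\<Sigma> D \<beta>)) \<alpha>\<bar>
      \<le> (\<Sum>\<alpha>\<in>J\<^sub>\<Sigma> D i. ?B * area (\<zeta> D \<alpha>))"
    by (intro order_trans[OF sum_abs] sum_mono)
  ultimately have "\<bar>irradiation u i - irradiation v i\<bar>
      \<le> (\<Sum>\<alpha>\<in>J\<^sub>\<Omega> D i. ?B * area (\<zeta> D \<alpha>)) + (\<Sum>\<alpha>\<in>J\<^sub>\<Sigma> D i. ?B * area (\<zeta> D \<alpha>))"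
    unfolding irradiation_def sum_subtractf by linarith
  then show ?thesis
    by (simp only: sum_distrib_left[symmetric] sum_area_J\<^sub>\<Omega>[OF i] sum_area_J\<^sub>\<Sigma>[OF i] radiating_area_def distrib_left)
qed

section \<open>Time levels, sources and the bounds M\<close>

lemma time_less: "\<mu> < \<nu> \<Longrightarrow> \<nu> \<le> N_steps D \<Longrightarrow> time D \<mu> < time D \<nu>"
  using time_mono by (auto simp: strict_mono_on_def)

lemma time_le: "\<mu> \<le> \<nu> \<Longrightarrow> \<nu> \<le> N_steps D \<Longrightarrow> time D \<mu> \<le> time D \<nu>"
  using time_less[of \<mu> \<nu>] by (cases "\<mu> = \<nu>") auto

lemma time_bounds: "\<nu> \<le> N_steps D \<Longrightarrow> 0 \<le> time D \<nu>" "\<nu> \<le> N_steps D \<Longrightarrow> time D \<nu> \<le> T_end D"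
  using time_le[of 0 \<nu>] time_le[of \<nu> "N_steps D"] time_0 time_N by auto

lemma step_size_pos: "\<nu> \<in> {1..N_steps D} \<Longrightarrow> 0 < step_size D \<nu>"
  using time_less[of "\<nu> - 1" \<nu>] by (auto simp: step_size_def)

definition source_bound :: "nat \<Rightarrow> real" where
  "source_bound \<nu> = (\<Sum>p\<in>{Solid, Gas}. Linf_norm ({0<..<time D \<nu>} \<times> \<Omega>\<^sub>m D p) (source D p))"

lemma open_cylinder: "open ({s<..<t::real} \<times> \<Omega>\<^sub>m D p)"
  using open_\<Omega>\<^sub>m by (intro open_Times) auto

lemma source_norm_mono:
  assumes "S \<subseteq> {0<..<time D \<nu>} \<times> \<Omega>\<^sub>m D p" "open S" "\<nu> \<le> N_steps D"
  shows "Linf_norm S (source D p) \<le> Linf_norm ({0<..<time D \<nu>} \<times> \<Omega>\<^sub>m D p) (source D p)"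
    "0 \<le> Linf_norm S (source D p)"
proof -
  have sub: "{0<..<time D \<nu>} \<times> \<Omega>\<^sub>m D p \<subseteq> {0<..<T_end D} \<times> \<Omega>\<^sub>m D p"
    using time_bounds[OF assms(3)] by auto
  have Linf: "source D p \<in> Linf ({0<..<time D \<nu>} \<times> \<Omega>\<^sub>m D p)"
    using sub by (rule Linf_subset) (use source_Linf open_cylinder in auto)
  show "Linf_norm S (source D p) \<le> Linf_norm ({0<..<time D \<nu>} \<times> \<Omega>\<^sub>m D p) (source D p)"
    using assms(1) by (rule Linf_norm_mono) (use assms(2) open_cylinder Linf in auto)
  have "source D p \<in> Linf S"
    using assms(1) by (rule Linf_subset) (use assms(2) open_cylinder Linf in auto)
  then show "0 \<le> Linf_norm S (source D p)" by (auto simp: Linf_def intro: Linf_norm_nonneg)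
qed

lemma source_bound_mono: "\<mu> \<le> \<nu> \<Longrightarrow> \<nu> \<le> N_steps D \<Longrightarrow> source_bound \<mu> \<le> source_bound \<nu>"
  unfolding source_bound_def using time_le[of \<mu> \<nu>]
  by (intro sum_mono source_norm_mono(1)) (auto intro: open_cylinder)

lemma source_bound_nonneg: "\<nu> \<le> N_steps D \<Longrightarrow> 0 \<le> source_bound \<nu>"
  unfolding source_bound_def by (intro sum_nonneg source_norm_mono(2)[OF order_refl]) (auto intro: open_cylinder)

text \<open>Each phase part has at most the volume of the whole cell; this is why the upper bound
  adds the source norms of both phases.\<close>

lemma source_approx_sum:
  assumes \<nu>: "\<nu> \<in> {1..N_steps D}" and i: "i \<in> cells D"
  shows "0 \<le> (\<Sum>p\<in>{Solid, Gas}. source_approx D p \<nu> i * volume (\<omega>\<^sub>m D p i))"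
    "(\<Sum>p\<in>{Solid, Gas}. source_approx D p \<nu> i * volume (\<omega>\<^sub>m D p i)) \<le> source_bound \<nu> * volume (\<omega> D i)"
proof -
  have *: "0 \<le> source_approx D p \<nu> i * volume (\<omega>\<^sub>m D p i) \<and>
      source_approx D p \<nu> i * volume (\<omega>\<^sub>m D p i)
        \<le> Linf_norm ({0<..<time D \<nu>} \<times> \<Omega>\<^sub>m D p) (source D p) * volume (\<omega> D i)" for p
  proof -
    have nn: "0 \<le> Linf_norm ({0<..<time D \<nu>} \<times> \<Omega>\<^sub>m D p) (source D p)"
      using \<nu> by (intro source_norm_mono(2)[OF order_refl]) (auto intro: open_cylinder)
    show ?thesis
    proof (cases "\<omega>\<^sub>m D p i = {}")
      \<comment> \<open>For an empty phase part the approximate source is unrestricted, but its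
        weight is zero.\<close>
      case True
      then show ?thesis using nn by simp
    next
      case False
      then have ip: "i \<in> cells\<^sub>m D p" using i by (simp add: cells\<^sub>m_def)
      have "{time D (\<nu> - 1)<..<time D \<nu>} \<times> \<omega>\<^sub>m D p i \<subseteq> {0<..<time D \<nu>} \<times> \<Omega>\<^sub>m D p"
      proof -
        have "0 \<le> time D (\<nu> - 1)" using \<nu> by (intro time_bounds(1)) auto
        then show ?thesis by (auto simp: \<omega>\<^sub>m_def)
      qed
      then have "Linf_norm ({time D (\<nu> - 1)<..<time D \<nu>} \<times> \<omega>\<^sub>m D p i) (source D p)
          \<le> Linf_norm ({0<..<time D \<nu>} \<times> \<Omega>\<^sub>m D p) (source D p)"
        using \<nu> open_\<omega>\<^sub>m[OF i] by (intro source_norm_mono(1) open_Times) auto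
      moreover have "volume (\<omega>\<^sub>m D p i) \<le> volume (\<omega> D i)"
        unfolding volume_cell[OF i, symmetric] by (cases p) auto
      ultimately show ?thesis
        using source_approx_bounds[OF \<nu> ip] nn by (auto intro!: mult_mono)
    qed
  qed
  show "0 \<le> (\<Sum>p\<in>{Solid, Gas}. source_approx D p \<nu> i * volume (\<omega>\<^sub>m D p i))"
    using * by (intro sum_nonneg) auto
  show "(\<Sum>p\<in>{Solid, Gas}. source_approx D p \<nu> i * volume (\<omega>\<^sub>m D p i)) \<le> source_bound \<nu> * volume (\<omega> D i)"
    unfolding source_bound_def sum_distrib_right using * by (intro sum_mono) auto
qed

text \<open>The source norms up to the previous time level are at most those up to level \<nu>, and
  t_(\<nu>-1) + k_\<nu> = t_\<nu>. So the bound grows by at least what the sources can deliver in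
  one step.\<close>

lemma upper_bound_step:
  assumes \<nu>: "\<nu> \<in> {1..N_steps D}"
  shows "upper_bound D (\<nu> - 1) + step_size D \<nu> * source_bound \<nu> / C_energy D \<le> upper_bound D \<nu>"
proof -
  have "time D (\<nu> - 1) * source_bound (\<nu> - 1) \<le> time D (\<nu> - 1) * source_bound \<nu>"
    using \<nu> time_bounds(1)[of "\<nu> - 1"] by (intro mult_left_mono source_bound_mono) auto
  then have "time D (\<nu> - 1) * source_bound (\<nu> - 1) + step_size D \<nu> * source_bound \<nu> \<le> time D \<nu> * source_bound \<nu>"
    by (simp add: step_size_def algebra_simps)
  then have "(time D (\<nu> - 1) * source_bound (\<nu> - 1) + step_size D \<nu> * source_bound \<nu>) / C_energy D
      \<le> time D \<nu> * source_bound \<nu> / C_energy D"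
    using C_energy_pos by (intro divide_right_mono) auto
  then show ?thesis by (simp add: upper_bound_def source_bound_def[symmetric] add_divide_distrib del: sum.insert)
qed

lemma upper_bound_mono: "\<mu> \<le> \<nu> \<Longrightarrow> \<nu> \<le> N_steps D \<Longrightarrow> upper_bound D \<mu> \<le> upper_bound D \<nu>"
  unfolding upper_bound_def source_bound_def[symmetric]
  using time_le[of \<mu> \<nu>] time_bounds(1)[of \<nu>] source_bound_mono[of \<mu> \<nu>] source_bound_nonneg[of \<mu>] C_energy_pos
  by (intro add_left_mono mult_mono divide_right_mono) auto

lemma \<theta>ext_le_upper: "\<nu> \<le> N_steps D \<Longrightarrow> \<theta>ext D \<le> upper_bound D \<nu>"
  unfolding upper_bound_def source_bound_def[symmetric]
  using source_bound_nonneg[of \<nu>] time_bounds(1)[of \<nu>] C_energy_pos by (simp add: add_increasing2)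

lemma lower_le_\<theta>ext: "lower_bound D \<le> \<theta>ext D"
  by (simp add: lower_bound_def)

lemma init_bounds:
  assumes i: "i \<in> cells D"
  shows "lower_bound D \<le> init_approx D i" "init_approx D i \<le> upper_bound D 0" "0 \<le> lower_bound D"
proof -
  have S: "\<omega> D i \<subseteq> \<Omega> D" "\<omega> D i \<in> sets lebesgue" "\<Omega> D \<in> sets lebesgue"
    using cell_subset[OF i] open_cell[OF i] open_\<Omega> by auto
  have "emeasure lebesgue (\<omega> D i) \<noteq> 0"
    using volume_cell_pos[OF i] open_cell[OF i] by (auto simp: measure_def)
  note ess_inf_antimono[OF S \<theta>init_Linf this \<theta>init_pos]
  then show "lower_bound D \<le> init_approx D i" "0 \<le> lower_bound D"
    using init_approx_bounds[OF i] \<theta>ext_pos by (auto simp: lower_bound_def)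
  show "init_approx D i \<le> upper_bound D 0"
  proof -
    have "init_approx D i \<le> Linf_norm (\<Omega> D) (\<theta>init D)"
      using init_approx_bounds[OF i] Linf_norm_mono[OF S \<theta>init_Linf] by linarith
    then show ?thesis using time_0 by (simp add: upper_bound_def)
  qed
qed

lemma lower_bound_nonneg: "0 \<le> lower_bound D"
  using cells_nonempty init_bounds(3) by blast

section \<open>Sign, slope and Lipschitz estimates for the residual\<close>

lemma energy_sum_growth:
  assumes i: "i \<in> cells D" and "0 \<le> s" "s \<le> t"
  shows "C_energy D * (t - s) * volume (\<omega> D i)
    \<le> (\<Sum>p\<in>{Solid, Gas}. (energy D p t - energy D p s) * volume (\<omega>\<^sub>m D p i))"
  unfolding volume_cell[OF i, symmetric] sum_distrib_left
proof (rule sum_mono)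
  fix p
  show "C_energy D * (t - s) * volume (\<omega>\<^sub>m D p i) \<le> (energy D p t - energy D p s) * volume (\<omega>\<^sub>m D p i)"
    using energy_growth[OF assms(2,3), of p] by (intro mult_right_mono) (auto simp: algebra_simps)
qed

lemma nb\<^sub>m_subset: "nb\<^sub>m D p i \<subseteq> cells D"
  by (auto simp: nb\<^sub>m_def cells\<^sub>m_def)

text \<open>If no value exceeds s \<ge> M_\<nu>, conduction, exchange and exterior radiation have
  nonnegative sign, and the energy growth from w i to M_\<nu> already pays for the sources. The
  surplus excludes a zero for s > M_\<nu>; at s = M_\<nu> the sign serves the intermediate value
  argument.\<close>

lemma residual_above:
  assumes \<nu>: "\<nu> \<in> {1..N_steps D}" and i: "i \<in> cells D"
    and w: "0 \<le> w i" "w i \<le> upper_bound D (\<nu> - 1)" and s: "upper_bound D \<nu> \<le> s"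
    and v: "\<And>j. j \<in> cells D \<Longrightarrow> 0 \<le> v j \<and> v j \<le> s"
  shows "inverse (step_size D \<nu>) * C_energy D * (s - upper_bound D \<nu>) * volume (\<omega> D i) \<le> residual \<nu> w i s v"
proof -
  let ?k = "step_size D \<nu>" and ?C = "C_energy D" and ?vol = "volume (\<omega> D i)"
  have k: "0 < ?k" by (rule step_size_pos[OF \<nu>])
  have \<theta>: "\<theta>ext D \<le> s" using \<theta>ext_le_upper[of \<nu>] \<nu> s by auto
  have s0: "0 < s" using \<theta> \<theta>ext_pos by linarith
  have e: "0 < emissivity D s" using emissivity_range[of s] s0 by auto
  have ws: "w i \<le> s" using w(2) s upper_bound_mono[of "\<nu> - 1" \<nu>] \<nu> by auto
  have "inverse ?k * (?C * (s - w i) * ?vol)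
      \<le> inverse ?k * (\<Sum>p\<in>{Solid, Gas}. (energy D p s - energy D p (w i)) * volume (\<omega>\<^sub>m D p i))"
    using k by (intro mult_left_mono energy_sum_growth[OF i w(1) ws]) auto
  moreover have "inverse ?k * ?C * (s - upper_bound D \<nu>) * ?vol + source_bound \<nu> * ?vol \<le> inverse ?k * (?C * (s - w i) * ?vol)"
  proof -
    have "?k * source_bound \<nu> / ?C \<le> upper_bound D \<nu> - w i" using upper_bound_step[OF \<nu>] w(2) by linarith
    then have "?k * source_bound \<nu> \<le> ?C * (upper_bound D \<nu> - w i)"
      using C_energy_pos by (simp add: divide_le_eq mult.commute)
    then have "source_bound \<nu> \<le> inverse ?k * ?C * (upper_bound D \<nu> - w i)"
      using k by (simp add: field_simps)
    then have "source_bound \<nu> * ?vol \<le> inverse ?k * ?C * (upper_bound D \<nu> - w i) * ?vol"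
      using volume_cell_pos[OF i] by (intro mult_right_mono) auto
    then show ?thesis by (simp add: algebra_simps)
  qed
  moreover have "0 \<le> (\<Sum>p\<in>{Solid, Gas}. \<Sum>j\<in>nb\<^sub>m D p i. conductance D i p j * (s - v j))"
    using v nb\<^sub>m_subset areas_nonneg(3) by (intro sum_nonneg mult_nonneg_nonneg) auto
  moreover have "0 \<le> emissivity D s * (boltzmann D * s ^ 4 * radiating_area D i - irradiation v i)"
    using e irradiation_upper[OF i v \<theta>] by simp
  moreover have "0 \<le> boltzmann D * outer_area D i * (emissivity D s * s ^ 4 - emissivity D s * \<theta>ext D ^ 4)"
    using boltzmann_pos areas_nonneg(2) e \<theta> \<theta>ext_pos
    by (intro mult_nonneg_nonneg) (auto intro!: mult_left_mono power_mono)
  ultimately show ?thesis using source_approx_sum(2)[OF \<nu> i] unfolding residual_def by linarith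
qed

text \<open>Mirror image at a value not exceeding \<theta>ext, the old value or any of the others.
  Sources are nonnegative and call for no compensation, so the lower bound stays the same at all
  time levels.\<close>

lemma residual_below:
  assumes \<nu>: "\<nu> \<in> {1..N_steps D}" and i: "i \<in> cells D"
    and s: "0 \<le> s" "s \<le> \<theta>ext D" "s \<le> w i" and v: "\<And>j. j \<in> cells D \<Longrightarrow> s \<le> v j"
  shows "residual \<nu> w i s v \<le> - (inverse (step_size D \<nu>) * C_energy D * (w i - s) * volume (\<omega> D i))"
proof -
  let ?k = "step_size D \<nu>" and ?C = "C_energy D" and ?vol = "volume (\<omega> D i)"
  have k: "0 < ?k" by (rule step_size_pos[OF \<nu>])
  have e: "0 < emissivity D s" using emissivity_range[of s] s by auto
  have "inverse ?k * (?C * (w i - s) * ?vol)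
      \<le> inverse ?k * (\<Sum>p\<in>{Solid, Gas}. (energy D p (w i) - energy D p s) * volume (\<omega>\<^sub>m D p i))"
    using k by (intro mult_left_mono energy_sum_growth[OF i s(1,3)]) auto
  also have "(\<Sum>p\<in>{Solid, Gas}. (energy D p (w i) - energy D p s) * volume (\<omega>\<^sub>m D p i))
      = - (\<Sum>p\<in>{Solid, Gas}. (energy D p s - energy D p (w i)) * volume (\<omega>\<^sub>m D p i))"
    by (simp add: algebra_simps)
  finally have "inverse ?k * (\<Sum>p\<in>{Solid, Gas}. (energy D p s - energy D p (w i)) * volume (\<omega>\<^sub>m D p i))
      \<le> - (inverse ?k * ?C * (w i - s) * ?vol)"
    by (simp only: mult_minus_right mult.assoc)
  moreover have "(\<Sum>p\<in>{Solid, Gas}. \<Sum>j\<in>nb\<^sub>m D p i. conductance D i p j * (s - v j)) \<le> 0"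
    using v nb\<^sub>m_subset areas_nonneg(3) by (intro sum_nonpos mult_nonneg_nonpos) auto
  moreover have "emissivity D s * (boltzmann D * s ^ 4 * radiating_area D i - irradiation v i) \<le> 0"
    using e irradiation_lower[OF i v s(1,2)] by (simp add: mult_le_0_iff)
  moreover have "boltzmann D * outer_area D i * (emissivity D s * s ^ 4 - emissivity D s * \<theta>ext D ^ 4) \<le> 0"
    using boltzmann_pos areas_nonneg(2) e s
    by (intro mult_nonneg_nonpos) (auto intro!: mult_left_mono power_mono)
  ultimately show ?thesis using source_approx_sum(1)[OF \<nu> i] unfolding residual_def by linarith
qed

text \<open>Conduction and energy only help; every loss comes from the varying emissivity. It
  multiplies s^4 and an irradiation between 0 and \<sigma> r^4 times the area, which gives 2 L r^4;
  at the outer boundary \<theta>ext^4 takes the place of the irradiation.\<close>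

lemma residual_slope:
  assumes \<nu>: "\<nu> \<in> {1..N_steps D}" and i: "i \<in> cells D" and r: "\<theta>ext D \<le> r"
    and v: "\<And>j. j \<in> cells D \<Longrightarrow> 0 \<le> v j \<and> v j \<le> r" and st: "0 \<le> s" "s \<le> t" "t \<le> r"
  defines "L \<equiv> Lip_const (emissivity D) r"
  shows "(total_conductance D i + (inverse (step_size D \<nu>) * C_energy D * volume (\<omega> D i)
      - boltzmann D * radiating_area D i * (2 * L * r ^ 4)
      - boltzmann D * outer_area D i * (L * r ^ 4 + L * \<theta>ext D ^ 4))) * (t - s)
    \<le> residual \<nu> w i t v - residual \<nu> w i s v"
proof -
  let ?k = "step_size D \<nu>" and ?C = "C_energy D" and ?vol = "volume (\<omega> D i)" and ?e = "emissivity D"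
  have k: "0 < ?k" by (rule step_size_pos[OF \<nu>])
  have e: "0 \<le> ?e t" using emissivity_range[of t] st by auto
  have L: "\<bar>?e t - ?e s\<bar> \<le> L * (t - s)" using emissivity_lip[of t r s] st by (simp add: L_def)
  have L0: "0 \<le> L" unfolding L_def using r \<theta>ext_pos by (intro Lip_const_nonneg) auto
  have 1: "inverse ?k * (?C * (t - s) * ?vol)
      \<le> inverse ?k * (\<Sum>p\<in>{Solid, Gas}. (energy D p t - energy D p (w i)) * volume (\<omega>\<^sub>m D p i))
      - inverse ?k * (\<Sum>p\<in>{Solid, Gas}. (energy D p s - energy D p (w i)) * volume (\<omega>\<^sub>m D p i))"
  proof -
    have "inverse ?k * (?C * (t - s) * ?vol)
        \<le> inverse ?k * (\<Sum>p\<in>{Solid, Gas}. (energy D p t - energy D p s) * volume (\<omega>\<^sub>m D p i))"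
      using k by (intro mult_left_mono energy_sum_growth[OF i st(1,2)]) auto
    then show ?thesis by (simp add: algebra_simps)
  qed
  have 2: "(\<Sum>p\<in>{Solid, Gas}. \<Sum>j\<in>nb\<^sub>m D p i. conductance D i p j * (t - v j))
      - (\<Sum>p\<in>{Solid, Gas}. \<Sum>j\<in>nb\<^sub>m D p i. conductance D i p j * (s - v j)) = total_conductance D i * (t - s)"
    unfolding total_conductance_def sum_subtractf[symmetric] sum_distrib_right
    by (intro sum.cong refl) (simp add: algebra_simps)
  have pw: "- (L * r ^ 4) * (t - s) \<le> ?e t * t ^ 4 - ?e s * s ^ 4"
    by (rule power4_weighted_diff_ge[OF st e L])
  have 3: "- (boltzmann D * radiating_area D i * (2 * L * r ^ 4)) * (t - s)
      \<le> ?e t * (boltzmann D * t ^ 4 * radiating_area D i - irradiation v i)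
      - ?e s * (boltzmann D * s ^ 4 * radiating_area D i - irradiation v i)"
  proof -
    have "boltzmann D * radiating_area D i * (- (L * r ^ 4) * (t - s))
        \<le> boltzmann D * radiating_area D i * (?e t * t ^ 4 - ?e s * s ^ 4)"
      using boltzmann_pos areas_nonneg(1) by (intro mult_left_mono[OF pw]) auto
    moreover have "(?e t - ?e s) * irradiation v i \<le> L * (t - s) * (boltzmann D * r ^ 4 * radiating_area D i)"
    proof -
      have "0 \<le> irradiation v i" using irradiation_lower[OF i, of 0 v] v \<theta>ext_pos by simp
      moreover have "irradiation v i \<le> boltzmann D * r ^ 4 * radiating_area D i" by (rule irradiation_upper[OF i v r])
      moreover have "?e t - ?e s \<le> L * (t - s)" "0 \<le> L * (t - s)" using L by linarith+
      ultimately show ?thesis by (intro mult_mono) auto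
    qed
    ultimately show ?thesis by (simp add: algebra_simps)
  qed
  have 4: "- (boltzmann D * outer_area D i * (L * r ^ 4 + L * \<theta>ext D ^ 4)) * (t - s)
      \<le> boltzmann D * outer_area D i * (?e t * t ^ 4 - ?e t * \<theta>ext D ^ 4)
      - boltzmann D * outer_area D i * (?e s * s ^ 4 - ?e s * \<theta>ext D ^ 4)"
  proof -
    have "(?e t - ?e s) * \<theta>ext D ^ 4 \<le> L * (t - s) * \<theta>ext D ^ 4"
      using L \<theta>ext_pos by (intro mult_right_mono) auto
    then have "- (L * r ^ 4) * (t - s) - L * (t - s) * \<theta>ext D ^ 4
        \<le> (?e t * t ^ 4 - ?e s * s ^ 4) - (?e t - ?e s) * \<theta>ext D ^ 4" using pw by linarith
    then have "boltzmann D * outer_area D i * (- (L * r ^ 4) * (t - s) - L * (t - s) * \<theta>ext D ^ 4)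
        \<le> boltzmann D * outer_area D i * ((?e t * t ^ 4 - ?e s * s ^ 4) - (?e t - ?e s) * \<theta>ext D ^ 4)"
      using boltzmann_pos areas_nonneg(2) by (intro mult_left_mono) auto
    then show ?thesis by (simp add: algebra_simps)
  qed
  have "(total_conductance D i + (inverse ?k * ?C * ?vol
      - boltzmann D * radiating_area D i * (2 * L * r ^ 4)
      - boltzmann D * outer_area D i * (L * r ^ 4 + L * \<theta>ext D ^ 4))) * (t - s)
    = inverse ?k * (?C * (t - s) * ?vol) + total_conductance D i * (t - s)
      + - (boltzmann D * radiating_area D i * (2 * L * r ^ 4)) * (t - s)
      + - (boltzmann D * outer_area D i * (L * r ^ 4 + L * \<theta>ext D ^ 4)) * (t - s)"
    by (simp add: algebra_simps)
  then show ?thesis using 1 2 3 4 unfolding residual_def by linarith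
qed

text \<open>The values \<open>v\<close> occur only in conduction and irradiation, so all other terms
  cancel; the emissivity in front of the irradiation is at most 1.\<close>

lemma residual_Lipschitz:
  assumes i: "i \<in> cells D" and r: "\<theta>ext D \<le> r" and s: "s \<in> {0..r}"
    and u: "\<And>j. j \<in> cells D \<Longrightarrow> 0 \<le> u j \<and> u j \<le> r" and v: "\<And>j. j \<in> cells D \<Longrightarrow> 0 \<le> v j \<and> v j \<le> r"
    and \<delta>: "\<And>j. j \<in> cells D \<Longrightarrow> \<bar>u j - v j\<bar> \<le> \<delta>"
  shows "\<bar>residual \<nu> w i s u - residual \<nu> w i s v\<bar> \<le> (total_conductance D i + boltzmann D * radiating_area D i *
    (4 * r ^ 3 + Lip_const (emissivity D) r * r ^ 4 / min_val (emissivity D) r)) * \<delta>"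
proof -
  let ?B = "boltzmann D * radiating_area D i *
    (4 * r ^ 3 + Lip_const (emissivity D) r * r ^ 4 / min_val (emissivity D) r) * \<delta>"
  have "\<bar>\<Sum>p\<in>{Solid, Gas}. \<Sum>j\<in>nb\<^sub>m D p i. conductance D i p j * (v j - u j)\<bar>
      \<le> (\<Sum>p\<in>{Solid, Gas}. \<Sum>j\<in>nb\<^sub>m D p i. conductance D i p j * \<delta>)"
  proof (rule order_trans[OF sum_abs], rule sum_mono, rule order_trans[OF sum_abs], rule sum_mono)
    fix p j assume "j \<in> nb\<^sub>m D p i"
    then have "\<bar>v j - u j\<bar> \<le> \<delta>" using \<delta>[of j] nb\<^sub>m_subset by (metis abs_minus_commute subsetD)
    then show "\<bar>conductance D i p j * (v j - u j)\<bar> \<le> conductance D i p j * \<delta>"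
      using areas_nonneg(3)[of i p j] by (simp add: abs_mult mult_left_mono)
  qed
  also have "\<dots> = total_conductance D i * \<delta>"
    unfolding total_conductance_def sum_distrib_right ..
  finally have 1: "\<bar>\<Sum>p\<in>{Solid, Gas}. \<Sum>j\<in>nb\<^sub>m D p i. conductance D i p j * (v j - u j)\<bar> \<le> total_conductance D i * \<delta>" .
  have "\<bar>emissivity D s * (irradiation v i - irradiation u i)\<bar> \<le> 1 * \<bar>irradiation u i - irradiation v i\<bar>"
    unfolding abs_mult using emissivity_range[of s] s by (intro mult_mono) auto
  also have "\<dots> \<le> ?B" using irradiation_Lipschitz[OF i u v r \<delta>] by (simp add: algebra_simps)
  finally have 2: "\<bar>emissivity D s * (irradiation v i - irradiation u i)\<bar> \<le> ?B" .
  have "residual \<nu> w i s u - residual \<nu> w i s v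
      = (\<Sum>p\<in>{Solid, Gas}. \<Sum>j\<in>nb\<^sub>m D p i. conductance D i p j * (v j - u j))
      + emissivity D s * (irradiation v i - irradiation u i)"
  proof -
    have "(\<Sum>p\<in>{Solid, Gas}. \<Sum>j\<in>nb\<^sub>m D p i. conductance D i p j * (s - u j))
        - (\<Sum>p\<in>{Solid, Gas}. \<Sum>j\<in>nb\<^sub>m D p i. conductance D i p j * (s - v j))
        = (\<Sum>p\<in>{Solid, Gas}. \<Sum>j\<in>nb\<^sub>m D p i. conductance D i p j * (v j - u j))"
      unfolding sum_subtractf[symmetric] by (intro sum.cong refl) (simp add: algebra_simps)
    then show ?thesis unfolding residual_def by (simp add: right_diff_distrib)
  qed
  then show ?thesis using 1 2 by (simp add: distrib_right)
qed

lemma residual_continuous: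
  assumes "0 \<le> l"
  shows "continuous_on {l..r} (\<lambda>s. residual \<nu> w i s v)"
proof -
  have "continuous_on {l..r} (energy D p)" for p
    using energy_continuous by (rule continuous_on_subset) (use assms in auto)
  moreover have "continuous_on {l..r} (emissivity D)"
    using emissivity_continuous by (rule continuous_on_subset) (use assms in auto)
  ultimately show ?thesis unfolding residual_def by (intro continuous_intros)
qed

section \<open>The step size condition\<close>

lemma max_ratio_ge:
  assumes "i \<in> cells D"
  shows "boltzmann D * X i \<le> boltzmann D * (MAX i\<in>cells D. X i / volume (\<omega> D i)) * volume (\<omega> D i)"
proof -
  have "X i / volume (\<omega> D i) \<le> (MAX i\<in>cells D. X i / volume (\<omega> D i))"
    using finite_cells assms by (intro Max_ge) auto
  then have "X i \<le> (MAX i\<in>cells D. X i / volume (\<omega> D i)) * volume (\<omega> D i)"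
    using volume_cell_pos[OF assms] by (simp add: divide_le_eq)
  then show ?thesis using boltzmann_pos by (simp add: mult.assoc)
qed

lemma LV_bounds:
  assumes i: "i \<in> cells D"
  shows "boltzmann D * radiating_area D i \<le> (LV_\<Gamma>\<^sub>\<Omega> D + LV_\<Sigma> D) * volume (\<omega> D i)"
    "boltzmann D * outer_area D i \<le> LV_outer D * volume (\<omega> D i)"
  using max_ratio_ge[OF i, of "\<lambda>i. area (frontier (\<omega>\<^sub>m D Solid i) \<inter> \<Gamma>\<^sub>\<Omega> D)"]
    max_ratio_ge[OF i, of "\<lambda>i. area (\<omega> D i \<inter> \<Sigma> D)"] max_ratio_ge[OF i, of "outer_area D"]
  by (simp_all add: LV_\<Gamma>\<^sub>\<Omega>_def LV_\<Sigma>_def LV_outer_def radiating_area_def outer_area_def distrib_left distrib_right)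

lemma LV_nonneg: "0 \<le> LV_\<Gamma>\<^sub>\<Omega> D" "0 \<le> LV_\<Sigma> D" "0 \<le> LV_outer D"
proof -
  have "0 \<le> boltzmann D * (MAX i\<in>cells D. X i / volume (\<omega> D i))" if X: "\<And>i. 0 \<le> X i" for X
  proof -
    obtain i where i: "i \<in> cells D" using cells_nonempty by blast
    have "0 \<le> X i / volume (\<omega> D i)" using X by simp
    also have "\<dots> \<le> (MAX i\<in>cells D. X i / volume (\<omega> D i))"
      using finite_cells i by (intro Max_ge) auto
    finally show ?thesis using boltzmann_pos by simp
  qed
  then show "0 \<le> LV_\<Gamma>\<^sub>\<Omega> D" "0 \<le> LV_\<Sigma> D" "0 \<le> LV_outer D"
    by (simp_all add: LV_\<Gamma>\<^sub>\<Omega>_def LV_\<Sigma>_def LV_outer_def)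
qed

lemma lg_nonneg:
  assumes "0 \<le> r"
  shows "0 \<le> lg1 D r" "0 \<le> lg2 D r" "0 \<le> lg3 D r"
proof -
  have "0 \<le> max (r ^ 4) (\<theta>ext D ^ 4)" by (simp add: le_max_iff_disj)
  then show "0 \<le> lg1 D r" "0 \<le> lg2 D r" "0 \<le> lg3 D r"
    using assms neg_variation_nonneg[OF assms] Lip_const_nonneg[OF assms] min_val_pos[OF assms] \<theta>ext_pos
    by (simp_all add: lg1_def lg2_def lg3_def)
qed

lemma step_factor_nonneg: "0 \<le> r \<Longrightarrow> 0 \<le> step_factor D r"
  using lg_nonneg[of r] LV_nonneg by (simp add: step_factor_def)

text \<open>Enlarging the temperature range raises the suprema and lowers the minimum of the
  emissivity, whose inverse therefore grows.\<close>

lemma step_factor_mono: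
  assumes "0 < r" "r \<le> r'"
  shows "step_factor D r \<le> step_factor D r'"
proof -
  have r': "0 < r'" using assms by linarith
  note L = Lip_const_mono[OF assms] Lip_const_nonneg[of r]
  have p: "r ^ 3 \<le> r' ^ 3" "r ^ 4 \<le> r' ^ 4" using assms by (auto intro!: power_mono)
  have m: "inverse (min_val (emissivity D) r) \<le> inverse (min_val (emissivity D) r')"
    "0 \<le> inverse (min_val (emissivity D) r)"
    "0 \<le> min_val (emissivity D) r" "0 \<le> min_val (emissivity D) r'"
    using min_val_antimono[of r r'] min_val_pos[of r] min_val_pos[of r'] assms r' by (auto intro!: le_imp_inverse_le)
  have "lg1 D r \<le> lg1 D r'" unfolding lg1_def
    using p L neg_variation_mono[OF assms] neg_variation_nonneg[of r] Lip_const_nonneg[of r] assms r'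
    by (intro add_mono mult_mono) auto
  moreover have "lg2 D r \<le> lg2 D r'" unfolding lg2_def
    using p m L Lip_const_nonneg[of r'] assms r' \<theta>ext_pos
    by (intro add_mono mult_mono) (auto intro: max.mono simp: le_max_iff_disj)
  moreover have "lg3 D r \<le> lg3 D r'" unfolding lg3_def using L by (intro mult_right_mono) auto
  ultimately show ?thesis unfolding step_factor_def using LV_nonneg
    by (intro add_mono mult_left_mono) auto
qed

text \<open>Of the slope losses 2 L r^4 one copy is charged to \<open>lg1\<close>, the other to the
  summand 1 in the last factor of \<open>lg2\<close>; the Lipschitz constant of the irradiation fits
  into the rest of \<open>lg2\<close>. The maxima in the geometric constants convert areas into
  multiples of the cell volume.\<close>

lemma step_condition:
  assumes \<nu>: "\<nu> \<in> {1..N_steps D}" and i: "i \<in> cells D" and r: "\<theta>ext D \<le> r"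
    and small: "step_size D \<nu> * step_factor D r < C_energy D"
  defines "L \<equiv> Lip_const (emissivity D) r"
  shows "boltzmann D * radiating_area D i * (4 * r ^ 3 + L * r ^ 4 / min_val (emissivity D) r)
    < inverse (step_size D \<nu>) * C_energy D * volume (\<omega> D i)
      - boltzmann D * radiating_area D i * (2 * L * r ^ 4)
      - boltzmann D * outer_area D i * (L * r ^ 4 + L * \<theta>ext D ^ 4)"
proof -
  let ?vol = "volume (\<omega> D i)" and ?m = "inverse (min_val (emissivity D) r)"
  have r0: "0 < r" using r \<theta>ext_pos by linarith
  have L: "0 \<le> L" unfolding L_def using r0 by (intro Lip_const_nonneg) auto
  have k: "0 < step_size D \<nu>" by (rule step_size_pos[OF \<nu>])
  have m0: "0 \<le> ?m" using min_val_pos[of r] r0 by simp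
  have m: "1 \<le> ?m" using min_val_pos[of r] min_val_le_1[of r] r0 by (simp add: one_le_inverse)
  have mx: "max (r ^ 4) (\<theta>ext D ^ 4) = r ^ 4" using r \<theta>ext_pos by (intro max_absorb1 power_mono) auto
  have lg1: "L * r ^ 4 \<le> lg1 D r"
    unfolding lg1_def L_def using neg_variation_nonneg[of r] r0 by simp
  have lg2: "4 * r ^ 3 + L * r ^ 4 * ?m + L * r ^ 4 \<le> lg2 D r"
  proof -
    \<comment> \<open>As the minimal emissivity is at most 1, the term 4 r^3 fits under its
      counterpart in \<open>lg2\<close>.\<close>
    have "1 * (4 * r ^ 3) \<le> ?m * (4 * r ^ 3)" using m r0 by (intro mult_right_mono) auto
    moreover have "0 \<le> L * r ^ 4 * ?m" using L m0 by (intro mult_nonneg_nonneg) auto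
    moreover have "lg2 D r = ?m * (4 * r ^ 3) + 2 * (L * r ^ 4 * ?m) + L * r ^ 4"
      unfolding lg2_def mx L_def by (simp add: algebra_simps)
    ultimately show ?thesis by linarith
  qed
  have "boltzmann D * radiating_area D i * (4 * r ^ 3 + L * r ^ 4 * ?m + L * r ^ 4 + L * r ^ 4)
      \<le> (LV_\<Gamma>\<^sub>\<Omega> D + LV_\<Sigma> D) * ?vol * (lg2 D r + lg1 D r)"
  proof (rule mult_mono[OF LV_bounds(1)[OF i]])
    show "4 * r ^ 3 + L * r ^ 4 * ?m + L * r ^ 4 + L * r ^ 4 \<le> lg2 D r + lg1 D r" using lg1 lg2 by linarith
    show "0 \<le> (LV_\<Gamma>\<^sub>\<Omega> D + LV_\<Sigma> D) * ?vol" using LV_nonneg by simp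
    have "0 \<le> L * r ^ 4 * ?m" using L m0 by (intro mult_nonneg_nonneg) auto
    then show "0 \<le> 4 * r ^ 3 + L * r ^ 4 * ?m + L * r ^ 4 + L * r ^ 4" using L r0 by simp
  qed
  moreover have "boltzmann D * outer_area D i * (L * r ^ 4 + L * \<theta>ext D ^ 4)
      \<le> LV_outer D * ?vol * (lg1 D r + lg3 D r)"
  proof (rule mult_mono[OF LV_bounds(2)[OF i]])
    show "L * r ^ 4 + L * \<theta>ext D ^ 4 \<le> lg1 D r + lg3 D r" using lg1 by (simp add: lg3_def L_def)
  qed (use LV_nonneg L in auto)
  moreover have "(LV_\<Gamma>\<^sub>\<Omega> D + LV_\<Sigma> D) * ?vol * (lg2 D r + lg1 D r) + LV_outer D * ?vol * (lg1 D r + lg3 D r)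
      = step_factor D r * ?vol"
    by (simp add: step_factor_def algebra_simps)
  moreover have "step_factor D r * ?vol < inverse (step_size D \<nu>) * C_energy D * ?vol"
    using small k volume_cell_pos[OF i] by (intro mult_strict_right_mono) (simp_all add: field_simps)
  ultimately show ?thesis
    by (simp add: divide_inverse algebra_simps)
qed

section \<open>One time step and the whole scheme\<close>

lemma a_priori_step:
  assumes \<nu>: "\<nu> \<in> {1..N_steps D}"
    and w: "\<And>i. i \<in> cells D \<Longrightarrow> w i \<in> {lower_bound D..upper_bound D (\<nu> - 1)}"
    and u: "\<And>i. i \<in> cells D \<Longrightarrow> 0 \<le> u i" and sol: "\<And>i. i \<in> cells D \<Longrightarrow> \<H> D \<nu> i w u = 0"
    and j: "j \<in> cells D"
  shows "u j \<in> {lower_bound D..upper_bound D \<nu>}"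
proof -
  have zero: "residual \<nu> w i (u i) u = 0" if "i \<in> cells D" for i
    using sol[OF that] \<H>_eq_residual[OF that] by simp
  have c: "0 < inverse (step_size D \<nu>) * C_energy D"
    using step_size_pos[OF \<nu>] C_energy_pos by simp
  obtain i where i: "i \<in> cells D" "\<And>j. j \<in> cells D \<Longrightarrow> u j \<le> u i"
    using obtain_maximum[OF finite_cells cells_nonempty, of u] by blast
  have "u i \<le> upper_bound D \<nu>"
  proof (rule ccontr)
    assume "\<not> u i \<le> upper_bound D \<nu>"
    then have gt: "upper_bound D \<nu> < u i" by simp
    have "inverse (step_size D \<nu>) * C_energy D * (u i - upper_bound D \<nu>) * volume (\<omega> D i) \<le> residual \<nu> w i (u i) u"
      using w[OF i(1)] lower_bound_nonneg gt u i by (intro residual_above[OF \<nu> i(1)]) auto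
    moreover have "0 < inverse (step_size D \<nu>) * C_energy D * (u i - upper_bound D \<nu>) * volume (\<omega> D i)"
      using c gt volume_cell_pos[OF i(1)] by simp
    ultimately show False using zero[OF i(1)] by linarith
  qed
  moreover obtain k where k: "k \<in> cells D" "\<And>j. j \<in> cells D \<Longrightarrow> - u j \<le> - u k"
    using obtain_maximum[OF finite_cells cells_nonempty, of "\<lambda>j. - u j"] by blast
  have "lower_bound D \<le> u k"
  proof (rule ccontr)
    assume "\<not> lower_bound D \<le> u k"
    then have lt: "u k < lower_bound D" by simp
    \<comment> \<open>The old value is at least the lower bound, so the temperature has dropped
      strictly and the residual is strictly negative.\<close>
    have wk: "u k < w k" using w[OF k(1)] lt by auto
    have "residual \<nu> w k (u k) u \<le> - (inverse (step_size D \<nu>) * C_energy D * (w k - u k) * volume (\<omega> D k))"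
      using wk lt lower_le_\<theta>ext u k by (intro residual_below[OF \<nu> k(1)]) auto
    moreover have "0 < inverse (step_size D \<nu>) * C_energy D * (w k - u k) * volume (\<omega> D k)"
      using c wk volume_cell_pos[OF k(1)] by simp
    ultimately show False using zero[OF k(1)] by linarith
  qed
  ultimately show ?thesis using i(2)[OF j] k(2)[OF j] by auto
qed

lemma a_priori_bounds:
  assumes sol: "fv_solution D u" and \<nu>: "\<nu> \<le> N_steps D" and i: "i \<in> cells D"
  shows "u \<nu> i \<in> {lower_bound D..upper_bound D \<nu>}"
  using \<nu> i
proof (induction \<nu> arbitrary: i)
  case 0
  then show ?case using sol init_bounds by (auto simp: fv_solution_def)
next
  case (Suc \<nu>)
  show ?case
  proof (rule a_priori_step[of "Suc \<nu>" "u \<nu>"])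
    show "u \<nu> i \<in> {lower_bound D..upper_bound D (Suc \<nu> - 1)}" if "i \<in> cells D" for i
      using Suc.IH[OF _ that] Suc.prems by simp
    show "0 \<le> u (Suc \<nu>) i" if "i \<in> cells D" for i
      using sol Suc.prems(1) that by (auto simp: fv_solution_def PiE_iff)
    have "Suc \<nu> \<in> {1..N_steps D}" using Suc.prems(1) by auto
    then have "\<forall>i\<in>cells D. \<H> D (Suc \<nu>) i (u (Suc \<nu> - 1)) (u (Suc \<nu>)) = 0"
      using sol unfolding fv_solution_def by blast
    then show "\<H> D (Suc \<nu>) i (u \<nu>) (u (Suc \<nu>)) = 0" if "i \<in> cells D" for i
      using that by simp
  qed (use Suc.prems in auto)
qed

text \<open>With the total conductance as common part, \<open>p\<close> is the remaining slope and
  \<open>q\<close> the Lipschitz constant of the irradiation term; \<open>step_condition\<close>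
  provides q < p.\<close>

lemma step_exists_unique:
  assumes \<nu>: "\<nu> \<in> {1..N_steps D}"
    and small: "step_size D \<nu> * step_factor D (upper_bound D \<nu>) < C_energy D"
    and w: "\<And>i. i \<in> cells D \<Longrightarrow> w i \<in> {lower_bound D..upper_bound D (\<nu> - 1)}"
  obtains u where "u \<in> cells D \<rightarrow>\<^sub>E {lower_bound D..upper_bound D \<nu>}"
    "\<And>i. i \<in> cells D \<Longrightarrow> \<H> D \<nu> i w u = 0"
    "\<forall>v\<in>cells D \<rightarrow>\<^sub>E {lower_bound D..upper_bound D \<nu>}. (\<forall>i\<in>cells D. \<H> D \<nu> i w v = 0) \<longrightarrow> v = u"
proof -
  let ?l = "lower_bound D" and ?r = "upper_bound D \<nu>"
  let ?L = "Lip_const (emissivity D) ?r"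
  define p where "p i = inverse (step_size D \<nu>) * C_energy D * volume (\<omega> D i)
      - boltzmann D * radiating_area D i * (2 * ?L * ?r ^ 4)
      - boltzmann D * outer_area D i * (?L * ?r ^ 4 + ?L * \<theta>ext D ^ 4)" for i
  define q where "q i = boltzmann D * radiating_area D i * (4 * ?r ^ 3 + ?L * ?r ^ 4 / min_val (emissivity D) ?r)" for i
  have r: "\<theta>ext D \<le> ?r" using \<theta>ext_le_upper \<nu> by auto
  have l0: "0 \<le> ?l" by (rule lower_bound_nonneg)
  have r0: "0 \<le> ?r" using r \<theta>ext_pos by linarith
  have box: "0 \<le> v j \<and> v j \<le> ?r" if "v \<in> cells D \<rightarrow> {?l..?r}" "j \<in> cells D" for v j
    using funcset_mem[OF that] l0 by auto
  obtain u where u: "u \<in> cells D \<rightarrow> {?l..?r}" "\<And>i. i \<in> cells D \<Longrightarrow> residual \<nu> w i (u i) u = 0"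
    "\<forall>v\<in>cells D \<rightarrow> {?l..?r}. (\<forall>i\<in>cells D. residual \<nu> w i (v i) v = 0) \<longrightarrow> (\<forall>i\<in>cells D. v i = u i)"
  proof (rule implicit_system_solution[where I = "cells D" and l = ?l and r = ?r and F = "residual \<nu> w"
        and d = "total_conductance D" and p = p and q = q])
    show "finite (cells D)" by (rule finite_cells)
    show "?l \<le> ?r" using lower_le_\<theta>ext r by linarith
    show "residual \<nu> w i ?l v \<le> 0" if i: "i \<in> cells D" and v: "v \<in> cells D \<rightarrow> {?l..?r}" for i v
    proof -
      have "residual \<nu> w i ?l v \<le> - (inverse (step_size D \<nu>) * C_energy D * (w i - ?l) * volume (\<omega> D i))"
        using l0 lower_le_\<theta>ext w[OF i] v by (intro residual_below[OF \<nu> i]) (auto dest: funcset_mem)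
      also have "\<dots> \<le> 0"
        using step_size_pos[OF \<nu>] C_energy_pos w[OF i] volume_cell_pos[OF i] by simp
      finally show ?thesis .
    qed
    show "0 \<le> residual \<nu> w i ?r v" if i: "i \<in> cells D" and v: "v \<in> cells D \<rightarrow> {?l..?r}" for i v
    proof -
      have "inverse (step_size D \<nu>) * C_energy D * (?r - ?r) * volume (\<omega> D i) \<le> residual \<nu> w i ?r v"
        using w[OF i] l0 box[OF v] by (intro residual_above[OF \<nu> i]) auto
      then show ?thesis by simp
    qed
    show "continuous_on {?l..?r} (\<lambda>s. residual \<nu> w i s v)" for i v
      by (rule residual_continuous[OF l0])
    show "(total_conductance D i + p i) * (t - s) \<le> residual \<nu> w i t v - residual \<nu> w i s v"
      if "i \<in> cells D" "v \<in> cells D \<rightarrow> {?l..?r}" "?l \<le> s" "s \<le> t" "t \<le> ?r" for i v s t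
      unfolding p_def using that l0 box[OF that(2)] by (intro residual_slope[OF \<nu> that(1) r]) auto
    show "\<bar>residual \<nu> w i s v - residual \<nu> w i s v'\<bar> \<le> (total_conductance D i + q i) * \<delta>"
      if "i \<in> cells D" "v \<in> cells D \<rightarrow> {?l..?r}" "v' \<in> cells D \<rightarrow> {?l..?r}" "s \<in> {?l..?r}"
        "\<And>j. j \<in> cells D \<Longrightarrow> \<bar>v j - v' j\<bar> \<le> \<delta>" for i v v' s \<delta>
      unfolding q_def using that l0 by (intro residual_Lipschitz[OF that(1) r _ box[OF that(2)] box[OF that(3)]]) auto
    show "0 \<le> total_conductance D i \<and> 0 \<le> q i \<and> q i < p i" if "i \<in> cells D" for i
      using step_condition[OF \<nu> that r small] areas_nonneg r0 boltzmann_pos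
        Lip_const_nonneg[OF r0] min_val_pos[OF r0] by (simp add: p_def q_def)
  qed (rule that)
  \<comment> \<open>The fixed point is determined on the cells only; restriction makes it
    extensional, as the uniqueness claim requires.\<close>
  let ?u = "restrict u (cells D)"
  have cong: "\<H> D \<nu> i w ?u = residual \<nu> w i (u i) u" if i: "i \<in> cells D" for i
  proof -
    have "irradiation ?u i = irradiation u i"
    proof -
      \<comment> \<open>Agreement on the cells suffices, by the Lipschitz estimate with \<delta> =
        0.\<close>
      have "irradiation ?u i - irradiation u i = 0"
        using irradiation_Lipschitz[OF i, of ?u ?r u 0] box[OF u(1)] r by simp
      then show ?thesis by simp
    qed
    moreover have "(\<Sum>j\<in>nb\<^sub>m D p i. conductance D i p j * (u i - ?u j))
        = (\<Sum>j\<in>nb\<^sub>m D p i. conductance D i p j * (u i - u j))" for p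
      using nb\<^sub>m_subset by (intro sum.cong refl) auto
    ultimately show ?thesis unfolding \<H>_eq_residual[OF i] residual_def using i by simp
  qed
  have box': "?u \<in> cells D \<rightarrow>\<^sub>E {?l..?r}" using u(1) by auto
  then show ?thesis
  proof (rule that)
    show "\<H> D \<nu> i w ?u = 0" if "i \<in> cells D" for i using cong[OF that] u(2)[OF that] by simp
    show "\<forall>v\<in>cells D \<rightarrow>\<^sub>E {?l..?r}. (\<forall>i\<in>cells D. \<H> D \<nu> i w v = 0) \<longrightarrow> v = ?u"
    proof (intro ballI impI)
      fix v assume v: "v \<in> cells D \<rightarrow>\<^sub>E {?l..?r}" "\<forall>i\<in>cells D. \<H> D \<nu> i w v = 0"
      then have "v \<in> cells D \<rightarrow> {?l..?r}" "\<forall>i\<in>cells D. residual \<nu> w i (v i) v = 0"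
        by (auto simp: PiE_iff \<H>_eq_residual)
      then have "\<forall>i\<in>cells D. v i = u i" using u(3) by blast
      then show "v = ?u" by (intro PiE_ext[OF v(1) box']) simp
    qed
  qed
qed

text \<open>Existence marches through the time levels. Uniqueness concerns all nonnegative
  solutions, while a single step is known to be unique only within its box; the a priori bounds
  place every solution in these boxes.\<close>

lemma solution_exists_unique:
  assumes small: "\<And>\<nu>. \<nu> \<in> {1..N_steps D} \<Longrightarrow> step_size D \<nu> * step_factor D (upper_bound D \<nu>) < C_energy D"
  shows "\<exists>!u. fv_solution D u"
proof -
  let ?box = "\<lambda>\<nu>. cells D \<rightarrow>\<^sub>E {lower_bound D..upper_bound D \<nu>}"
  have "\<exists>u. u \<in> ?box \<nu> \<and> (\<forall>i\<in>cells D. \<H> D \<nu> i w u = 0)"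
    if "\<nu> \<in> {1..N_steps D}" "w \<in> ?box (\<nu> - 1)" for \<nu> w
    using step_exists_unique[OF that(1) small[OF that(1)], of w] that(2) by (metis PiE_mem)
  then have "\<forall>\<nu> w. \<exists>u. \<nu> \<in> {1..N_steps D} \<and> w \<in> ?box (\<nu> - 1) \<longrightarrow> u \<in> ?box \<nu> \<and> (\<forall>i\<in>cells D. \<H> D \<nu> i w u = 0)"
    by blast
  then obtain S where S: "\<And>\<nu> w. \<nu> \<in> {1..N_steps D} \<Longrightarrow> w \<in> ?box (\<nu> - 1) \<Longrightarrow>
      S \<nu> w \<in> ?box \<nu> \<and> (\<forall>i\<in>cells D. \<H> D \<nu> i w (S \<nu> w) = 0)"
    unfolding choice_iff by blast
  define x where "x = rec_nat (restrict (init_approx D) (cells D)) (\<lambda>\<nu>. S (Suc \<nu>))"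
  have x0: "x 0 = restrict (init_approx D) (cells D)" and xS: "x (Suc \<nu>) = S (Suc \<nu>) (x \<nu>)" for \<nu>
    by (simp_all add: x_def)
  have x: "x \<nu> \<in> ?box \<nu>" if "\<nu> \<le> N_steps D" for \<nu>
    using that
  proof (induction \<nu>)
    case 0
    then show ?case unfolding x0 using init_bounds by auto
  next
    case (Suc \<nu>)
    then show ?case unfolding xS using S[of "Suc \<nu>" "x \<nu>"] by auto
  qed
  let ?u = "restrict x {0..N_steps D}"
  have "fv_solution D ?u"
    unfolding fv_solution_def
  proof (intro conjI ballI)
    have "x \<nu> \<in> cells D \<rightarrow>\<^sub>E {0..}" if "\<nu> \<le> N_steps D" for \<nu>
      using x[OF that] lower_bound_nonneg by (force simp: PiE_iff)
    then show "?u \<in> {0..N_steps D} \<rightarrow>\<^sub>E (cells D \<rightarrow>\<^sub>E {0..})" by auto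
    show "?u 0 i = init_approx D i" if "i \<in> cells D" for i using that by (simp add: x0)
    fix \<nu> i assume \<nu>: "\<nu> \<in> {1..N_steps D}" and i: "i \<in> cells D"
    have "x \<nu> = S \<nu> (x (\<nu> - 1))" using xS[of "\<nu> - 1"] \<nu> by simp
    moreover have "\<nu> - 1 \<le> N_steps D" using \<nu> by auto
    ultimately show "\<H> D \<nu> i (?u (\<nu> - 1)) (?u \<nu>) = 0"
      using S[OF \<nu> x[of "\<nu> - 1"]] \<nu> i by simp
  qed
  moreover have "u = v" if u: "fv_solution D u" and v: "fv_solution D v" for u v
  proof (rule PiE_ext)
    show "u \<in> {0..N_steps D} \<rightarrow>\<^sub>E (cells D \<rightarrow>\<^sub>E {0..})" "v \<in> {0..N_steps D} \<rightarrow>\<^sub>E (cells D \<rightarrow>\<^sub>E {0..})"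
      using u v by (auto simp: fv_solution_def)
    have box: "s \<nu> \<in> ?box \<nu>" if s: "fv_solution D s" and "\<nu> \<le> N_steps D" for s \<nu>
      using a_priori_bounds[OF s that(2)] s that(2) by (auto simp: fv_solution_def PiE_iff)
    fix \<nu> assume "\<nu> \<in> {0..N_steps D}"
    then have "\<nu> \<le> N_steps D" by simp
    then show "u \<nu> = v \<nu>"
    proof (induction \<nu>)
      case 0
      show ?case by (rule PiE_ext[OF box[OF u] box[OF v]]) (use u v in \<open>auto simp: fv_solution_def\<close>)
    next
      case (Suc \<nu>)
      then have \<nu>: "Suc \<nu> \<in> {1..N_steps D}" by auto
      have "\<forall>i\<in>cells D. \<H> D (Suc \<nu>) i (u (Suc \<nu> - 1)) (u (Suc \<nu>)) = 0"
        "\<forall>i\<in>cells D. \<H> D (Suc \<nu>) i (v (Suc \<nu> - 1)) (v (Suc \<nu>)) = 0"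
        using u v \<nu> unfolding fv_solution_def by blast+
      then have zero: "\<H> D (Suc \<nu>) i (u \<nu>) (u (Suc \<nu>)) = 0" "\<H> D (Suc \<nu>) i (u \<nu>) (v (Suc \<nu>)) = 0"
        if "i \<in> cells D" for i using Suc that by simp_all
      have bounds: "u \<nu> i \<in> {lower_bound D..upper_bound D (Suc \<nu> - 1)}" if "i \<in> cells D" for i
        using a_priori_bounds[OF u _ that] Suc.prems by simp
      obtain y where y: "\<forall>v\<in>?box (Suc \<nu>). (\<forall>i\<in>cells D. \<H> D (Suc \<nu>) i (u \<nu>) v = 0) \<longrightarrow> v = y"
        by (rule step_exists_unique[where w = "u \<nu>", OF \<nu> small[OF \<nu>] bounds]) (assumption, rule that)
      have "u (Suc \<nu>) = y" using y box[OF u Suc.prems] zero(1) by blast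
      moreover have "v (Suc \<nu>) = y" using y box[OF v Suc.prems] zero(2) by blast
      ultimately show ?case by simp
    qed
  qed
  ultimately show ?thesis by blast
qed

text \<open>M_\<nu> increases with \<nu> and is positive because of \<theta>ext, so monotonicity of
  the step factor applies.\<close>

lemma max_step_condition:
  assumes small: "(MAX \<nu>\<in>{1..N_steps D}. step_size D \<nu>) * step_factor D (upper_bound D (N_steps D)) < C_energy D"
    and \<nu>: "\<nu> \<in> {1..N_steps D}"
  shows "step_size D \<nu> * step_factor D (upper_bound D \<nu>) < C_energy D"
proof -
  have pos: "0 < upper_bound D \<nu>" using \<theta>ext_le_upper[of \<nu>] \<theta>ext_pos \<nu> by force
  have le: "upper_bound D \<nu> \<le> upper_bound D (N_steps D)" using \<nu> by (intro upper_bound_mono) auto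
  have k: "step_size D \<nu> \<le> (MAX \<nu>\<in>{1..N_steps D}. step_size D \<nu>)" using \<nu> by (intro Max_ge) auto
  have "step_size D \<nu> * step_factor D (upper_bound D \<nu>)
      \<le> (MAX \<nu>\<in>{1..N_steps D}. step_size D \<nu>) * step_factor D (upper_bound D (N_steps D))"
    using step_size_pos[OF \<nu>] k step_factor_nonneg pos by (intro mult_mono[OF k step_factor_mono[OF pos le]]) auto
  then show ?thesis using small by linarith
qed

end

theorem corollary2:
  fixes D :: "('i, 'a) fv_data"
  assumes "fv_setting D"
  shows "(\<forall>u. fv_solution D u \<longrightarrow>
            (\<forall>\<nu>\<in>{0..N_steps D}. u \<nu> \<in> cells D \<rightarrow>\<^sub>E {lower_bound D..upper_bound D \<nu>}))
       \<and> ((\<forall>\<nu>\<in>{1..N_steps D}. step_size D \<nu> * step_factor D (upper_bound D \<nu>) < C_energy D) \<longrightarrow>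
            (\<exists>!u. fv_solution D u))
       \<and> ((MAX \<nu>\<in>{1..N_steps D}. step_size D \<nu>) * step_factor D (upper_bound D (N_steps D)) < C_energy D \<longrightarrow>
            (\<forall>\<nu>\<in>{1..N_steps D}. step_size D \<nu> * step_factor D (upper_bound D \<nu>) < C_energy D))"
proof -
  interpret fv_setting D by (rule assms)
  have "u \<nu> \<in> cells D \<rightarrow>\<^sub>E {lower_bound D..upper_bound D \<nu>}"
    if "fv_solution D u" "\<nu> \<in> {0..N_steps D}" for u \<nu>
    using a_priori_bounds[OF that(1)] that by (auto simp: fv_solution_def PiE_iff)
  then show ?thesis using solution_exists_unique max_step_condition by blast
qed

end
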